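(* Consider EC-SGD as described in the context. (1) Assume that $f_\xi(x)$ is convex and $L$-smooth in $x$ for every $\xi$ and $f$ is $\mu$-quasi strongly convex, $\mu\ge0$. Let $0<\gamma\le\frac{\delta}{8L\sqrt{6+9\delta}}$. Then EC-SGD satisfies the parametric assumption of the context with $A=A'=2L$, $\widetilde A=6L$, $B_1=\widetilde B_1=B_1'=B_2=\widetilde B_2=B_2'=0$, $$D_1=\frac2n\sum_{i=1}^n\|\nabla f_i(x^* )\|^2,\quad\widetilde D_1=\frac2n\sum_{i=1}^n\mathbf E\|\nabla f_{\xi_i}(x^* )-\nabla f_i(x^* )\|^2,\quad D_1'=\frac2{n^2}\sum_{i=1}^n\mathbf E\|\nabla f_{\xi_i}(x^* )-\nabla f_i(x^* )\|^2,$$ $\sigma_{1,k}^2\equiv\sigma_{2,k}^2\equiv0$, $\rho_1=\rho_2=1$, $C_1=C_2=0$, $G=0$, $D_2=0$, $F_1=F_2=0$, $D_3=\frac{6L\gamma}\delta\left(\frac{2D_1}\delta+\widetilde D_1\right)$, and for all $K\ge0$ $$\mathbf E[f(\bar x^K)-f(x^* )]\le\left(1-\frac{\gamma\mu}2\right)^K\frac{4\|x^0-x^*\|^2}\gamma+4\gamma\left(D_1'+\frac{12L\gamma}{\delta^2}D_1+\frac{6L\gamma}\delta\widetilde D_1\right)$$ when $\mu>0$, and $$\mathbf E[f(\bar x^K)-f(x^* )]\le\frac{4\|x^0-x^*\|^2}{K\gamma}+4\gamma\left(D_1'+\frac{12L\gamma}{\delta^2}D_1+\frac{6L\gamma}\delta\widetilde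 D_1\right)$$ when $\mu=0$ (right-hand side read as $+\infty$ for $K=0$). (2) If instead $f$ is $\mu$-strongly convex with $\mu>0$ and $f_i,f_{\xi_i}$ are possibly non-convex, then, with $\kappa=\frac L\mu$ and $0<\gamma\le\min\left\{\frac1{8\kappa L},\frac{\delta}{8L\sqrt{3\kappa(2+3\delta)}}\right\}$, EC-SGD satisfies the parametric assumption with $A=A'=2L\kappa$, $\widetilde A=6L\kappa$ and all other parameters given by the same expressions as in (1), and for all $K\ge0$ $$\mathbf E[f(\bar x^K)-f(x^* )]\le\left(1-\frac{\gamma\mu}2\right)^K\frac{4\|x^0-x^*\|^2}\gamma+4\gamma\left(D_1'+\frac{12L\gamma}{\delta^2}D_1+\frac{6L\gamma}\delta\widetilde D_1\right).$$
   Context: $f(x)=\frac1n\sum_{i=1}^nf_i(x)$ on $\mathbb R^d$, $f_i(x)=\mathbf E_{\xi_i\sim\mathcal D_i}[f_{\xi_i}(x)]$, where $f_{\xi_i}$ is differentiable and $L$-smooth (gradient $L$-Lipschitz) almost surely in $\xi_i$, with $\mathbf E[\nabla f_{\xi_i}(x)]=\nabla f_i(x)$. $f$ is $\mu$-quasi strongly convex if it has a unique minimizer $x^*$ and $f(x^* )\ge f(x)+\langle\nabla f(x),x^*-x\rangle+\frac\mu2\|x-x^*\|^2$ for all $x$. $\mathcal C$ is a (possibly randomized) compression operator with $\mathbf E\|\mathcal C(x)-x\|^2\le(1-\delta)\|x\|^2$ for all $x$, $\delta\in(0,1]$; every application uses fresh independent randomness. EC-SGD: given deterministic $x^0\in\mathbb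 R^d$, $e_i^0=0$; at iteration $k\ge0$ each worker $i$ samples $\xi_i^k\sim\mathcal D_i$ (independently over $i$ and $k$), sets $g_i^k=\nabla f_{\xi_i^k}(x^k)$, $v_i^k=\mathcal C(e_i^k+\gamma g_i^k)$, $e_i^{k+1}=e_i^k+\gamma g_i^k-v_i^k$; then $x^{k+1}=x^k-\frac1n\sum_iv_i^k$. Parametric assumption: let $g^k=\frac1n\sum_ig_i^k$, $e^k=\frac1n\sum_ie_i^k$, $\mathbf E_k$ the conditional expectation given all randomness generated before iteration $k$, $\bar g_i^k=\mathbf E_k[g_i^k]$. For all $k,K\ge0$: $\mathbf E_k[g^k]=\nabla f(x^k)$; $\frac1n\sum_i\|\bar g_i^k\|^2\le2A(f(x^k)-f(x^* ))+B_1\sigma_{1,k}^2+B_2\sigma_{2,k}^2+D_1$; $\frac1n\sum_i\mathbf E_k\|g_i^k-\bar g_i^k\|^2\le2\widetilde A(f(x^k)-f(x^* ))+\widetilde B_1\sigma_{1,k}^2+\widetilde B_2\sigma_{2,k}^2+\widetilde D_1$; $\mathbf E_k\|g^k\|^2\le2A'(f(x^k)-f(x^* ))+B_1'\sigma_{1,k}^2+B_2'\sigma_{2,k}^2+D_1'$; $\mathbf E_k[\sigma_{1,k+1}^2]\le(1-\rho_1)\sigma_{1,k}^2+2C_1(f(x^k)-f(x^* ))+G\rho_1\sigma_{2,k}^2+D_2$; $\mathbf E_k[\sigma_{2,k+1}^2]\le(1-\rho_2)\sigma_{2,k}^2+2C_2(f(x^k)-f(x^* ))$; $3L\sum_{k=0}^Kw_k\mathbf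 E\|e^k\|^2\le\frac14\sum_{k=0}^Kw_k\mathbf E[f(x^k)-f(x^* )]+F_1\sigma_{1,0}^2+F_2\sigma_{2,0}^2+\gamma D_3W_K$, where $w_k=(1-\eta)^{-(k+1)}$, $W_K=\sum_{k=0}^Kw_k$, $\eta=\min\{\frac{\gamma\mu}2,\frac{\rho_1}4,\frac{\rho_2}4\}$. Also $\bar x^K=\frac1{W_K}\sum_{k=0}^Kw_kx^k$. *)

theory Defs
  imports "HOL-Probability.Probability"
begin

definition grad :: "('a::euclidean_space \<Rightarrow> real) \<Rightarrow> 'a \<Rightarrow> 'a" where
  "grad h x = (THE D. GDERIV h x :> D)"

definition L_smooth :: "real \<Rightarrow> ('a::euclidean_space \<Rightarrow> real) \<Rightarrow> bool" where
  "L_smooth L h \<longleftrightarrow> (\<forall>x. h differentiable (at x)) \<and> L-lipschitz_on UNIV (grad h)"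

definition strongly_convex :: "real \<Rightarrow> ('a::euclidean_space \<Rightarrow> real) \<Rightarrow> bool" where
  "strongly_convex \<mu> h \<longleftrightarrow>
     (\<forall>x y. h y \<ge> h x + grad h x \<bullet> (y - x) + \<mu> / 2 * (norm (y - x))\<^sup>2)"

definition quasi_strongly_convex :: "real \<Rightarrow> ('a::euclidean_space \<Rightarrow> real) \<Rightarrow> 'a \<Rightarrow> bool" where
  "quasi_strongly_convex \<mu> h xs \<longleftrightarrow>
     {y. \<forall>x. h y \<le> h x} = {xs} \<and>
     (\<forall>x. h xs \<ge> h x + grad h x \<bullet> (xs - x) + \<mu> / 2 * (norm (x - xs))\<^sup>2)"

definition avg :: "nat \<Rightarrow> (nat \<Rightarrow> 'a::real_vector) \<Rightarrow> 'a" where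
  "avg n h = (1 / real n) *\<^sub>R (\<Sum>i<n. h i)"

definition local_obj :: "(nat \<Rightarrow> 'z measure) \<Rightarrow> ('z \<Rightarrow> 'a \<Rightarrow> real) \<Rightarrow> nat \<Rightarrow> 'a::euclidean_space \<Rightarrow> real" where
  "local_obj \<D> F i x = (\<integral>z. F z x \<partial>\<D> i)"

definition global_obj :: "nat \<Rightarrow> (nat \<Rightarrow> 'z measure) \<Rightarrow> ('z \<Rightarrow> 'a \<Rightarrow> real) \<Rightarrow> 'a::euclidean_space \<Rightarrow> real" where
  "global_obj n \<D> F x = avg n (\<lambda>i. local_obj \<D> F i x)"

text \<open>Joint measurability of the stochastic gradient makes the compositions occurring in the
  method random variables; the integrability clauses give the expectations their meaning.\<close>

definition stochastic_problem ::
    "nat \<Rightarrow> (nat \<Rightarrow> 'z measure) \<Rightarrow> ('z \<Rightarrow> 'a::euclidean_space \<Rightarrow> real) \<Rightarrow> real \<Rightarrow> bool" where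
  "stochastic_problem n \<D> F L \<longleftrightarrow> 0 < n \<and> 0 < L \<and>
     (\<forall>i<n. prob_space (\<D> i) \<and>
        (\<lambda>(z, x). grad (F z) x) \<in> borel_measurable (\<D> i \<Otimes>\<^sub>M borel) \<and>
        (AE z in \<D> i. L_smooth L (F z)) \<and>
        (\<forall>x. integrable (\<D> i) (\<lambda>z. F z x) \<and>
             integrable (\<D> i) (\<lambda>z. grad (F z) x) \<and>
             local_obj \<D> F i differentiable (at x) \<and>
             (\<integral>z. grad (F z) x \<partial>\<D> i) = grad (local_obj \<D> F i) x))"

text \<open>A randomized operator is a map \<open>C r x\<close> with \<open>r\<close> drawn from \<open>R\<close>.\<close>

definition compression_operator ::
    "'r measure \<Rightarrow> ('r \<Rightarrow> 'a::euclidean_space \<Rightarrow> 'a) \<Rightarrow> real \<Rightarrow> bool" where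
  "compression_operator R C \<delta> \<longleftrightarrow> prob_space R \<and> 0 < \<delta> \<and> \<delta> \<le> 1 \<and>
     (\<lambda>(r, x). C r x) \<in> borel_measurable (R \<Otimes>\<^sub>M borel) \<and>
     (\<forall>x. integrable R (\<lambda>r. (norm (C r x - x))\<^sup>2) \<and>
          (\<integral>r. (norm (C r x - x))\<^sup>2 \<partial>R) \<le> (1 - \<delta>) * (norm x)\<^sup>2)"

text \<open>\<open>\<xi> k i\<close> is the sample and \<open>\<zeta> k i\<close> the compressor randomness of worker \<open>i\<close> at iteration \<open>k\<close>.
  Independence of the pairs together with their product law makes all these variables, over
  all \<open>k\<close> and all \<open>i < n\<close>, jointly independent.\<close>

definition fresh_randomness ::
    "'w measure \<Rightarrow> nat \<Rightarrow> (nat \<Rightarrow> 'z measure) \<Rightarrow> 'r measure \<Rightarrow>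
     (nat \<Rightarrow> nat \<Rightarrow> 'w \<Rightarrow> 'z) \<Rightarrow> (nat \<Rightarrow> nat \<Rightarrow> 'w \<Rightarrow> 'r) \<Rightarrow> bool" where
  "fresh_randomness M n \<D> R \<xi> \<zeta> \<longleftrightarrow> prob_space M \<and>
     prob_space.indep_vars M (\<lambda>(k, i). \<D> i \<Otimes>\<^sub>M R) (\<lambda>(k, i) \<omega>. (\<xi> k i \<omega>, \<zeta> k i \<omega>)) (UNIV \<times> {..<n}) \<and>
     (\<forall>k. \<forall>i<n. distr M (\<D> i \<Otimes>\<^sub>M R) (\<lambda>\<omega>. (\<xi> k i \<omega>, \<zeta> k i \<omega>)) = \<D> i \<Otimes>\<^sub>M R)"

text \<open>The \<open>\<sigma>\<close>-algebra of all randomness generated before iteration \<open>k\<close>.\<close>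

definition history ::
    "'w measure \<Rightarrow> nat \<Rightarrow> (nat \<Rightarrow> 'z measure) \<Rightarrow> 'r measure \<Rightarrow>
     (nat \<Rightarrow> nat \<Rightarrow> 'w \<Rightarrow> 'z) \<Rightarrow> (nat \<Rightarrow> nat \<Rightarrow> 'w \<Rightarrow> 'r) \<Rightarrow> nat \<Rightarrow> 'w measure" where
  "history M n \<D> R \<xi> \<zeta> k = sigma (space M)
     ({\<xi> j i -` S \<inter> space M |j i S. j < k \<and> i < n \<and> S \<in> sets (\<D> i)} \<union>
      {\<zeta> j i -` S \<inter> space M |j i S. j < k \<and> i < n \<and> S \<in> sets R})"

text \<open>Conditional expectation of a vector-valued random variable, taken coordinatewise.\<close>

definition vec_cond_exp ::
    "'w measure \<Rightarrow> 'w measure \<Rightarrow> ('w \<Rightarrow> 'a::euclidean_space) \<Rightarrow> 'w \<Rightarrow> 'a" where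
  "vec_cond_exp M H X \<omega> = (\<Sum>b\<in>Basis. real_cond_exp M H (\<lambda>\<omega>'. X \<omega>' \<bullet> b) \<omega> *\<^sub>R b)"

definition ec_sgd ::
    "'w measure \<Rightarrow> nat \<Rightarrow> ('z \<Rightarrow> 'a::euclidean_space \<Rightarrow> real) \<Rightarrow> ('r \<Rightarrow> 'a \<Rightarrow> 'a) \<Rightarrow> real \<Rightarrow> 'a \<Rightarrow>
     (nat \<Rightarrow> nat \<Rightarrow> 'w \<Rightarrow> 'z) \<Rightarrow> (nat \<Rightarrow> nat \<Rightarrow> 'w \<Rightarrow> 'r) \<Rightarrow>
     (nat \<Rightarrow> 'w \<Rightarrow> 'a) \<Rightarrow> (nat \<Rightarrow> nat \<Rightarrow> 'w \<Rightarrow> 'a) \<Rightarrow>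
     (nat \<Rightarrow> nat \<Rightarrow> 'w \<Rightarrow> 'a) \<Rightarrow> (nat \<Rightarrow> nat \<Rightarrow> 'w \<Rightarrow> 'a) \<Rightarrow> bool" where
  "ec_sgd M n F C \<gamma> x0 \<xi> \<zeta> x e g v \<longleftrightarrow>
     (\<forall>\<omega>\<in>space M.
        x 0 \<omega> = x0 \<and> (\<forall>i<n. e 0 i \<omega> = 0) \<and>
        (\<forall>k. (\<forall>i<n.
                g k i \<omega> = grad (F (\<xi> k i \<omega>)) (x k \<omega>) \<and>
                v k i \<omega> = C (\<zeta> k i \<omega>) (e k i \<omega> + \<gamma> *\<^sub>R g k i \<omega>) \<and>
                e (Suc k) i \<omega> = e k i \<omega> + \<gamma> *\<^sub>R g k i \<omega> - v k i \<omega>) \<and>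
             x (Suc k) \<omega> = x k \<omega> - avg n (\<lambda>i. v k i \<omega>)))"

text \<open>The parameters of the parametric assumption. The suffixes \<open>t\<close> and \<open>p\<close> stand for tilde
  and prime; \<open>sig1 k\<close> and \<open>sig2 k\<close> are the random variables \<open>\<sigma>\<^sub>1\<^sub>,\<^sub>k\<close> and \<open>\<sigma>\<^sub>2\<^sub>,\<^sub>k\<close>, not their
  squares.\<close>

record 'w ec_params =
  cA :: real  cAt :: real  cAp :: real
  cB1 :: real  cB1t :: real  cB1p :: real
  cB2 :: real  cB2t :: real  cB2p :: real
  cC1 :: real  cC2 :: real
  cD1 :: real  cD1t :: real  cD1p :: real  cD2 :: real  cD3 :: real
  cF1 :: real  cF2 :: real  cG :: real
  rho1 :: real  rho2 :: real
  sig1 :: "nat \<Rightarrow> 'w \<Rightarrow> real"  sig2 :: "nat \<Rightarrow> 'w \<Rightarrow> real"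

definition rate :: "real \<Rightarrow> real \<Rightarrow> 'w ec_params \<Rightarrow> real" where
  "rate \<gamma> \<mu> P = min (\<gamma> * \<mu> / 2) (min (rho1 P / 4) (rho2 P / 4))"

definition weight :: "real \<Rightarrow> real \<Rightarrow> 'w ec_params \<Rightarrow> nat \<Rightarrow> real" where
  "weight \<gamma> \<mu> P k = 1 / (1 - rate \<gamma> \<mu> P) ^ (k + 1)"

definition weight_sum :: "real \<Rightarrow> real \<Rightarrow> 'w ec_params \<Rightarrow> nat \<Rightarrow> real" where
  "weight_sum \<gamma> \<mu> P K = (\<Sum>k\<le>K. weight \<gamma> \<mu> P k)"

definition weighted_iterate ::
    "real \<Rightarrow> real \<Rightarrow> 'w ec_params \<Rightarrow> (nat \<Rightarrow> 'w \<Rightarrow> 'a::real_vector) \<Rightarrow> nat \<Rightarrow> 'w \<Rightarrow> 'a" where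
  "weighted_iterate \<gamma> \<mu> P x K \<omega> =
     (1 / weight_sum \<gamma> \<mu> P K) *\<^sub>R (\<Sum>k\<le>K. weight \<gamma> \<mu> P k *\<^sub>R x k \<omega>)"

text \<open>\<open>H k\<close> is the history before iteration \<open>k\<close>. Integrability is asserted wherever an
  expectation or a conditional expectation is formed, because both are total functions with
  arbitrary values otherwise. As \<open>\<sigma>\<^sub>1\<^sub>,\<^sub>0\<close> and \<open>\<sigma>\<^sub>2\<^sub>,\<^sub>0\<close> precede all randomness, their squares are
  written as expectations in the last inequality.\<close>

definition parametric_assumption ::
    "'w measure \<Rightarrow> (nat \<Rightarrow> 'w measure) \<Rightarrow> nat \<Rightarrow> ('a::euclidean_space \<Rightarrow> real) \<Rightarrow> 'a \<Rightarrow>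
     real \<Rightarrow> real \<Rightarrow> real \<Rightarrow>
     (nat \<Rightarrow> 'w \<Rightarrow> 'a) \<Rightarrow> (nat \<Rightarrow> nat \<Rightarrow> 'w \<Rightarrow> 'a) \<Rightarrow> (nat \<Rightarrow> nat \<Rightarrow> 'w \<Rightarrow> 'a) \<Rightarrow> 'w ec_params \<Rightarrow> bool" where
  "parametric_assumption M H n f xs L \<gamma> \<mu> x e g P \<longleftrightarrow>
     (let gk = (\<lambda>k \<omega>. avg n (\<lambda>i. g k i \<omega>));
          ek = (\<lambda>k \<omega>. avg n (\<lambda>i. e k i \<omega>));
          gbar = (\<lambda>k i. vec_cond_exp M (H k) (g k i));
          gap = (\<lambda>k \<omega>. f (x k \<omega>) - f xs);
          s1 = (\<lambda>k \<omega>. (sig1 P k \<omega>)\<^sup>2);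
          s2 = (\<lambda>k \<omega>. (sig2 P k \<omega>)\<^sup>2)
      in
      (\<forall>k. (\<forall>i<n. integrable M (g k i) \<and>
                   integrable M (\<lambda>\<omega>. (norm (g k i \<omega> - gbar k i \<omega>))\<^sup>2)) \<and>
           integrable M (\<lambda>\<omega>. (norm (gk k \<omega>))\<^sup>2) \<and>
           integrable M (\<lambda>\<omega>. (norm (ek k \<omega>))\<^sup>2) \<and>
           integrable M (gap k) \<and> integrable M (s1 k) \<and> integrable M (s2 k)) \<and>
      (\<forall>k. AE \<omega> in M. vec_cond_exp M (H k) (gk k) \<omega> = grad f (x k \<omega>)) \<and>
      (\<forall>k. AE \<omega> in M. avg n (\<lambda>i. (norm (gbar k i \<omega>))\<^sup>2) \<le>
         2 * cA P * gap k \<omega> + cB1 P * s1 k \<omega> + cB2 P * s2 k \<omega> + cD1 P) \<and>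
      (\<forall>k. AE \<omega> in M.
         avg n (\<lambda>i. real_cond_exp M (H k) (\<lambda>\<omega>'. (norm (g k i \<omega>' - gbar k i \<omega>'))\<^sup>2) \<omega>) \<le>
         2 * cAt P * gap k \<omega> + cB1t P * s1 k \<omega> + cB2t P * s2 k \<omega> + cD1t P) \<and>
      (\<forall>k. AE \<omega> in M. real_cond_exp M (H k) (\<lambda>\<omega>'. (norm (gk k \<omega>'))\<^sup>2) \<omega> \<le>
         2 * cAp P * gap k \<omega> + cB1p P * s1 k \<omega> + cB2p P * s2 k \<omega> + cD1p P) \<and>
      (\<forall>k. AE \<omega> in M. real_cond_exp M (H k) (s1 (Suc k)) \<omega> \<le>
         (1 - rho1 P) * s1 k \<omega> + 2 * cC1 P * gap k \<omega> + cG P * rho1 P * s2 k \<omega> + cD2 P) \<and>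
      (\<forall>k. AE \<omega> in M. real_cond_exp M (H k) (s2 (Suc k)) \<omega> \<le>
         (1 - rho2 P) * s2 k \<omega> + 2 * cC2 P * gap k \<omega>) \<and>
      (\<forall>K. 3 * L * (\<Sum>k\<le>K. weight \<gamma> \<mu> P k * (\<integral>\<omega>. (norm (ek k \<omega>))\<^sup>2 \<partial>M)) \<le>
         1 / 4 * (\<Sum>k\<le>K. weight \<gamma> \<mu> P k * (\<integral>\<omega>. gap k \<omega> \<partial>M)) +
         cF1 P * (\<integral>\<omega>. s1 0 \<omega> \<partial>M) + cF2 P * (\<integral>\<omega>. s2 0 \<omega> \<partial>M) +
         \<gamma> * cD3 P * weight_sum \<gamma> \<mu> P K))"

end

theory Submission
  imports Defs
begin

text \<open>Error feedback makes the virtual iterate \<open>x\<^sup>k - e\<^sup>k\<close> perform plain SGD steps \<open>- \<gamma> g\<^sup>k\<close>, with the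
gradients evaluated at the nearby point \<open>x\<^sup>k\<close>. Quasi strong convexity therefore contracts the distance
of the virtual iterate to the minimizer, up to the noise \<open>\<gamma>\<^sup>2 E \<bar>g\<^sup>k\<bar>\<^sup>2\<close> and a penalty
\<open>3 L \<gamma> E \<bar>e\<^sup>k\<bar>\<^sup>2\<close> for the displacement (\<open>mean_dist_step\<close>). On average, compression leaves at most the
fraction \<open>1 - \<delta>\<close> of the squared norm in the error memory, so that the errors obey a contracting recursion
driven by the second moments of the stochastic gradients (\<open>worker_error_step\<close>), and their weighted sum
is absorbed by a quarter of the weighted optimality gaps plus a constant (\<open>weighted_error_le\<close>). Summing
the descent inequality with the weights \<open>w\<^sub>k\<close> telescopes, and convexity of \<open>f\<close> passes from the weighted
gaps to the averaged iterate.

Both parts of the theorem are instances of one argument. Write \<open>dev x\<close> for the mean over the workers of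
\<open>E \<bar>grad (F \<xi>) x - grad (F \<xi>) xs\<bar>\<^sup>2\<close>. The parts differ in the proof of the bound
\<open>dev x \<le> 2 Lc (f x - f xs)\<close>: it holds with \<open>Lc = L\<close> because the gradients of convex smooth functions are
cocoercive (\<open>grad_dev_le_convex\<close>), and with \<open>Lc = L \<kappa>\<close> because the gradients are Lipschitz and \<open>f\<close> grows
quadratically (\<open>grad_dev_le_lipschitz\<close>). The locale \<open>ec_sgd_convergence\<close> collects this bound and the
step size conditions.

The constant \<open>D3\<close> is delicate. The noise levels \<open>D1\<close> and \<open>D1t\<close> contain the factor 2 of the inequality
\<open>\<bar>a + b\<bar>\<^sup>2 \<le> 2 \<bar>a\<bar>\<^sup>2 + 2 \<bar>b\<bar>\<^sup>2\<close>, and if the same inequality is used in the error recursion, the growth of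
the weights can make the sum overshoot \<open>D3\<close>. The split \<open>3/2 \<bar>a\<bar>\<^sup>2 + 3 \<bar>b\<bar>\<^sup>2\<close> moves weight from the
constants to the optimality gap, where the step size condition pays for it.

On the probabilistic side, conditioning on the past means integrating over the fresh samples with the
past held fixed. The locale \<open>fresh_sample\<close> proves this freezing principle for a variable that is
independent of a sub-\<open>\<sigma>\<close>-algebra, and \<open>fresh_block\<close> shows that the samples of one iteration, jointly,
are such a variable for the history.\<close>

section \<open>Smooth and convex functions\<close>

lemma GDERIV_unique:
  assumes "GDERIV h x :> D" "GDERIV h x :> D'" shows "D = D'"
proof -
  have "(\<lambda>u. u \<bullet> D) = (\<lambda>u. u \<bullet> D')"
    using assms has_derivative_unique unfolding gderiv_def by blast
  then show ?thesis
    by (metis vector_eq_ldot)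
qed

lemma grad_eqI: "GDERIV h x :> D \<Longrightarrow> grad h x = D"
  unfolding grad_def by (blast intro: the_equality GDERIV_unique)

lemma GDERIV_grad:
  fixes h :: "'a::euclidean_space \<Rightarrow> real"
  assumes "h differentiable (at x)"
  shows "GDERIV h x :> grad h x"
proof -
  obtain h' where h': "(h has_derivative h') (at x)"
    using assms unfolding differentiable_def by blast
  then interpret bounded_linear h'
    by (rule has_derivative_bounded_linear)
  have "h' = (\<lambda>u. u \<bullet> (\<Sum>b\<in>Basis. h' b *\<^sub>R b))"
  proof
    fix u :: 'a
    have "h' u = h' (\<Sum>b\<in>Basis. (u \<bullet> b) *\<^sub>R b)" by (simp add: euclidean_representation)
    also have "\<dots> = u \<bullet> (\<Sum>b\<in>Basis. h' b *\<^sub>R b)"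
      by (simp add: sum scaleR inner_sum_right mult.commute)
    finally show "h' u = u \<bullet> (\<Sum>b\<in>Basis. h' b *\<^sub>R b)" .
  qed
  then have "GDERIV h x :> (\<Sum>b\<in>Basis. h' b *\<^sub>R b)"
    using h' unfolding gderiv_def by simp
  then show ?thesis using grad_eqI by metis
qed

lemma grad_avg:
  fixes h :: "nat \<Rightarrow> 'a::euclidean_space \<Rightarrow> real"
  assumes "\<And>i. i < n \<Longrightarrow> h i differentiable (at x)"
  shows "(\<lambda>x. avg n (\<lambda>i. h i x)) differentiable (at x)"
    and "grad (\<lambda>x. avg n (\<lambda>i. h i x)) x = avg n (\<lambda>i. grad (h i) x)"
proof -
  have "((\<lambda>x. avg n (\<lambda>i. h i x)) has_derivative (\<lambda>u. avg n (\<lambda>i. u \<bullet> grad (h i) x))) (at x)"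
    unfolding avg_def using GDERIV_grad[OF assms]
    unfolding gderiv_def
    by (intro has_derivative_scaleR_right has_derivative_sum) auto
  also have "(\<lambda>u. avg n (\<lambda>i. u \<bullet> grad (h i) x)) = (\<lambda>u. u \<bullet> avg n (\<lambda>i. grad (h i) x))"
    by (simp add: avg_def inner_sum_right)
  finally have "GDERIV (\<lambda>x. avg n (\<lambda>i. h i x)) x :> avg n (\<lambda>i. grad (h i) x)"
    unfolding gderiv_def .
  then show "(\<lambda>x. avg n (\<lambda>i. h i x)) differentiable (at x)"
    and "grad (\<lambda>x. avg n (\<lambda>i. h i x)) x = avg n (\<lambda>i. grad (h i) x)"
    by (auto simp: gderiv_def differentiable_def grad_eqI)
qed

lemma GDERIV_along_segment:
  fixes h :: "'a::euclidean_space \<Rightarrow> real"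
  assumes "\<And>z. GDERIV h z :> G z"
  shows "((\<lambda>t. h (x + t *\<^sub>R u)) has_real_derivative u \<bullet> G (x + t *\<^sub>R u)) (at t within S)"
proof -
  have "((\<lambda>t. x + t *\<^sub>R u) has_derivative (\<lambda>s. s *\<^sub>R u)) (at t within S)"
    by (auto intro!: derivative_eq_intros)
  moreover have "(h has_derivative (\<lambda>u'. u' \<bullet> G (x + t *\<^sub>R u))) (at (x + t *\<^sub>R u))"
    using assms unfolding gderiv_def by blast
  ultimately have "((\<lambda>t. h (x + t *\<^sub>R u)) has_derivative
      (\<lambda>s. (s *\<^sub>R u) \<bullet> G (x + t *\<^sub>R u))) (at t within S)"
    using has_derivative_compose by fastforce
  then show ?thesis
    unfolding has_field_derivative_def by (simp add: mult.commute[of _ "u \<bullet> _"])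
qed

text \<open>Along the segment from \<open>x\<close> to \<open>y\<close> the difference of the two sides is monotone, because its derivative
is controlled by the Lipschitz bound on the gradient.\<close>

lemma smooth_upper_bound:
  fixes h :: "'a::euclidean_space \<Rightarrow> real"
  assumes h: "\<And>z. GDERIV h z :> G z"
    and G: "\<And>y z. norm (G y - G z) \<le> L * norm (y - z)"
  shows "h y \<le> h x + G x \<bullet> (y - x) + L / 2 * (norm (y - x))\<^sup>2"
proof -
  define u where "u = y - x"
  define \<phi> where "\<phi> t = h (x + t *\<^sub>R u) - t * (G x \<bullet> u) - L / 2 * t\<^sup>2 * (norm u)\<^sup>2" for t
  have "\<phi> 1 \<le> \<phi> 0"
  proof (rule DERIV_nonpos_imp_nonincreasing[of 0 1 \<phi>])
    fix t :: real assume t: "0 \<le> t" "t \<le> 1"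
    have "(\<phi> has_real_derivative (u \<bullet> G (x + t *\<^sub>R u) - G x \<bullet> u - L * t * (norm u)\<^sup>2)) (at t)"
      unfolding \<phi>_def
      by (auto intro!: derivative_eq_intros GDERIV_along_segment[OF h])
    moreover have "u \<bullet> G (x + t *\<^sub>R u) - G x \<bullet> u - L * t * (norm u)\<^sup>2 \<le> 0"
    proof -
      have "u \<bullet> G (x + t *\<^sub>R u) - G x \<bullet> u = u \<bullet> (G (x + t *\<^sub>R u) - G x)"
        by (simp add: inner_diff_right inner_commute)
      also have "\<dots> \<le> norm u * norm (G (x + t *\<^sub>R u) - G x)"
        by (rule norm_cauchy_schwarz)
      also have "\<dots> \<le> norm u * (L * norm (t *\<^sub>R u))"
        using G[of "x + t *\<^sub>R u" x] by (intro mult_left_mono) auto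
      also have "\<dots> = L * t * (norm u)\<^sup>2"
        using t by (simp add: power2_eq_square)
      finally show ?thesis by simp
    qed
    ultimately show "\<exists>d. (\<phi> has_real_derivative d) (at t) \<and> d \<le> 0" by blast
  qed simp
  then show ?thesis unfolding \<phi>_def u_def by simp
qed

text \<open>A gradient step of length \<open>1/L\<close> decreases the function by at least \<open>\<bar>G x\<bar>\<^sup>2 / (2 L)\<close>, and it cannot
lead below \<open>m\<close>.\<close>

lemma grad_norm_le_gap:
  fixes h :: "'a::euclidean_space \<Rightarrow> real"
  assumes h: "\<And>z. GDERIV h z :> G z"
    and G: "\<And>y z. norm (G y - G z) \<le> L * norm (y - z)"
    and L: "0 < L" and m: "\<And>z. m \<le> h z"
  shows "(norm (G x))\<^sup>2 \<le> 2 * L * (h x - m)"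
proof -
  have "m \<le> h (x - (1 / L) *\<^sub>R G x)" by (rule m)
  also have "\<dots> \<le> h x + G x \<bullet> (- ((1 / L) *\<^sub>R G x)) + L / 2 * (norm ((1 / L) *\<^sub>R G x))\<^sup>2"
    using smooth_upper_bound[OF h G, of "x - (1 / L) *\<^sub>R G x" x] by simp
  also have "\<dots> = h x - (norm (G x))\<^sup>2 / (2 * L)"
    using L by (simp add: power2_norm_eq_inner[symmetric] field_simps power2_eq_square)
  finally show ?thesis using L by (simp add: field_simps)
qed

lemma convex_above_tangent:
  fixes h :: "'a::euclidean_space \<Rightarrow> real"
  assumes h: "\<And>z. GDERIV h z :> G z" and cvx: "convex_on UNIV h"
  shows "h x + G x \<bullet> (y - x) \<le> h y"
proof -
  (* reduction to the one-dimensional tangent inequality *)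
  define \<phi> where "\<phi> t = h (x + t *\<^sub>R (y - x))" for t
  have "convex_on UNIV \<phi>"
  proof (rule convex_onI)
    fix t a b :: real assume t: "0 < t" "t < 1"
    have "x + ((1 - t) *\<^sub>R a + t *\<^sub>R b) *\<^sub>R (y - x)
      = (1 - t) *\<^sub>R (x + a *\<^sub>R (y - x)) + t *\<^sub>R (x + b *\<^sub>R (y - x))"
      by (simp add: algebra_simps)
    then show "\<phi> ((1 - t) *\<^sub>R a + t *\<^sub>R b) \<le> (1 - t) * \<phi> a + t * \<phi> b"
      unfolding \<phi>_def using convex_onD[OF cvx] t by simp
  qed simp
  moreover have "(\<phi> has_real_derivative (y - x) \<bullet> G x) (at 0 within UNIV)"
    unfolding \<phi>_def using GDERIV_along_segment[OF h, where x=x and u="y - x" and t=0] by simp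
  ultimately have "(y - x) \<bullet> G x * (1 - 0) \<le> \<phi> 1 - \<phi> 0"
    using convex_on_imp_above_tangent[of UNIV \<phi> 0 1 "(y - x) \<bullet> G x"] by simp
  then show ?thesis unfolding \<phi>_def by (simp add: inner_commute)
qed

text \<open>Subtracting the linear function \<open>G y\<close> turns \<open>y\<close> into a minimizer, so that \<open>grad_norm_le_gap\<close> applies
to the tilted function.\<close>

lemma smooth_convex_bregman:
  fixes h :: "'a::euclidean_space \<Rightarrow> real"
  assumes h: "\<And>z. GDERIV h z :> G z"
    and G: "\<And>y z. norm (G y - G z) \<le> L * norm (y - z)"
    and L: "0 < L" and cvx: "convex_on UNIV h"
  shows "(norm (G x - G y))\<^sup>2 \<le> 2 * L * (h x - h y - G y \<bullet> (x - y))"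
proof -
  define k where "k z = h z - z \<bullet> G y" for z
  have "GDERIV k z :> G z - G y" for z
    using h[of z] unfolding k_def gderiv_def
    by (auto intro!: derivative_eq_intros simp: inner_diff_right)
  moreover have "k y \<le> k z" for z
    using convex_above_tangent[OF h cvx, of y z] unfolding k_def
    by (simp add: inner_diff_right inner_diff_left inner_commute)
  ultimately have "(norm (G x - G y))\<^sup>2 \<le> 2 * L * (k x - k y)"
    using grad_norm_le_gap[of k "\<lambda>z. G z - G y" L "k y" x] G L by simp
  then show ?thesis unfolding k_def by (simp add: inner_diff_right inner_commute algebra_simps)
qed

lemma L_smoothD:
  assumes "L_smooth L h"
  shows "GDERIV h x :> grad h x" "norm (grad h y - grad h z) \<le> L * norm (y - z)"
  using assms unfolding L_smooth_def
  by (auto intro: GDERIV_grad dest: lipschitz_onD simp: dist_norm[symmetric])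

text \<open>The free parameter \<open>c\<close> trades the two terms against each other: \<open>c = 1\<close> gives the constants of the
parametric assumption, \<open>c = 1/2\<close> is used in the error recursion.\<close>

lemma norm_add_sq_young:
  fixes a b :: "'a::real_inner"
  assumes "0 < c"
  shows "(norm (a + b))\<^sup>2 \<le> (1 + c) * (norm a)\<^sup>2 + (1 + 1 / c) * (norm b)\<^sup>2"
proof -
  have "0 \<le> (norm (sqrt c *\<^sub>R a - (1 / sqrt c) *\<^sub>R b))\<^sup>2" by simp
  also have "\<dots> = c * (norm a)\<^sup>2 + (1 / c) * (norm b)\<^sup>2 - 2 * (a \<bullet> b)"
    using assms unfolding power2_norm_eq_inner
    by (simp add: inner_diff_left inner_diff_right inner_commute field_simps)
  finally show ?thesis
    unfolding power2_norm_eq_inner by (simp add: inner_add_left inner_add_right inner_commute algebra_simps)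
qed

lemma norm_avg_sq_le:
  fixes a :: "nat \<Rightarrow> 'a::real_inner"
  shows "(norm (avg n a))\<^sup>2 \<le> avg n (\<lambda>i. (norm (a i))\<^sup>2)"
proof (cases "n = 0")
  case False
  have "norm (\<Sum>i<n. a i) \<le> (\<Sum>i<n. norm (a i))" by (rule norm_sum)
  then have "(norm (\<Sum>i<n. a i))\<^sup>2 \<le> (\<Sum>i<n. 1 * norm (a i))\<^sup>2"
    by (intro power_mono) auto
  also have "\<dots> \<le> (\<Sum>i<n. 1\<^sup>2) * (\<Sum>i<n. (norm (a i))\<^sup>2)"
    by (rule Cauchy_Schwarz_ineq_sum)
  finally have "(norm (\<Sum>i<n. a i))\<^sup>2 \<le> real n * (\<Sum>i<n. (norm (a i))\<^sup>2)" by simp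
  then show ?thesis
    using False by (simp add: avg_def power_mult_distrib field_simps power2_eq_square)
qed (simp add: avg_def)

text \<open>Shifting the index in the weighted sum \<open>S\<close> of the \<open>a k\<close> costs the factor \<open>1 - \<eta>\<close>, so the recursion
gives \<open>(1 - \<eta>) S \<le> q S + \<Sum> w N\<close>, which is solved for \<open>S\<close>.\<close>

lemma weighted_sum_of_contraction:
  fixes a N w :: "nat \<Rightarrow> real"
  assumes rec: "\<And>k. a (Suc k) \<le> q * a k + N k" and a0: "a 0 = 0"
    and w: "\<And>k. 0 \<le> w k" "\<And>k. (1 - \<eta>) * w (Suc k) = w k"
    and nn: "\<And>k. 0 \<le> a k" "\<And>k. 0 \<le> N k" and q: "0 \<le> q"
  shows "(1 - \<eta> - q) * (\<Sum>k\<le>K. w k * a k) \<le> (\<Sum>k\<le>K. w k * N k)"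
proof -
  have "(1 - \<eta>) * (\<Sum>k\<le>K. w k * a k) = (1 - \<eta>) * (\<Sum>k<K. w (Suc k) * a (Suc k))"
    by (subst sum.atMost_shift) (simp add: a0)
  also have "\<dots> = (\<Sum>k<K. w k * a (Suc k))"
    unfolding sum_distrib_left mult.assoc[symmetric] w(2) ..
  also have "\<dots> \<le> (\<Sum>k<K. w k * (q * a k + N k))"
    by (intro sum_mono mult_left_mono rec w)
  also have "\<dots> \<le> (\<Sum>k\<le>K. w k * (q * a k + N k))"
    by (intro sum_mono2) (auto intro!: mult_nonneg_nonneg add_nonneg_nonneg w nn q)
  also have "\<dots> = q * (\<Sum>k\<le>K. w k * a k) + (\<Sum>k\<le>K. w k * N k)"
    by (simp add: sum.distrib sum_distrib_left algebra_simps)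
  finally show ?thesis by (simp add: algebra_simps)
qed

text \<open>Because \<open>(1 - \<eta>) w\<^sub>k\<close> is the previous weight, the weighted descent inequalities telescope.\<close>

lemma weighted_sum_of_descent:
  fixes T G w :: "nat \<Rightarrow> real"
  assumes rec: "\<And>k. T (Suc k) \<le> (1 - \<eta>) * T k - G k"
    and w: "\<And>k. 0 \<le> w k" "\<And>k. (1 - \<eta>) * w (Suc k) = w k" and w0: "(1 - \<eta>) * w 0 = 1"
    and nn: "\<And>k. 0 \<le> T k"
  shows "(\<Sum>k\<le>K. w k * G k) \<le> T 0"
proof -
  have step: "w k * G k \<le> (1 - \<eta>) * w k * T k - w k * T (Suc k)" for k
    using mult_left_mono[OF rec[of k] w(1)[of k]] by (simp add: algebra_simps)
  have "(\<Sum>k\<le>K. w k * G k) \<le> T 0 - w K * T (Suc K)"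
  proof (induction K)
    case 0
    then show ?case using step[of 0] w0 by simp
  next
    case (Suc K)
    then show ?case using step[of "Suc K"] w(2)[of K] by simp
  qed
  also have "\<dots> \<le> T 0" using w(1) nn by simp
  finally show ?thesis .
qed

lemma power2_norm_diff_scaleR:
  fixes a b :: "'a::real_inner"
  shows "(norm (a - c *\<^sub>R b))\<^sup>2 = (norm a)\<^sup>2 - 2 * c * (a \<bullet> b) + c\<^sup>2 * (norm b)\<^sup>2"
  unfolding power2_norm_eq_inner
  by (simp add: inner_diff_left inner_diff_right inner_commute[of b a] power2_eq_square algebra_simps)

section \<open>Averages over the workers and the compression inequality\<close>

lemma avg_cong: "(\<And>i. i < n \<Longrightarrow> a i = b i) \<Longrightarrow> avg n a = avg n b"
  by (simp add: avg_def)

lemma avg_mono: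
  fixes a b :: "nat \<Rightarrow> real"
  shows "(\<And>i. i < n \<Longrightarrow> a i \<le> b i) \<Longrightarrow> avg n a \<le> avg n b"
  unfolding avg_def real_scaleR_def by (intro mult_left_mono sum_mono) auto

lemma avg_add: "avg n (\<lambda>i. a i + b i) = avg n a + avg n b"
  and avg_diff: "avg n (\<lambda>i. a i - b i) = avg n a - avg n b"
  and avg_scaleR: "avg n (\<lambda>i. c *\<^sub>R a i) = c *\<^sub>R avg n a"
  by (simp_all add: avg_def sum.distrib sum_subtractf scaleR_add_right scaleR_diff_right scaleR_sum_right
      mult.commute)

lemma avg_mult: "avg n (\<lambda>i. c * a i) = c * avg n (a :: nat \<Rightarrow> real)"
  using avg_scaleR[of n c a] by simp

lemma inner_avg: "y \<bullet> avg n a = avg n (\<lambda>i. y \<bullet> a i)"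
  by (simp add: avg_def inner_sum_right)

lemma integral_avg:
  fixes h :: "nat \<Rightarrow> 'w \<Rightarrow> real"
  assumes "\<And>i. i < n \<Longrightarrow> integrable M (h i)"
  shows "integrable M (\<lambda>\<omega>. avg n (\<lambda>i. h i \<omega>))"
    and "(\<integral>\<omega>. avg n (\<lambda>i. h i \<omega>) \<partial>M) = avg n (\<lambda>i. \<integral>\<omega>. h i \<omega> \<partial>M)"
  unfolding avg_def
  by (intro Bochner_Integration.integrable_scaleR_right Bochner_Integration.integrable_sum; simp add: assms)
    (subst Bochner_Integration.integral_scaleR_right, subst Bochner_Integration.integral_sum; simp add: assms)

lemma (in sigma_finite_subalgebra) real_cond_exp_avg:
  assumes "\<And>i. i < n \<Longrightarrow> integrable M (h i)"
  shows "AE \<omega> in M. real_cond_exp M F (\<lambda>\<omega>. avg n (\<lambda>i. h i \<omega>)) \<omega> = avg n (\<lambda>i. real_cond_exp M F (h i) \<omega>)"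
proof -
  (* cut off outside the range of summation, so that every member of the family is integrable *)
  define h' where "h' i = (if i < n then h i else (\<lambda>_. 0))" for i
  have int: "integrable M (h' i)" for i using assms by (simp add: h'_def)
  have sum_int: "integrable M (\<lambda>\<omega>. \<Sum>i<n. h' i \<omega>)"
    by (intro Bochner_Integration.integrable_sum int)
  have "(\<lambda>\<omega>. avg n (\<lambda>i. h i \<omega>)) = (\<lambda>\<omega>. (1 / real n) * (\<Sum>i<n. h' i \<omega>))"
    by (simp add: avg_def h'_def)
  moreover have "avg n (\<lambda>i. real_cond_exp M F (h i) \<omega>) = (1 / real n) * (\<Sum>i<n. real_cond_exp M F (h' i) \<omega>)" for \<omega>
    by (simp add: avg_def h'_def)
  moreover have "AE \<omega> in M. real_cond_exp M F (\<lambda>\<omega>. (1 / real n) * (\<Sum>i<n. h' i \<omega>)) \<omega>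
      = (1 / real n) * (\<Sum>i<n. real_cond_exp M F (h' i) \<omega>)"
    using real_cond_exp_cmult[OF sum_int, of "1 / real n"] real_cond_exp_sum[of h' "{..<n}", OF int]
    by eventually_elim simp
  ultimately show ?thesis by simp
qed

text \<open>Splitting with the parameter \<open>\<delta> / (2 (1 - \<delta>))\<close> gives up half of the contraction \<open>\<delta>\<close> and keeps the
factor \<open>1 - \<delta> / 2\<close> on \<open>a\<close>, at the price of \<open>2 / \<delta>\<close> on \<open>b\<close>. For
\<open>\<delta> = 1\<close> the left-hand side vanishes.\<close>

lemma compression_young:
  fixes a b :: "'a::real_inner"
  assumes \<delta>: "0 < \<delta>" "\<delta> \<le> 1"
  shows "(1 - \<delta>) * (norm (a + b))\<^sup>2 \<le> (1 - \<delta> / 2) * (norm a)\<^sup>2 + 2 / \<delta> * (norm b)\<^sup>2"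
proof (cases "\<delta> = 1")
  case False
  then have \<delta>1: "0 < 1 - \<delta>" using \<delta> by simp
  define c where "c = \<delta> / (2 * (1 - \<delta>))"
  have c: "0 < c" using \<delta> \<delta>1 by (simp add: c_def)
  have "(1 - \<delta>) * (norm (a + b))\<^sup>2 \<le> (1 - \<delta>) * ((1 + c) * (norm a)\<^sup>2 + (1 + 1 / c) * (norm b)\<^sup>2)"
    using \<delta>1 by (intro mult_left_mono norm_add_sq_young c) simp
  also have "\<dots> = (1 - \<delta>) * (1 + c) * (norm a)\<^sup>2 + (1 - \<delta>) * (1 + 1 / c) * (norm b)\<^sup>2"
    by (simp add: algebra_simps)
  also have "(1 - \<delta>) * (1 + c) = 1 - \<delta> / 2"
    using \<delta>1 by (simp add: c_def field_simps)
  also have "(1 - \<delta>) * (1 + 1 / c) * (norm b)\<^sup>2 \<le> 2 / \<delta> * (norm b)\<^sup>2"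
  proof (rule mult_right_mono)
    have "(1 - \<delta>) * (1 + 1 / c) = (1 - \<delta>) * (2 - \<delta>) / \<delta>"
      using \<delta> \<delta>1 by (simp add: c_def field_simps)
    also have "\<dots> \<le> 2 / \<delta>"
    proof (rule divide_right_mono)
      have "(1 - \<delta>) * (2 - \<delta>) \<le> 1 * 2" using \<delta> by (intro mult_mono) auto
      then show "(1 - \<delta>) * (2 - \<delta>) \<le> 2" by simp
    qed (use \<delta> in simp)
    finally show "(1 - \<delta>) * (1 + 1 / c) \<le> 2 / \<delta>" .
  qed simp
  finally show ?thesis by simp
qed simp

section \<open>Square integrable random vectors\<close>

definition square_integrable :: "'w measure \<Rightarrow> ('w \<Rightarrow> 'a::euclidean_space) \<Rightarrow> bool" where
  "square_integrable M X \<longleftrightarrow>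
     X \<in> borel_measurable M \<and> integrable M (\<lambda>\<omega>. (norm (X \<omega>))\<^sup>2)"

lemma square_integrable_measurable [measurable_dest]:
  "square_integrable M X \<Longrightarrow> X \<in> borel_measurable M"
  by (simp add: square_integrable_def)

lemma square_integrable_dominated:
  assumes "X \<in> borel_measurable M" "integrable M B"
    and "AE \<omega> in M. (norm (X \<omega>))\<^sup>2 \<le> B \<omega>"
  shows "square_integrable M X"
  unfolding square_integrable_def
proof
  show "integrable M (\<lambda>\<omega>. (norm (X \<omega>))\<^sup>2)"
  proof (rule Bochner_Integration.integrable_bound[OF assms(2)])
    show "AE \<omega> in M. norm ((norm (X \<omega>))\<^sup>2) \<le> norm (B \<omega>)"
      using assms(3) by eventually_elim (smt (verit) real_norm_def zero_le_power2)
  qed (use assms(1) in measurable)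
qed fact

lemma square_integrable_add:
  assumes "square_integrable M X" "square_integrable M Y"
  shows "square_integrable M (\<lambda>\<omega>. X \<omega> + Y \<omega>)"
proof (rule square_integrable_dominated)
  show "AE \<omega> in M. (norm (X \<omega> + Y \<omega>))\<^sup>2 \<le> 2 * (norm (X \<omega>))\<^sup>2 + 2 * (norm (Y \<omega>))\<^sup>2"
    using norm_add_sq_young[of 1] by fastforce
qed (use assms in \<open>auto simp: square_integrable_def\<close>)

lemma square_integrable_scaleR:
  "square_integrable M X \<Longrightarrow> square_integrable M (\<lambda>\<omega>. c *\<^sub>R X \<omega>)"
  by (auto simp: square_integrable_def power_mult_distrib)

lemma square_integrable_diff:
  "square_integrable M X \<Longrightarrow> square_integrable M Y \<Longrightarrow> square_integrable M (\<lambda>\<omega>. X \<omega> - Y \<omega>)"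
  using square_integrable_add[OF _ square_integrable_scaleR[of M Y "-1"]] by simp

lemma (in finite_measure) square_integrable_const: "square_integrable M (\<lambda>\<omega>. c)"
  by (simp add: square_integrable_def)

lemma square_integrable_avg:
  assumes "\<And>i. i < n \<Longrightarrow> square_integrable M (X i)"
  shows "square_integrable M (\<lambda>\<omega>. avg n (\<lambda>i. X i \<omega>))"
proof -
  have "square_integrable M (\<lambda>\<omega>. \<Sum>i<m. X i \<omega>)" if "m \<le> n" for m
    using that
  proof (induction m)
    case 0
    then show ?case by (simp add: square_integrable_def)
  next
    case (Suc m)
    then show ?case by (simp add: square_integrable_add assms)
  qed
  then show ?thesis unfolding avg_def by (intro square_integrable_scaleR) simp
qed

lemma square_integrable_cong_AE:
  assumes "AE \<omega> in M. X \<omega> = Y \<omega>" "square_integrable M X" "Y \<in> borel_measurable M"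
  shows "square_integrable M Y"
  using assms(3) _ _
proof (rule square_integrable_dominated)
  show "AE \<omega> in M. (norm (Y \<omega>))\<^sup>2 \<le> (norm (X \<omega>))\<^sup>2"
    using assms(1) by eventually_elim simp
  show "integrable M (\<lambda>\<omega>. (norm (X \<omega>))\<^sup>2)"
    using assms(2) by (simp add: square_integrable_def)
qed

lemma square_integrable_inner:
  assumes "square_integrable M X" "square_integrable M Y"
  shows "integrable M (\<lambda>\<omega>. X \<omega> \<bullet> Y \<omega>)"
proof (rule Bochner_Integration.integrable_bound)
  show "integrable M (\<lambda>\<omega>. (norm (X \<omega>))\<^sup>2 + (norm (Y \<omega>))\<^sup>2)"
    using assms by (auto simp: square_integrable_def)
  show "AE \<omega> in M. norm (X \<omega> \<bullet> Y \<omega>) \<le> norm ((norm (X \<omega>))\<^sup>2 + (norm (Y \<omega>))\<^sup>2)"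
  proof (intro AE_I2)
    fix \<omega>
    have "\<bar>X \<omega> \<bullet> Y \<omega>\<bar> \<le> norm (X \<omega>) * norm (Y \<omega>)" by (rule Cauchy_Schwarz_ineq2)
    moreover have "2 * (norm (X \<omega>) * norm (Y \<omega>)) \<le> (norm (X \<omega>))\<^sup>2 + (norm (Y \<omega>))\<^sup>2"
      using sum_squares_bound[of "norm (X \<omega>)" "norm (Y \<omega>)"] by simp
    moreover have "0 \<le> norm (X \<omega>) * norm (Y \<omega>)" by simp
    ultimately show "norm (X \<omega> \<bullet> Y \<omega>) \<le> norm ((norm (X \<omega>))\<^sup>2 + (norm (Y \<omega>))\<^sup>2)"
      unfolding real_norm_def by linarith
  qed
qed (use assms in \<open>auto simp: square_integrable_def\<close>)

lemma (in finite_measure) square_integrable_integrable: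
  assumes "square_integrable M X"
  shows "integrable M X"
proof -
  have "integrable M (\<lambda>\<omega>. \<Sum>b\<in>Basis. (X \<omega> \<bullet> b) *\<^sub>R b)"
    using square_integrable_inner[OF assms square_integrable_const] by auto
  then show ?thesis by (simp add: euclidean_representation)
qed

text \<open>The decomposition into variance and squared bias. It shows that the second moment about any point
dominates both the variance and the squared distance of the mean from that point.\<close>

lemma (in prob_space) second_moment_about:
  assumes "square_integrable M X"
  shows "(\<integral>\<omega>. (norm (X \<omega> - c))\<^sup>2 \<partial>M) =
    (\<integral>\<omega>. (norm (X \<omega> - expectation X))\<^sup>2 \<partial>M) + (norm (expectation X - c))\<^sup>2"
proof -
  let ?m = "expectation X"
  have X: "integrable M X" by (rule square_integrable_integrable[OF assms])
  have sq: "square_integrable M (\<lambda>\<omega>. X \<omega> - ?m)"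
    by (intro square_integrable_diff assms square_integrable_const)
  have "(norm (X \<omega> - c))\<^sup>2 = (norm (X \<omega> - ?m))\<^sup>2 + (norm (?m - c))\<^sup>2 + 2 * ((X \<omega> - ?m) \<bullet> (?m - c))" for \<omega>
    unfolding power2_norm_eq_inner
    by (simp add: inner_diff_left inner_diff_right inner_commute)
  moreover have "(\<integral>\<omega>. (X \<omega> - ?m) \<bullet> (?m - c) \<partial>M) = 0"
    using X by (subst integral_inner_left) (auto simp: prob_space)
  ultimately show ?thesis
    using sq square_integrable_inner[OF sq square_integrable_const]
    by (simp add: square_integrable_def prob_space)
qed

lemma norm_sum_sq_orthogonal:
  fixes U :: "'i \<Rightarrow> 'w \<Rightarrow> 'a::euclidean_space"
  assumes "finite I" and sq: "\<And>i. i \<in> I \<Longrightarrow> square_integrable M (U i)"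
    and orth: "\<And>i j. i \<in> I \<Longrightarrow> j \<in> I \<Longrightarrow> i \<noteq> j \<Longrightarrow> (\<integral>\<omega>. U i \<omega> \<bullet> U j \<omega> \<partial>M) = 0"
  shows "(\<integral>\<omega>. (norm (\<Sum>i\<in>I. U i \<omega>))\<^sup>2 \<partial>M) = (\<Sum>i\<in>I. \<integral>\<omega>. (norm (U i \<omega>))\<^sup>2 \<partial>M)"
proof -
  have "(\<integral>\<omega>. (norm (\<Sum>i\<in>I. U i \<omega>))\<^sup>2 \<partial>M) = (\<integral>\<omega>. (\<Sum>i\<in>I. \<Sum>j\<in>I. U j \<omega> \<bullet> U i \<omega>) \<partial>M)"
    unfolding power2_norm_eq_inner inner_sum_left inner_sum_right ..
  also have "\<dots> = (\<Sum>i\<in>I. \<Sum>j\<in>I. \<integral>\<omega>. U j \<omega> \<bullet> U i \<omega> \<partial>M)"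
    using square_integrable_inner[OF sq sq]
    by (simp add: Bochner_Integration.integral_sum)
  also have "\<dots> = (\<Sum>i\<in>I. \<Sum>j\<in>I. if j = i then \<integral>\<omega>. U i \<omega> \<bullet> U i \<omega> \<partial>M else 0)"
    using orth by (intro sum.cong refl) auto
  finally show ?thesis
    using assms(1) by (simp add: power2_norm_eq_inner)
qed

text \<open>Coordinatewise, the expectation of a product of independent variables factorizes.\<close>

lemma (in prob_space) indep_var_inner_zero:
  fixes U V :: "'a \<Rightarrow> 'b::euclidean_space"
  assumes ind: "indep_var borel U borel V" and sq: "square_integrable M U" "square_integrable M V"
    and zero: "expectation U = 0"
  shows "(\<integral>\<omega>. U \<omega> \<bullet> V \<omega> \<partial>M) = 0"
proof -
  have comp: "indep_var borel (\<lambda>\<omega>. U \<omega> \<bullet> b) borel (\<lambda>\<omega>. V \<omega> \<bullet> b)" for b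
    using indep_var_compose[OF ind, of "\<lambda>u. u \<bullet> b" borel "\<lambda>u. u \<bullet> b" borel] by (simp add: comp_def)
  have int: "integrable M (\<lambda>\<omega>. U \<omega> \<bullet> b)" "integrable M (\<lambda>\<omega>. V \<omega> \<bullet> b)" for b
    using sq by (auto intro: square_integrable_inner square_integrable_const)
  have "(\<integral>\<omega>. (U \<omega> \<bullet> b) * (V \<omega> \<bullet> b) \<partial>M) = (\<integral>\<omega>. U \<omega> \<bullet> b \<partial>M) * (\<integral>\<omega>. V \<omega> \<bullet> b \<partial>M)" for b
    by (rule indep_var_lebesgue_integral[OF comp int])
  moreover have "(\<integral>\<omega>. U \<omega> \<bullet> b \<partial>M) = 0" for b
    using zero square_integrable_integrable[OF sq(1)] by simp
  moreover have "integrable M (\<lambda>\<omega>. (U \<omega> \<bullet> b) * (V \<omega> \<bullet> b))" for b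
    by (rule indep_var_integrable[OF comp int])
  ultimately show ?thesis
    by (subst euclidean_inner) (simp add: Bochner_Integration.integral_sum)
qed

section \<open>Freezing the past\<close>

text \<open>Here \<open>H\<close> is the information available before \<open>Y\<close> is drawn. Independence is stated for events, since
the past and the sample take values in different types.\<close>

locale fresh_sample = prob_space M for M :: "'w measure" +
  fixes H :: "'w measure" and N :: "'y measure" and Y :: "'w \<Rightarrow> 'y"
  assumes sub: "subalgebra M H"
    and measurable_sample [measurable]: "Y \<in> measurable M N"
    and indep: "\<And>A B. A \<in> sets H \<Longrightarrow> B \<in> sets N \<Longrightarrow>
      prob (A \<inter> (Y -` B \<inter> space M)) = prob A * prob (Y -` B \<inter> space M)"
begin

sublocale finite_measure_subalgebra M H
  by unfold_locales (rule sub)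

lemma measurable_past [measurable]: "(\<lambda>\<omega>. \<omega>) \<in> measurable M H"
  using sub unfolding subalgebra_def measurable_def by (auto dest: sets.sets_into_space)

sublocale sample: prob_space "distr M N Y"
  by (rule prob_space_distr) simp

sublocale past: prob_space "distr M H (\<lambda>\<omega>. \<omega>)"
  by (rule prob_space_distr) simp

sublocale pair_sigma_finite "distr M H (\<lambda>\<omega>. \<omega>)" "distr M N Y" ..

text \<open>The identity on \<open>M\<close>, read as a variable with values in \<open>H\<close>, represents the whole past. Its joint law
with \<open>Y\<close> is a product, and Fubini's theorem for this product yields all freezing lemmas.\<close>

lemma joint_law:
  "distr M (H \<Otimes>\<^sub>M N) (\<lambda>\<omega>. (\<omega>, Y \<omega>)) = distr M H (\<lambda>\<omega>. \<omega>) \<Otimes>\<^sub>M distr M N Y"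
proof (rule pair_measure_eqI[symmetric])
  fix A B assume "A \<in> sets (distr M H (\<lambda>\<omega>. \<omega>))" "B \<in> sets (distr M N Y)"
  then have A: "A \<in> sets H" and B: "B \<in> sets N" by simp_all
  have "A \<subseteq> space M" using sets.sets_into_space[OF A] sub unfolding subalgebra_def by simp
  then have "(\<lambda>\<omega>. (\<omega>, Y \<omega>)) -` (A \<times> B) \<inter> space M = A \<inter> (Y -` B \<inter> space M)"
    and "(\<lambda>\<omega>. \<omega>) -` A \<inter> space M = A" by auto
  then show "emeasure (distr M H (\<lambda>\<omega>. \<omega>)) A * emeasure (distr M N Y) B
      = emeasure (distr M (H \<Otimes>\<^sub>M N) (\<lambda>\<omega>. (\<omega>, Y \<omega>))) (A \<times> B)"
    using A B indep[OF A B]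
    by (simp add: emeasure_distr emeasure_eq_measure ennreal_mult'')
qed (simp_all add: past.sigma_finite_measure_axioms sample.sigma_finite_measure_axioms
       cong: sets_pair_measure_cong)

lemma freeze_nn_integral:
  assumes [measurable]: "\<phi> \<in> borel_measurable (H \<Otimes>\<^sub>M N)"
  shows "(\<integral>\<^sup>+\<omega>. \<phi> (\<omega>, Y \<omega>) \<partial>M) = (\<integral>\<^sup>+\<omega>. \<integral>\<^sup>+y. \<phi> (\<omega>, y) \<partial>distr M N Y \<partial>M)"
proof -
  have "(\<integral>\<^sup>+\<omega>. \<phi> (\<omega>, Y \<omega>) \<partial>M) = (\<integral>\<^sup>+p. \<phi> p \<partial>(distr M H (\<lambda>\<omega>. \<omega>) \<Otimes>\<^sub>M distr M N Y))"
    unfolding joint_law[symmetric] by (subst nn_integral_distr) auto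
  also have "\<dots> = (\<integral>\<^sup>+\<omega>. \<integral>\<^sup>+y. \<phi> (\<omega>, y) \<partial>distr M N Y \<partial>distr M H (\<lambda>\<omega>. \<omega>))"
    by (subst sample.nn_integral_fst[symmetric]) auto
  also have "\<dots> = (\<integral>\<^sup>+\<omega>. \<integral>\<^sup>+y. \<phi> (\<omega>, y) \<partial>distr M N Y \<partial>M)"
    by (subst nn_integral_distr) auto
  finally show ?thesis .
qed

lemma freeze_integral:
  fixes \<phi> :: "'w \<times> 'y \<Rightarrow> 'b::{banach, second_countable_topology}"
  assumes [measurable]: "\<phi> \<in> borel_measurable (H \<Otimes>\<^sub>M N)"
    and int: "integrable M (\<lambda>\<omega>. \<phi> (\<omega>, Y \<omega>))"
  shows "integrable M (\<lambda>\<omega>. \<integral>y. \<phi> (\<omega>, y) \<partial>distr M N Y)"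
    and "(\<integral>\<omega>. \<phi> (\<omega>, Y \<omega>) \<partial>M) = (\<integral>\<omega>. \<integral>y. \<phi> (\<omega>, y) \<partial>distr M N Y \<partial>M)"
proof -
  have int': "integrable (distr M H (\<lambda>\<omega>. \<omega>) \<Otimes>\<^sub>M distr M N Y) \<phi>"
    unfolding joint_law[symmetric] using int by (subst integrable_distr_eq) auto
  then show "integrable M (\<lambda>\<omega>. \<integral>y. \<phi> (\<omega>, y) \<partial>distr M N Y)"
    using integrable_fst'[OF int'] by (subst (asm) integrable_distr_eq) auto
  have "(\<integral>\<omega>. \<phi> (\<omega>, Y \<omega>) \<partial>M) = (\<integral>p. \<phi> p \<partial>(distr M H (\<lambda>\<omega>. \<omega>) \<Otimes>\<^sub>M distr M N Y))"
    unfolding joint_law[symmetric] by (subst integral_distr) auto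
  also have "\<dots> = (\<integral>\<omega>. \<integral>y. \<phi> (\<omega>, y) \<partial>distr M N Y \<partial>distr M H (\<lambda>\<omega>. \<omega>))"
    by (rule integral_fst'[OF int', symmetric])
  also have "\<dots> = (\<integral>\<omega>. \<integral>y. \<phi> (\<omega>, y) \<partial>distr M N Y \<partial>M)"
    by (subst integral_distr) auto
  finally show "(\<integral>\<omega>. \<phi> (\<omega>, Y \<omega>) \<partial>M) = (\<integral>\<omega>. \<integral>y. \<phi> (\<omega>, y) \<partial>distr M N Y \<partial>M)" .
qed

text \<open>A variable that is almost surely a function \<open>\<phi>\<close> of the past and the fresh sample is conditioned on the
past by integrating \<open>\<phi>\<close> over the sample alone. The test functions of the characterization of conditional
expectations are indicators of past events, and multiplying \<open>\<phi>\<close> by them keeps it a function of the past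
and the sample.\<close>

lemma freeze_cond_exp:
  fixes \<phi> :: "'w \<times> 'y \<Rightarrow> real"
  assumes [measurable]: "\<phi> \<in> borel_measurable (H \<Otimes>\<^sub>M N)"
    and X: "integrable M X" and eq: "AE \<omega> in M. X \<omega> = \<phi> (\<omega>, Y \<omega>)"
  shows "AE \<omega> in M. real_cond_exp M H X \<omega> = (\<integral>y. \<phi> (\<omega>, y) \<partial>distr M N Y)"
proof -
  have int: "integrable M (\<lambda>\<omega>. \<phi> (\<omega>, Y \<omega>))"
    by (rule integrable_cong_AE_imp[OF X _ eq]) measurable
  have "AE \<omega> in M. real_cond_exp M H (\<lambda>\<omega>. \<phi> (\<omega>, Y \<omega>)) \<omega> = (\<integral>y. \<phi> (\<omega>, y) \<partial>distr M N Y)"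
  proof (rule real_cond_exp_charact)
    fix A assume A [measurable]: "A \<in> sets H"
    then have A': "A \<in> sets M" using sub unfolding subalgebra_def by blast
    have "(\<integral>\<omega>. indicator A \<omega> *\<^sub>R \<phi> (\<omega>, Y \<omega>) \<partial>M)
        = (\<integral>\<omega>. \<integral>y. indicator A \<omega> *\<^sub>R \<phi> (\<omega>, y) \<partial>distr M N Y \<partial>M)"
      using freeze_integral(2)[of "\<lambda>p. indicator A (fst p) *\<^sub>R \<phi> p"]
        integrable_mult_indicator[OF A' int] by simp
    then show "(\<integral>\<omega>\<in>A. \<phi> (\<omega>, Y \<omega>) \<partial>M) = (\<integral>\<omega>\<in>A. (\<integral>y. \<phi> (\<omega>, y) \<partial>distr M N Y) \<partial>M)"
      unfolding set_lebesgue_integral_def by simp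
  qed (use int freeze_integral(1)[OF assms(1) int] in \<open>auto\<close>)
  moreover have "AE \<omega> in M. real_cond_exp M H X \<omega> = real_cond_exp M H (\<lambda>\<omega>. \<phi> (\<omega>, Y \<omega>)) \<omega>"
    using X int eq by (intro real_cond_exp_cong) auto
  ultimately show ?thesis by eventually_elim simp
qed

lemma freeze_vec_cond_exp:
  fixes \<phi> :: "'w \<times> 'y \<Rightarrow> 'b::euclidean_space"
  assumes meas [measurable]: "\<phi> \<in> borel_measurable (H \<Otimes>\<^sub>M N)"
    and X: "integrable M X" and eq: "AE \<omega> in M. X \<omega> = \<phi> (\<omega>, Y \<omega>)"
    and int_sample: "\<And>\<omega>. \<omega> \<in> space M \<Longrightarrow> integrable (distr M N Y) (\<lambda>y. \<phi> (\<omega>, y))"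
  shows "AE \<omega> in M. vec_cond_exp M H X \<omega> = (\<integral>y. \<phi> (\<omega>, y) \<partial>distr M N Y)"
proof -
  have "AE \<omega> in M. real_cond_exp M H (\<lambda>\<omega>. X \<omega> \<bullet> b) \<omega> = (\<integral>y. \<phi> (\<omega>, y) \<bullet> b \<partial>distr M N Y)" for b
  proof (rule freeze_cond_exp[of "\<lambda>p. \<phi> p \<bullet> b"])
    show "AE \<omega> in M. X \<omega> \<bullet> b = \<phi> (\<omega>, Y \<omega>) \<bullet> b"
      using eq by eventually_elim simp
  qed (use X in auto)
  then have "AE \<omega> in M. \<forall>b\<in>Basis. real_cond_exp M H (\<lambda>\<omega>. X \<omega> \<bullet> b) \<omega>
      = (\<integral>y. \<phi> (\<omega>, y) \<bullet> b \<partial>distr M N Y)"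
    by (intro AE_finite_allI) auto
  with AE_space show ?thesis
  proof eventually_elim
    case (elim \<omega>)
    have "vec_cond_exp M H X \<omega> = (\<Sum>b\<in>Basis. ((\<integral>y. \<phi> (\<omega>, y) \<partial>distr M N Y) \<bullet> b) *\<^sub>R b)"
      using elim int_sample[of \<omega>] unfolding vec_cond_exp_def by (intro sum.cong) simp_all
    then show ?case by (simp add: euclidean_representation)
  qed
qed

end

lemma fresh_sample_compose:
  assumes "fresh_sample M H N Y" and f: "f \<in> measurable N N'"
  shows "fresh_sample M H N' (\<lambda>\<omega>. f (Y \<omega>))"
proof -
  interpret fresh_sample M H N Y by fact
  show ?thesis
  proof
    show "(\<lambda>\<omega>. f (Y \<omega>)) \<in> measurable M N'" using f by measurable
    fix A B assume A: "A \<in> sets H" and B: "B \<in> sets N'"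
    have "(\<lambda>\<omega>. f (Y \<omega>)) -` B \<inter> space M = Y -` (f -` B \<inter> space N) \<inter> space M"
      using measurable_space[OF measurable_sample] by auto
    then show "prob (A \<inter> ((\<lambda>\<omega>. f (Y \<omega>)) -` B \<inter> space M))
        = prob A * prob ((\<lambda>\<omega>. f (Y \<omega>)) -` B \<inter> space M)"
      using indep[OF A measurable_sets[OF f B]] by simp
  qed (rule sub)
qed

section \<open>The stochastic problem\<close>

text \<open>A run of the method, together with the problem, the compressor and the randomness that it uses.
Convexity and the size of \<open>\<gamma>\<close> enter later, in \<open>ec_sgd_convergence\<close>.\<close>

locale ec_sgd_run =
  fixes M :: "'w measure" and \<D> :: "nat \<Rightarrow> 'z measure" and R :: "'r measure"
    and F :: "'z \<Rightarrow> 'a::euclidean_space \<Rightarrow> real" and C :: "'r \<Rightarrow> 'a \<Rightarrow> 'a"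
    and \<xi> :: "nat \<Rightarrow> nat \<Rightarrow> 'w \<Rightarrow> 'z" and \<zeta> :: "nat \<Rightarrow> nat \<Rightarrow> 'w \<Rightarrow> 'r"
    and x :: "nat \<Rightarrow> 'w \<Rightarrow> 'a" and e g v :: "nat \<Rightarrow> nat \<Rightarrow> 'w \<Rightarrow> 'a"
    and f :: "'a \<Rightarrow> real" and x0 xs :: 'a and n :: nat and L \<gamma> \<delta> :: real
  assumes problem: "stochastic_problem n \<D> F L"
    and f_eq: "f = global_obj n \<D> F"
    and compressor: "compression_operator R C \<delta>"
    and fresh: "fresh_randomness M n \<D> R \<xi> \<zeta>"
    and run: "ec_sgd M n F C \<gamma> x0 \<xi> \<zeta> x e g v"
    and variance_finite: "\<And>i. i < n \<Longrightarrow> integrable (\<D> i)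
          (\<lambda>z. (norm (grad (F z) xs - grad (local_obj \<D> F i) xs))\<^sup>2)"
begin

abbreviation "past \<equiv> history M n \<D> R \<xi> \<zeta>"
abbreviation "obj \<equiv> local_obj \<D> F"

lemma n_pos: "0 < n" and L_pos: "0 < L"
  using problem unfolding stochastic_problem_def by auto

lemma \<delta>: "0 < \<delta>" "\<delta> \<le> 1"
  using compressor unfolding compression_operator_def by auto

sublocale prob_space M
  using fresh unfolding fresh_randomness_def by blast

lemma prob_R: "prob_space R"
  using compressor unfolding compression_operator_def by blast

context
  fixes i assumes i: "i < n"
begin

lemma prob_D: "prob_space (\<D> i)"
  and grad_measurable: "(\<lambda>(z, x). grad (F z) x) \<in> borel_measurable (\<D> i \<Otimes>\<^sub>M borel)"
  and AE_smooth: "AE z in \<D> i. L_smooth L (F z)"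
  and integrable_F: "integrable (\<D> i) (\<lambda>z. F z y)"
  and integrable_grad: "integrable (\<D> i) (\<lambda>z. grad (F z) y)"
  and obj_differentiable: "obj i differentiable (at y)"
  and expectation_grad: "(\<integral>z. grad (F z) y \<partial>\<D> i) = grad (obj i) y"
  using problem i unfolding stochastic_problem_def by auto

lemma grad_measurable_sample [measurable]: "(\<lambda>z. grad (F z) y) \<in> borel_measurable (\<D> i)"
  using integrable_grad by auto

lemma grad_obj_lipschitz: "norm (grad (obj i) y - grad (obj i) z) \<le> L * norm (y - z)"
proof -
  interpret D: prob_space "\<D> i" by (rule prob_D)
  have "norm (grad (obj i) y - grad (obj i) z) = norm (\<integral>w. grad (F w) y - grad (F w) z \<partial>\<D> i)"
    by (simp add: expectation_grad[symmetric] integrable_grad)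
  also have "\<dots> \<le> (\<integral>w. norm (grad (F w) y - grad (F w) z) \<partial>\<D> i)"
    by (rule integral_norm_bound)
  also have "\<dots> \<le> (\<integral>w. L * norm (y - z) \<partial>\<D> i)"
  proof (rule integral_mono_AE)
    show "AE w in \<D> i. norm (grad (F w) y - grad (F w) z) \<le> L * norm (y - z)"
      using AE_smooth by eventually_elim (rule L_smoothD)
  qed (auto intro!: integrable_norm Bochner_Integration.integrable_diff integrable_grad)
  also have "\<dots> = L * norm (y - z)" by (simp add: D.prob_space)
  finally show ?thesis .
qed

lemma grad_obj_measurable [measurable]: "grad (obj i) \<in> borel_measurable borel"
proof -
  have "L-lipschitz_on UNIV (grad (obj i))"
    using L_pos grad_obj_lipschitz by (auto intro!: lipschitz_onI simp: dist_norm)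
  then show ?thesis
    by (intro borel_measurable_continuous_onI lipschitz_on_continuous_on)
qed

lemma grad_diff_sq_bound:
  "AE z in \<D> i. (norm (grad (F z) y - grad (F z) y'))\<^sup>2 \<le> L\<^sup>2 * (norm (y - y'))\<^sup>2"
  using AE_smooth
proof eventually_elim
  case (elim z)
  then show ?case
    using power_mono[OF L_smoothD(2)[OF elim, of y y'], of 2] by (simp add: power_mult_distrib)
qed

lemma square_integrable_grad_diff:
  "square_integrable (\<D> i) (\<lambda>z. grad (F z) y - grad (F z) y')"
proof -
  interpret D: prob_space "\<D> i" by (rule prob_D)
  show ?thesis
    by (rule square_integrable_dominated[OF _ _ grad_diff_sq_bound]) auto
qed

lemma square_integrable_grad: "square_integrable (\<D> i) (\<lambda>z. grad (F z) y)"
proof -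
  interpret D: prob_space "\<D> i" by (rule prob_D)
  have "square_integrable (\<D> i) (\<lambda>z. grad (F z) xs - grad (obj i) xs)"
    using variance_finite[OF i] by (simp add: square_integrable_def)
  from square_integrable_add[OF this square_integrable_add[OF square_integrable_grad_diff[of y xs] D.square_integrable_const[of "grad (obj i) xs"]]]
  show ?thesis by simp
qed

end

text \<open>Both quantities are functions of a deterministic point. Evaluated at the current iterate they become
conditional second moments, by freezing.\<close>

definition grad_var :: "nat \<Rightarrow> 'a \<Rightarrow> real" where
  "grad_var i y = (\<integral>z. (norm (grad (F z) y - grad (obj i) y))\<^sup>2 \<partial>\<D> i)"

definition grad_dev :: "nat \<Rightarrow> 'a \<Rightarrow> real" where
  "grad_dev i y = (\<integral>z. (norm (grad (F z) y - grad (F z) xs))\<^sup>2 \<partial>\<D> i)"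

lemma grad_var_nonneg: "0 \<le> grad_var i y" and grad_dev_nonneg: "0 \<le> grad_dev i y"
  by (simp_all add: grad_var_def grad_dev_def)

text \<open>The deviation \<open>grad (obj i) y - grad (obj i) xs\<close> is the mean of the deviation for one sample, so its
square is at most \<open>grad_dev\<close>.\<close>

lemma grad_obj_sq_le:
  assumes i: "i < n" and c: "0 < c"
  shows "(norm (grad (obj i) y))\<^sup>2 \<le> (1 + c) * (norm (grad (obj i) xs))\<^sup>2 + (1 + 1 / c) * grad_dev i y"
proof -
  interpret D: prob_space "\<D> i" by (rule prob_D[OF i])
  have "(norm (grad (obj i) y - grad (obj i) xs))\<^sup>2 \<le> grad_dev i y"
    using D.second_moment_about[OF square_integrable_grad_diff[OF i, of y xs], of 0]
    by (simp add: grad_dev_def expectation_grad[OF i] integrable_grad[OF i])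
  then have "(1 + 1 / c) * (norm (grad (obj i) y - grad (obj i) xs))\<^sup>2 \<le> (1 + 1 / c) * grad_dev i y"
    using c by (intro mult_left_mono) auto
  then show ?thesis
    using norm_add_sq_young[OF c, of "grad (obj i) xs" "grad (obj i) y - grad (obj i) xs"] by simp
qed

text \<open>The variance is at most the second moment about \<open>grad (obj i) xs\<close>, and a sample differs from that point
by its deviation from its own gradient at \<open>xs\<close> plus its noise at \<open>xs\<close>.\<close>

lemma grad_var_le:
  assumes i: "i < n" and c: "0 < c"
  shows "grad_var i y \<le> (1 + c) * grad_var i xs + (1 + 1 / c) * grad_dev i y"
proof -
  interpret D: prob_space "\<D> i" by (rule prob_D[OF i])
  let ?G = "\<lambda>z. grad (F z) y"
  note sq = square_integrable_diff[OF square_integrable_grad[OF i] D.square_integrable_const]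
    square_integrable_grad_diff[OF i]
  have "grad_var i y \<le> (\<integral>z. (norm (?G z - grad (obj i) xs))\<^sup>2 \<partial>\<D> i)"
    using D.second_moment_about[OF square_integrable_grad[OF i, of y], of "grad (obj i) xs"]
    by (simp add: grad_var_def expectation_grad[OF i])
  also have "\<dots> \<le> (\<integral>z. (1 + c) * (norm (grad (F z) xs - grad (obj i) xs))\<^sup>2
      + (1 + 1 / c) * (norm (?G z - grad (F z) xs))\<^sup>2 \<partial>\<D> i)"
  proof (rule integral_mono)
    fix z
    show "(norm (?G z - grad (obj i) xs))\<^sup>2 \<le> (1 + c) * (norm (grad (F z) xs - grad (obj i) xs))\<^sup>2
      + (1 + 1 / c) * (norm (?G z - grad (F z) xs))\<^sup>2"
      using norm_add_sq_young[OF c, of "grad (F z) xs - grad (obj i) xs" "?G z - grad (F z) xs"]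
      by simp
  qed (use sq in \<open>auto simp: square_integrable_def\<close>)
  also have "\<dots> = (1 + c) * grad_var i xs + (1 + 1 / c) * grad_dev i y"
    unfolding grad_var_def grad_dev_def
    using sq by (subst Bochner_Integration.integral_add) (auto simp: square_integrable_def)
  finally show ?thesis .
qed

lemma f_avg: "f = (\<lambda>y. avg n (\<lambda>i. obj i y))"
  unfolding f_eq global_obj_def ..

lemma f_differentiable: "f differentiable (at y)"
  and grad_f: "grad f y = avg n (\<lambda>i. grad (obj i) y)"
  unfolding f_avg by (rule grad_avg; rule obj_differentiable; assumption)+

lemma f_gderiv: "GDERIV f y :> grad f y"
  by (rule GDERIV_grad[OF f_differentiable])

lemma grad_f_lipschitz: "norm (grad f y - grad f z) \<le> L * norm (y - z)"
proof -
  have "norm (grad f y - grad f z) = (1 / real n) * norm (\<Sum>i<n. grad (obj i) y - grad (obj i) z)"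
    unfolding grad_f avg_def by (simp add: sum_subtractf flip: scaleR_diff_right)
  also have "\<dots> \<le> (1 / real n) * (\<Sum>i<n. L * norm (y - z))"
    by (intro mult_left_mono sum_norm_le grad_obj_lipschitz) auto
  also have "\<dots> = L * norm (y - z)" using n_pos by simp
  finally show ?thesis .
qed

lemma f_measurable [measurable]: "f \<in> borel_measurable borel"
  by (intro borel_measurable_continuous_onI continuous_at_imp_continuous_on ballI
      differentiable_imp_continuous_within f_differentiable)

text \<open>The Bregman divergences of the samples average to that of \<open>f\<close>, so convexity estimates for single
samples carry over to \<open>f\<close>.\<close>

lemma avg_bregman:
  "avg n (\<lambda>i. \<integral>z. F z y - F z y' - grad (F z) y' \<bullet> (y - y') \<partial>\<D> i) = f y - f y' - grad f y' \<bullet> (y - y')"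
proof -
  have "(\<integral>z. F z y - F z y' - grad (F z) y' \<bullet> (y - y') \<partial>\<D> i)
      = obj i y - obj i y' - grad (obj i) y' \<bullet> (y - y')" if "i < n" for i
    using that integrable_F[OF that] integrable_grad[OF that]
    by (simp add: local_obj_def expectation_grad)
  then show ?thesis
    unfolding grad_f unfolding f_avg avg_def
    by (simp add: sum_subtractf inner_sum_left right_diff_distrib)
qed

section \<open>Fresh samples and the history\<close>

lemma sample_measurable:
  assumes "i < n" shows "(\<lambda>\<omega>. (\<xi> k i \<omega>, \<zeta> k i \<omega>)) \<in> measurable M (\<D> i \<Otimes>\<^sub>M R)"
proof -
  have "\<forall>p\<in>UNIV \<times> {..<n}. (case p of (k, i) \<Rightarrow> \<lambda>\<omega>. (\<xi> k i \<omega>, \<zeta> k i \<omega>))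
      \<in> measurable M (case p of (k, i) \<Rightarrow> \<D> i \<Otimes>\<^sub>M R)"
    using fresh unfolding fresh_randomness_def indep_vars_def2 by blast
  from bspec[OF this, of "(k, i)"] show ?thesis using assms by simp
qed

lemma xi_measurable: assumes "i < n" shows "\<xi> k i \<in> measurable M (\<D> i)"
  using measurable_compose[OF sample_measurable[OF assms, of k] measurable_fst] by simp

lemma zeta_measurable: assumes "i < n" shows "\<zeta> k i \<in> measurable M R"
  using measurable_compose[OF sample_measurable[OF assms, of k] measurable_snd] by simp

lemma sample_law:
  "i < n \<Longrightarrow> distr M (\<D> i \<Otimes>\<^sub>M R) (\<lambda>\<omega>. (\<xi> k i \<omega>, \<zeta> k i \<omega>)) = \<D> i \<Otimes>\<^sub>M R"
  using fresh unfolding fresh_randomness_def by blast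

lemma xi_law:
  assumes i: "i < n"
  shows "distr M (\<D> i) (\<xi> k i) = \<D> i"
proof -
  interpret R: prob_space R by (rule prob_R)
  have "distr M (\<D> i) (\<xi> k i) = distr (distr M (\<D> i \<Otimes>\<^sub>M R) (\<lambda>\<omega>. (\<xi> k i \<omega>, \<zeta> k i \<omega>))) (\<D> i) fst"
    using sample_measurable[OF i, of k] by (subst distr_distr) (simp_all add: comp_def)
  then show ?thesis by (simp add: sample_law[OF i] R.distr_pair_fst)
qed

lemma AE_xi:
  assumes i: "i < n" and "AE z in \<D> i. P z"
  shows "AE \<omega> in M. P (\<xi> k i \<omega>)"
proof (rule AE_distrD[OF xi_measurable[OF i]])
  show "AE z in distr M (\<D> i) (\<xi> k i). P z" using assms(2) unfolding xi_law[OF i] .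
qed

definition past_events :: "nat \<Rightarrow> 'w set set" where
  "past_events k = {\<xi> j i -` S \<inter> space M |j i S. j < k \<and> i < n \<and> S \<in> sets (\<D> i)} \<union>
      {\<zeta> j i -` S \<inter> space M |j i S. j < k \<and> i < n \<and> S \<in> sets R}"

lemma past_eventsE:
  assumes "A \<in> past_events k"
  obtains j i S where "j < k" "i < n" "S \<in> sets (\<D> i)" "A = \<xi> j i -` S \<inter> space M"
  | j i S where "j < k" "i < n" "S \<in> sets R" "A = \<zeta> j i -` S \<inter> space M"
  using assms unfolding past_events_def by blast

lemma past_eventsI:
  "j < k \<Longrightarrow> i < n \<Longrightarrow> S \<in> sets (\<D> i) \<Longrightarrow> \<xi> j i -` S \<inter> space M \<in> past_events k"
  "j < k \<Longrightarrow> i < n \<Longrightarrow> S' \<in> sets R \<Longrightarrow> \<zeta> j i -` S' \<inter> space M \<in> past_events k"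
  unfolding past_events_def by blast+

lemma past_events_subset: "past_events k \<subseteq> Pow (space M)"
  unfolding past_events_def by blast

lemma sets_history: "sets (past k) = sigma_sets (space M) (past_events k)"
  unfolding history_def past_events_def[symmetric]
  by (rule sets_measure_of[OF past_events_subset])

lemma space_history [simp]: "space (past k) = space M"
  unfolding history_def past_events_def[symmetric]
  by (rule space_measure_of[OF past_events_subset])

lemma subalgebra_history: "subalgebra M (past k)"
proof -
  have "past_events k \<subseteq> sets M"
    by (auto elim!: past_eventsE intro: measurable_sets[OF xi_measurable] measurable_sets[OF zeta_measurable])
  then show ?thesis
    unfolding subalgebra_def sets_history by (simp add: sets.sigma_sets_subset)
qed

lemma history_mono:
  assumes "h \<in> measurable (past k) N" shows "h \<in> measurable (past (Suc k)) N"
proof -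
  have "past_events k \<subseteq> past_events (Suc k)"
    by (auto elim!: past_eventsE intro: past_eventsI less_SucI)
  then have "sets (past k) \<subseteq> sets (past (Suc k))"
    unfolding sets_history by (rule sigma_sets_mono')
  then show ?thesis
    using assms unfolding measurable_def space_history by blast
qed

lemma past_measurable: "h \<in> measurable (past k) N \<Longrightarrow> h \<in> measurable M N"
  by (rule measurable_from_subalg[OF subalgebra_history])

lemma xi_past: assumes i: "i < n" shows "\<xi> k i \<in> measurable (past (Suc k)) (\<D> i)"
proof (rule measurableI)
  fix S assume "S \<in> sets (\<D> i)"
  then show "\<xi> k i -` S \<inter> space (past (Suc k)) \<in> sets (past (Suc k))"
    unfolding sets_history space_history by (intro sigma_sets.Basic past_eventsI lessI i)
qed (simp add: measurable_space[OF xi_measurable[OF i]])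

lemma zeta_past: assumes i: "i < n" shows "\<zeta> k i \<in> measurable (past (Suc k)) R"
proof (rule measurableI)
  fix S assume "S \<in> sets R"
  then show "\<zeta> k i -` S \<inter> space (past (Suc k)) \<in> sets (past (Suc k))"
    unfolding sets_history space_history by (intro sigma_sets.Basic past_eventsI lessI i)
qed (simp add: measurable_space[OF zeta_measurable[OF i]])

text \<open>The history is contained in the \<open>\<sigma>\<close>-algebra generated by the family of all earlier pairs of samples,
and that family is independent of the family of the pairs of iteration \<open>k\<close>.\<close>

lemma fresh_block:
  "fresh_sample M (past k) (PiM ({k} \<times> {..<n}) (\<lambda>(k, i). \<D> i \<Otimes>\<^sub>M R))
     (\<lambda>\<omega>. \<lambda>p\<in>{k} \<times> {..<n}. case p of (k, i) \<Rightarrow> (\<xi> k i \<omega>, \<zeta> k i \<omega>))"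
proof -
  let ?X = "\<lambda>p \<omega>. case p of (k, i) \<Rightarrow> (\<xi> k i \<omega>, \<zeta> k i \<omega>)"
  let ?N = "\<lambda>(k::nat, i). \<D> i \<Otimes>\<^sub>M R"
  let ?Z = "\<lambda>\<omega>. \<lambda>p\<in>{..<k} \<times> {..<n}. ?X p \<omega>" and ?P = "PiM ({..<k} \<times> {..<n}) ?N"
  let ?Y = "\<lambda>\<omega>. \<lambda>p\<in>{k} \<times> {..<n}. ?X p \<omega>" and ?Q = "PiM ({k} \<times> {..<n}) ?N"
  let ?V = "vimage_algebra (space M) ?Z ?P"
  have "indep_vars ?N (\<lambda>(k, i) \<omega>. (\<xi> k i \<omega>, \<zeta> k i \<omega>)) (UNIV \<times> {..<n})"
    using fresh unfolding fresh_randomness_def by blast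
  moreover have "(\<lambda>(k, i) \<omega>. (\<xi> k i \<omega>, \<zeta> k i \<omega>)) = ?X" by (auto simp: fun_eq_iff)
  ultimately have "indep_vars ?N ?X (UNIV \<times> {..<n})" by simp
  then have ind: "indep_var ?P ?Z ?Q ?Y"
    by (rule indep_var_restrict) auto
  then have Z: "?Z \<in> measurable M ?P" and Y: "?Y \<in> measurable M ?Q"
    unfolding indep_var_eq by blast+
  have Z_space: "?Z \<in> space M \<rightarrow> space ?P"
    using measurable_space[OF Z] by blast
  have comp: "(\<lambda>\<omega>. ?Z \<omega> (j, i)) \<in> measurable ?V (\<D> i \<Otimes>\<^sub>M R)" if "j < k" "i < n" for j i
  proof (rule measurable_compose[where f = ?Z and g = "\<lambda>h. h (j, i)"])
    show "?Z \<in> measurable ?V ?P"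
      by (rule measurable_vimage_algebra1[OF Z_space])
    show "(\<lambda>h. h (j, i)) \<in> measurable ?P (\<D> i \<Otimes>\<^sub>M R)"
      using measurable_component_singleton[of "(j, i)" "{..<k} \<times> {..<n}" ?N] that by simp
  qed
  have \<xi>': "\<xi> j i \<in> measurable ?V (\<D> i)" and \<zeta>': "\<zeta> j i \<in> measurable ?V R" if "j < k" "i < n" for j i
    using measurable_compose[OF comp[OF that] measurable_fst]
      measurable_compose[OF comp[OF that] measurable_snd] that by simp_all
  have "past_events k \<subseteq> sets ?V"
  proof
    fix A assume "A \<in> past_events k"
    then show "A \<in> sets ?V"
    proof (cases rule: past_eventsE)
      case (1 j i S)
      show ?thesis
        using measurable_sets[OF \<xi>'[OF 1(1,2)] 1(3)] unfolding 1(4) space_vimage_algebra .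
    next
      case (2 j i S)
      show ?thesis
        using measurable_sets[OF \<zeta>'[OF 2(1,2)] 2(3)] unfolding 2(4) space_vimage_algebra .
    qed
  qed
  then have "sets (past k) \<subseteq> sets ?V"
    unfolding sets_history using sets.sigma_sets_subset[of "past_events k" ?V]
    unfolding space_vimage_algebra by blast
  then have past_sets: "A \<in> {?Z -` S \<inter> space M |S. S \<in> sets ?P}" if "A \<in> sets (past k)" for A
    using that unfolding sets_vimage_algebra2[OF Z_space] by (rule subsetD)
  show ?thesis
  proof
    show "subalgebra M (past k)" by (rule subalgebra_history)
    show "?Y \<in> measurable M ?Q" by (rule Y)
    fix A B assume A: "A \<in> sets (past k)" and B: "B \<in> sets ?Q"
    from past_sets[OF A] obtain S where S: "S \<in> sets ?P" "A = ?Z -` S \<inter> space M" by auto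
    have "prob (A \<inter> (?Y -` B \<inter> space M)) = prob ((\<lambda>\<omega>. (?Z \<omega>, ?Y \<omega>)) -` (S \<times> B) \<inter> space M)"
      unfolding S(2) by (rule arg_cong[of _ _ prob]) blast
    also have "\<dots> = prob A * prob (?Y -` B \<inter> space M)"
      unfolding S by (rule indep_varD[OF ind S(1) B])
    finally show "prob (A \<inter> (?Y -` B \<inter> space M)) = prob A * prob (?Y -` B \<inter> space M)" .
  qed
qed

lemma fresh_worker:
  assumes i: "i < n"
  shows "fresh_sample M (past k) (\<D> i \<Otimes>\<^sub>M R) (\<lambda>\<omega>. (\<xi> k i \<omega>, \<zeta> k i \<omega>))"
  using fresh_sample_compose[OF fresh_block, of "\<lambda>h. h (k, i)" k "\<D> i \<Otimes>\<^sub>M R"]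
    measurable_component_singleton[of "(k, i)" "{k} \<times> {..<n}" "\<lambda>(k, i). \<D> i \<Otimes>\<^sub>M R"] i
  by simp

lemma fresh_xi:
  assumes i: "i < n"
  shows "fresh_sample M (past k) (\<D> i) (\<xi> k i)"
  using fresh_sample_compose[OF fresh_worker[OF i], of fst "\<D> i"] by simp

lemma indep_workers:
  fixes h h' :: "'z \<Rightarrow> 'c::topological_space"
  assumes "i < n" "j < n" "i \<noteq> j"
    and [measurable]: "h \<in> borel_measurable (\<D> i)" "h' \<in> borel_measurable (\<D> j)"
  shows "indep_var borel (\<lambda>\<omega>. h (\<xi> k i \<omega>)) borel (\<lambda>\<omega>. h' (\<xi> k j \<omega>))"
proof -
  let ?X = "\<lambda>p \<omega>. case p of (k, i) \<Rightarrow> (\<xi> k i \<omega>, \<zeta> k i \<omega>)"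
  let ?N = "\<lambda>(k::nat, i). \<D> i \<Otimes>\<^sub>M R"
  have "indep_vars ?N (\<lambda>(k, i) \<omega>. (\<xi> k i \<omega>, \<zeta> k i \<omega>)) (UNIV \<times> {..<n})"
    using fresh unfolding fresh_randomness_def by blast
  moreover have "(\<lambda>(k, i) \<omega>. (\<xi> k i \<omega>, \<zeta> k i \<omega>)) = ?X" by (auto simp: fun_eq_iff)
  ultimately have "indep_vars ?N ?X (UNIV \<times> {..<n})" by simp
  then have ind: "indep_var (PiM {(k, i)} ?N) (\<lambda>\<omega>. restrict (\<lambda>p. ?X p \<omega>) {(k, i)})
      (PiM {(k, j)} ?N) (\<lambda>\<omega>. restrict (\<lambda>p. ?X p \<omega>) {(k, j)})"
    using assms by (intro indep_var_restrict) auto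
  have comp: "(\<lambda>q. u (fst (q (k, l)))) \<in> borel_measurable (PiM {(k, l)} ?N)"
    if "u \<in> borel_measurable (\<D> l)" for l and u :: "'z \<Rightarrow> 'c::topological_space"
  proof -
    have "(\<lambda>q. q (k, l)) \<in> measurable (PiM {(k, l)} ?N) (\<D> l \<Otimes>\<^sub>M R)"
      using measurable_component_singleton[of "(k, l)" "{(k, l)}" ?N] by simp
    from measurable_compose[OF measurable_compose[OF this measurable_fst] that]
    show ?thesis .
  qed
  show ?thesis
    using indep_var_compose[OF ind comp comp, of h h'] assms(4,5) by (simp add: comp_def)
qed

section \<open>Measurability and integrability of the iterates\<close>

lemma x_0: "\<omega> \<in> space M \<Longrightarrow> x 0 \<omega> = x0"
  and e_0: "\<omega> \<in> space M \<Longrightarrow> i < n \<Longrightarrow> e 0 i \<omega> = 0"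
  and x_Suc: "\<omega> \<in> space M \<Longrightarrow> x (Suc k) \<omega> = x k \<omega> - avg n (\<lambda>i. v k i \<omega>)"
  and g_eq: "\<omega> \<in> space M \<Longrightarrow> i < n \<Longrightarrow> g k i \<omega> = grad (F (\<xi> k i \<omega>)) (x k \<omega>)"
  and v_eq: "\<omega> \<in> space M \<Longrightarrow> i < n \<Longrightarrow> v k i \<omega> = C (\<zeta> k i \<omega>) (e k i \<omega> + \<gamma> *\<^sub>R g k i \<omega>)"
  and e_Suc: "\<omega> \<in> space M \<Longrightarrow> i < n \<Longrightarrow> e (Suc k) i \<omega> = e k i \<omega> + \<gamma> *\<^sub>R g k i \<omega> - v k i \<omega>"
  using run unfolding ec_sgd_def by simp_all

lemma measurable_step:
  assumes x [measurable]: "x k \<in> borel_measurable (past k)"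
    and e: "\<And>i. i < n \<Longrightarrow> e k i \<in> borel_measurable (past k)" and i: "i < n"
  shows g_measurable_past: "g k i \<in> borel_measurable (past (Suc k))"
    and v_measurable_past: "v k i \<in> borel_measurable (past (Suc k))"
proof -
  note [measurable] = history_mono[OF x] history_mono[OF e[OF i]] xi_past[OF i, of k] zeta_past[OF i, of k]
  have "(\<lambda>\<omega>. (\<lambda>(z, y). grad (F z) y) (\<xi> k i \<omega>, x k \<omega>)) \<in> borel_measurable (past (Suc k))"
    by (rule measurable_compose[OF _ grad_measurable[OF i]]) measurable
  then show g [measurable]: "g k i \<in> borel_measurable (past (Suc k))"
    by (subst measurable_cong[of _ _ "\<lambda>\<omega>. (\<lambda>(z, y). grad (F z) y) (\<xi> k i \<omega>, x k \<omega>)"])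
      (simp_all add: g_eq i)
  have "(\<lambda>(r, y). C r y) \<in> borel_measurable (R \<Otimes>\<^sub>M borel)"
    using compressor unfolding compression_operator_def by blast
  then have "(\<lambda>\<omega>. (\<lambda>(r, y). C r y) (\<zeta> k i \<omega>, e k i \<omega> + \<gamma> *\<^sub>R g k i \<omega>)) \<in> borel_measurable (past (Suc k))"
    by (rule measurable_compose[rotated]) measurable
  then show "v k i \<in> borel_measurable (past (Suc k))"
    by (subst measurable_cong[of _ _ "\<lambda>\<omega>. (\<lambda>(r, y). C r y) (\<zeta> k i \<omega>, e k i \<omega> + \<gamma> *\<^sub>R g k i \<omega>)"])
      (simp_all add: v_eq i)
qed

lemma iterates_measurable_past:
  shows x_past: "x k \<in> borel_measurable (past k)"
    and e_past: "i < n \<Longrightarrow> e k i \<in> borel_measurable (past k)"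
proof -
  have "x k \<in> borel_measurable (past k) \<and> (\<forall>i<n. e k i \<in> borel_measurable (past k))"
  proof (induction k)
    case 0
    have "x 0 \<in> borel_measurable (past 0)"
      by (subst measurable_cong[of _ _ "\<lambda>_. x0"]) (simp_all add: x_0)
    moreover have "e 0 i \<in> borel_measurable (past 0)" if "i < n" for i
      by (subst measurable_cong[of _ _ "\<lambda>_. 0"]) (simp_all add: e_0 that)
    ultimately show ?case by blast
  next
    case (Suc k)
    then have g: "g k i \<in> borel_measurable (past (Suc k))"
      and v: "v k i \<in> borel_measurable (past (Suc k))"
      and e: "e k i \<in> borel_measurable (past (Suc k))" if "i < n" for i
      using that measurable_step[of k i] history_mono by blast+
    have x: "x k \<in> borel_measurable (past (Suc k))"
      using Suc history_mono by blast
    have "x (Suc k) \<in> borel_measurable (past (Suc k))"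
    proof (subst measurable_cong[of _ _ "\<lambda>\<omega>. x k \<omega> - avg n (\<lambda>i. v k i \<omega>)"])
      show "(\<lambda>\<omega>. x k \<omega> - avg n (\<lambda>i. v k i \<omega>)) \<in> borel_measurable (past (Suc k))"
        unfolding avg_def
        by (intro borel_measurable_diff borel_measurable_scaleR borel_measurable_sum x v) auto
    qed (simp add: x_Suc)
    moreover have "e (Suc k) i \<in> borel_measurable (past (Suc k))" if "i < n" for i
    proof (subst measurable_cong[of _ _ "\<lambda>\<omega>. e k i \<omega> + \<gamma> *\<^sub>R g k i \<omega> - v k i \<omega>"])
      show "(\<lambda>\<omega>. e k i \<omega> + \<gamma> *\<^sub>R g k i \<omega> - v k i \<omega>) \<in> borel_measurable (past (Suc k))"
        by (intro borel_measurable_diff borel_measurable_add borel_measurable_scaleR borel_measurable_const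
            e[OF that] g[OF that] v[OF that])
    qed (simp add: e_Suc that)
    ultimately show ?case by blast
  qed
  then show "x k \<in> borel_measurable (past k)" "i < n \<Longrightarrow> e k i \<in> borel_measurable (past k)"
    by blast+
qed

lemma x_measurable [measurable]: "x k \<in> borel_measurable M"
  and e_measurable: "i < n \<Longrightarrow> e k i \<in> borel_measurable M"
  and g_measurable: "i < n \<Longrightarrow> g k i \<in> borel_measurable M"
  using iterates_measurable_past measurable_step past_measurable by blast+

lemma square_integrable_sample_grad:
  assumes i: "i < n"
  shows "square_integrable M (\<lambda>\<omega>. grad (F (\<xi> k i \<omega>)) y)"
proof -
  have "square_integrable (distr M (\<D> i) (\<xi> k i)) (\<lambda>z. grad (F z) y)"
    using square_integrable_grad[OF i] by (simp only: xi_law[OF i])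
  then show ?thesis
    using xi_measurable[OF i, of k] grad_measurable_sample[OF i, of y]
    by (auto simp: square_integrable_def integrable_distr_eq intro: measurable_compose)
qed

text \<open>By the Lipschitz property a stochastic gradient differs from the one at \<open>xs\<close> by at most
\<open>L \<bar>x k - xs\<bar>\<close>, and the one at \<open>xs\<close> has finite variance.\<close>

lemma square_integrable_g:
  assumes x: "square_integrable M (x k)" and i: "i < n"
  shows "square_integrable M (g k i)"
proof -
  let ?G = "\<lambda>\<omega>. grad (F (\<xi> k i \<omega>)) xs"
  have G: "square_integrable M ?G" by (rule square_integrable_sample_grad[OF i])
  have dx: "square_integrable M (\<lambda>\<omega>. x k \<omega> - xs)"
    by (intro square_integrable_diff x square_integrable_const)
  have "square_integrable M (\<lambda>\<omega>. g k i \<omega> - ?G \<omega>)"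
  proof (rule square_integrable_dominated)
    show "(\<lambda>\<omega>. g k i \<omega> - ?G \<omega>) \<in> borel_measurable M"
      using G g_measurable[OF i] by (auto simp: square_integrable_def)
    show "integrable M (\<lambda>\<omega>. L\<^sup>2 * (norm (x k \<omega> - xs))\<^sup>2)"
      using dx by (simp add: square_integrable_def)
    show "AE \<omega> in M. (norm (g k i \<omega> - ?G \<omega>))\<^sup>2 \<le> L\<^sup>2 * (norm (x k \<omega> - xs))\<^sup>2"
      using AE_xi[OF i AE_smooth[OF i], of k] AE_space
    proof eventually_elim
      case (elim \<omega>)
      then show ?case
        using power_mono[OF L_smoothD(2)[OF elim(1), of "x k \<omega>" xs], of 2]
        by (simp add: power_mult_distrib g_eq i)
    qed
  qed
  from square_integrable_add[OF this G] show ?thesis by simp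
qed

text \<open>The compressor draws \<open>\<zeta>\<close> afresh even after the gradient sample \<open>\<xi>\<close> is known, so the compression
inequality applies for every fixed past and fixed \<open>\<xi>\<close>. Working with the nonnegative integral gives the
integrability of the new error together with the inequality.\<close>

lemma compression_step:
  assumes i: "i < n" and a: "square_integrable M (\<lambda>\<omega>. e k i \<omega> + \<gamma> *\<^sub>R g k i \<omega>)"
  shows "square_integrable M (e (Suc k) i)"
    and "(\<integral>\<omega>. (norm (e (Suc k) i \<omega>))\<^sup>2 \<partial>M) \<le> (1 - \<delta>) * (\<integral>\<omega>. (norm (e k i \<omega> + \<gamma> *\<^sub>R g k i \<omega>))\<^sup>2 \<partial>M)"
proof -
  interpret fresh_sample M "past k" "\<D> i \<Otimes>\<^sub>M R" "\<lambda>\<omega>. (\<xi> k i \<omega>, \<zeta> k i \<omega>)"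
    by (rule fresh_worker[OF i])
  interpret D: prob_space "\<D> i" by (rule prob_D[OF i])
  interpret R: prob_space R by (rule prob_R)
  (* A is the vector to be compressed and B the negative of the new error, both as functions of the past and
     the pair of fresh samples *)
  define A where "A q = e k i (fst q) + \<gamma> *\<^sub>R grad (F (fst (snd q))) (x k (fst q))" for q :: "'w \<times> 'z \<times> 'r"
  define B where "B q = C (snd (snd q)) (A q) - A q" for q
  have C: "(\<lambda>(r, y). C r y) \<in> borel_measurable (R \<Otimes>\<^sub>M borel)"
    and C_int: "integrable R (\<lambda>r. (norm (C r y - y))\<^sup>2)"
    and C_le: "(\<integral>r. (norm (C r y - y))\<^sup>2 \<partial>R) \<le> (1 - \<delta>) * (norm y)\<^sup>2" for y
    using compressor unfolding compression_operator_def by blast+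
  note [measurable] = x_past[of k] e_past[OF i, of k]
  have "(\<lambda>q. (\<lambda>(z, y). grad (F z) y) (fst (snd q), x k (fst q)))
      \<in> borel_measurable (past k \<Otimes>\<^sub>M (\<D> i \<Otimes>\<^sub>M R))"
    by (rule measurable_compose[OF _ grad_measurable[OF i]]) measurable
  then have [measurable]: "(\<lambda>q. grad (F (fst (snd q))) (x k (fst q)))
      \<in> borel_measurable (past k \<Otimes>\<^sub>M (\<D> i \<Otimes>\<^sub>M R))" by simp
  have A_meas [measurable]: "A \<in> borel_measurable (past k \<Otimes>\<^sub>M (\<D> i \<Otimes>\<^sub>M R))"
    unfolding A_def[abs_def] by measurable
  have "(\<lambda>q. (\<lambda>(r, y). C r y) (snd (snd q), A q)) \<in> borel_measurable (past k \<Otimes>\<^sub>M (\<D> i \<Otimes>\<^sub>M R))"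
    by (rule measurable_compose[OF _ C]) measurable
  then have [measurable]: "(\<lambda>q. C (snd (snd q)) (A q)) \<in> borel_measurable (past k \<Otimes>\<^sub>M (\<D> i \<Otimes>\<^sub>M R))"
    by simp
  have m1: "(\<lambda>q. ennreal ((norm (B q))\<^sup>2)) \<in> borel_measurable (past k \<Otimes>\<^sub>M (\<D> i \<Otimes>\<^sub>M R))"
    and m2: "(\<lambda>q. ennreal ((1 - \<delta>) * (norm (A q))\<^sup>2)) \<in> borel_measurable (past k \<Otimes>\<^sub>M (\<D> i \<Otimes>\<^sub>M R))"
    unfolding B_def[abs_def] by measurable
  have split: "(\<integral>\<^sup>+p. h p \<partial>distr M (\<D> i \<Otimes>\<^sub>M R) (\<lambda>\<omega>. (\<xi> k i \<omega>, \<zeta> k i \<omega>)))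
      = (\<integral>\<^sup>+z. \<integral>\<^sup>+r. h (z, r) \<partial>R \<partial>\<D> i)" if "h \<in> borel_measurable (\<D> i \<Otimes>\<^sub>M R)" for h
    unfolding sample_law[OF i] using that by (rule R.nn_integral_fst[symmetric])
  have a_expr: "e k i \<omega> + \<gamma> *\<^sub>R g k i \<omega> = A (\<omega>, \<xi> k i \<omega>, \<zeta> k i \<omega>)" if "\<omega> \<in> space M" for \<omega>
    using that i by (simp add: g_eq A_def)
  then have e_expr: "e (Suc k) i \<omega> = - B (\<omega>, \<xi> k i \<omega>, \<zeta> k i \<omega>)" if "\<omega> \<in> space M" for \<omega>
    using that i by (simp add: e_Suc v_eq B_def)
  have "(\<integral>\<^sup>+\<omega>. ennreal ((norm (e (Suc k) i \<omega>))\<^sup>2) \<partial>M)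
      = (\<integral>\<^sup>+\<omega>. ennreal ((norm (B (\<omega>, \<xi> k i \<omega>, \<zeta> k i \<omega>)))\<^sup>2) \<partial>M)"
    by (intro nn_integral_cong) (simp add: e_expr)
  also have "\<dots> = (\<integral>\<^sup>+\<omega>. \<integral>\<^sup>+p. ennreal ((norm (B (\<omega>, p)))\<^sup>2)
      \<partial>distr M (\<D> i \<Otimes>\<^sub>M R) (\<lambda>\<omega>. (\<xi> k i \<omega>, \<zeta> k i \<omega>)) \<partial>M)"
    by (rule freeze_nn_integral[OF m1])
  also have "\<dots> \<le> (\<integral>\<^sup>+\<omega>. \<integral>\<^sup>+p. ennreal ((1 - \<delta>) * (norm (A (\<omega>, p)))\<^sup>2)
      \<partial>distr M (\<D> i \<Otimes>\<^sub>M R) (\<lambda>\<omega>. (\<xi> k i \<omega>, \<zeta> k i \<omega>)) \<partial>M)"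
  proof (rule nn_integral_mono)
    fix \<omega> assume "\<omega> \<in> space M"
    then have pair: "(\<lambda>p. (\<omega>, p)) \<in> measurable (\<D> i \<Otimes>\<^sub>M R) (past k \<Otimes>\<^sub>M (\<D> i \<Otimes>\<^sub>M R))" by simp
    have "(\<integral>\<^sup>+r. ennreal ((norm (B (\<omega>, z, r)))\<^sup>2) \<partial>R)
        \<le> (\<integral>\<^sup>+r. ennreal ((1 - \<delta>) * (norm (A (\<omega>, z, r)))\<^sup>2) \<partial>R)" for z
    proof -
      let ?y = "e k i \<omega> + \<gamma> *\<^sub>R grad (F z) (x k \<omega>)"
      have "(\<integral>\<^sup>+r. ennreal ((norm (C r ?y - ?y))\<^sup>2) \<partial>R) = ennreal (\<integral>r. (norm (C r ?y - ?y))\<^sup>2 \<partial>R)"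
        by (rule nn_integral_eq_integral[OF C_int]) simp
      also have "\<dots> \<le> ennreal ((1 - \<delta>) * (norm ?y)\<^sup>2)"
        by (rule ennreal_leI[OF C_le])
      also have "\<dots> = (\<integral>\<^sup>+r. ennreal ((1 - \<delta>) * (norm ?y)\<^sup>2) \<partial>R)"
        by (simp add: R.emeasure_space_1)
      finally show ?thesis unfolding A_def B_def fst_conv snd_conv .
    qed
    then show "(\<integral>\<^sup>+p. ennreal ((norm (B (\<omega>, p)))\<^sup>2) \<partial>distr M (\<D> i \<Otimes>\<^sub>M R) (\<lambda>\<omega>. (\<xi> k i \<omega>, \<zeta> k i \<omega>)))
        \<le> (\<integral>\<^sup>+p. ennreal ((1 - \<delta>) * (norm (A (\<omega>, p)))\<^sup>2) \<partial>distr M (\<D> i \<Otimes>\<^sub>M R) (\<lambda>\<omega>. (\<xi> k i \<omega>, \<zeta> k i \<omega>)))"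
      unfolding split[OF measurable_compose[OF pair m1]] split[OF measurable_compose[OF pair m2]]
      by (rule nn_integral_mono)
  qed
  also have "\<dots> = (\<integral>\<^sup>+\<omega>. ennreal ((1 - \<delta>) * (norm (A (\<omega>, \<xi> k i \<omega>, \<zeta> k i \<omega>)))\<^sup>2) \<partial>M)"
    by (rule freeze_nn_integral[OF m2, symmetric])
  also have "\<dots> = (\<integral>\<^sup>+\<omega>. ennreal ((1 - \<delta>) * (norm (e k i \<omega> + \<gamma> *\<^sub>R g k i \<omega>))\<^sup>2) \<partial>M)"
    by (intro nn_integral_cong) (simp add: a_expr)
  also have "\<dots> = ennreal ((1 - \<delta>) * (\<integral>\<omega>. (norm (e k i \<omega> + \<gamma> *\<^sub>R g k i \<omega>))\<^sup>2 \<partial>M))"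
    using a \<delta> by (subst nn_integral_eq_integral) (auto simp: square_integrable_def)
  finally have le: "(\<integral>\<^sup>+\<omega>. ennreal ((norm (e (Suc k) i \<omega>))\<^sup>2) \<partial>M)
      \<le> ennreal ((1 - \<delta>) * (\<integral>\<omega>. (norm (e k i \<omega> + \<gamma> *\<^sub>R g k i \<omega>))\<^sup>2 \<partial>M))" .
  have "integrable M (\<lambda>\<omega>. (norm (e (Suc k) i \<omega>))\<^sup>2)"
    using e_measurable[OF i, of "Suc k"] le_less_trans[OF le ennreal_less_top]
    by (intro integrableI_bounded) auto
  then show "square_integrable M (e (Suc k) i)"
    using e_measurable[OF i] by (simp add: square_integrable_def)
  have "0 \<le> (1 - \<delta>) * (\<integral>\<omega>. (norm (e k i \<omega> + \<gamma> *\<^sub>R g k i \<omega>))\<^sup>2 \<partial>M)"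
    using \<delta> by simp
  then show "(\<integral>\<omega>. (norm (e (Suc k) i \<omega>))\<^sup>2 \<partial>M) \<le> (1 - \<delta>) * (\<integral>\<omega>. (norm (e k i \<omega> + \<gamma> *\<^sub>R g k i \<omega>))\<^sup>2 \<partial>M)"
    using le \<open>integrable M (\<lambda>\<omega>. (norm (e (Suc k) i \<omega>))\<^sup>2)\<close>
    by (subst (asm) nn_integral_eq_integral) (auto simp: ennreal_le_iff)
qed

text \<open>The new iterate is a linear combination of square integrable quantities, because
\<open>v k i = e k i + \<gamma> g k i - e (Suc k) i\<close>.\<close>

lemma square_integrable_iterates:
  shows square_integrable_x: "square_integrable M (x k)"
    and square_integrable_e: "i < n \<Longrightarrow> square_integrable M (e k i)"
proof -
  have "square_integrable M (x k) \<and> (\<forall>i<n. square_integrable M (e k i))"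
  proof (induction k)
    case 0
    have "square_integrable M (x 0)"
      by (rule square_integrable_cong_AE[OF _ square_integrable_const[of x0] x_measurable])
        (simp add: x_0)
    moreover have "square_integrable M (e 0 i)" if "i < n" for i
      by (rule square_integrable_cong_AE[OF _ square_integrable_const[of 0] e_measurable[OF that]])
        (simp add: e_0 that)
    ultimately show ?case by blast
  next
    case (Suc k)
    have a: "square_integrable M (\<lambda>\<omega>. e k i \<omega> + \<gamma> *\<^sub>R g k i \<omega>)" if "i < n" for i
      using Suc that by (intro square_integrable_add square_integrable_scaleR square_integrable_g) auto
    have e: "square_integrable M (e (Suc k) i)" if "i < n" for i
      using compression_step(1)[OF that a[OF that]] .
    have "square_integrable M (\<lambda>\<omega>. x k \<omega> - avg n (\<lambda>i. (e k i \<omega> + \<gamma> *\<^sub>R g k i \<omega>) - e (Suc k) i \<omega>))"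
      using Suc by (intro square_integrable_diff square_integrable_avg a e) auto
    then have "square_integrable M (x (Suc k))"
      by (rule square_integrable_cong_AE[rotated, OF _ x_measurable])
        (auto simp: x_Suc e_Suc avg_def)
    then show ?case using e by blast
  qed
  then show "square_integrable M (x k)" "i < n \<Longrightarrow> square_integrable M (e k i)"
    by blast+
qed

lemma square_integrable_g_run: "i < n \<Longrightarrow> square_integrable M (g k i)"
  by (rule square_integrable_g[OF square_integrable_x])

lemma square_integrable_grad_x:
  assumes i: "i < n"
  shows "square_integrable M (\<lambda>\<omega>. grad (obj i) (x k \<omega>))"
proof -
  have "square_integrable M (\<lambda>\<omega>. grad (obj i) (x k \<omega>) - grad (obj i) xs)"
  proof (rule square_integrable_dominated)
    show "integrable M (\<lambda>\<omega>. L\<^sup>2 * (norm (x k \<omega> - xs))\<^sup>2)"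
      using square_integrable_diff[OF square_integrable_x square_integrable_const]
      by (simp add: square_integrable_def)
    show "AE \<omega> in M. (norm (grad (obj i) (x k \<omega>) - grad (obj i) xs))\<^sup>2 \<le> L\<^sup>2 * (norm (x k \<omega> - xs))\<^sup>2"
      using power_mono[OF grad_obj_lipschitz[OF i], of _ xs 2] by (simp add: power_mult_distrib)
  qed (use grad_obj_measurable[OF i] in measurable)
  from square_integrable_add[OF this square_integrable_const[of "grad (obj i) xs"]]
  show ?thesis by simp
qed

section \<open>Conditional moments of the stochastic gradients\<close>

lemma grad_frozen_measurable:
  assumes i: "i < n"
  shows "(\<lambda>q. grad (F (snd q)) (x k (fst q))) \<in> borel_measurable (past k \<Otimes>\<^sub>M \<D> i)"
proof -
  note [measurable] = x_past[of k]
  have "(\<lambda>q. (\<lambda>(z, y). grad (F z) y) (snd q, x k (fst q))) \<in> borel_measurable (past k \<Otimes>\<^sub>M \<D> i)"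
    by (rule measurable_compose[OF _ grad_measurable[OF i]]) measurable
  then show ?thesis by simp
qed

lemma grad_obj_frozen_measurable:
  assumes i: "i < n"
  shows "(\<lambda>q. grad (obj i) (x k (fst q))) \<in> borel_measurable (past k \<Otimes>\<^sub>M \<D> i)"
  by (rule measurable_compose[OF measurable_compose[OF measurable_fst x_past] grad_obj_measurable[OF i]])

lemma cond_exp_g:
  assumes i: "i < n"
  shows "AE \<omega> in M. vec_cond_exp M (past k) (g k i) \<omega> = grad (obj i) (x k \<omega>)"
proof -
  interpret fresh_sample M "past k" "\<D> i" "\<xi> k i" by (rule fresh_xi[OF i])
  have "AE \<omega> in M. vec_cond_exp M (past k) (g k i) \<omega>
      = (\<integral>z. (\<lambda>q. grad (F (snd q)) (x k (fst q))) (\<omega>, z) \<partial>distr M (\<D> i) (\<xi> k i))"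
  proof (rule freeze_vec_cond_exp[OF grad_frozen_measurable[OF i]])
    show "integrable M (g k i)"
      by (rule square_integrable_integrable[OF square_integrable_g_run[OF i]])
  qed (simp_all add: g_eq i xi_law integrable_grad)
  then show ?thesis by (simp add: xi_law[OF i] expectation_grad[OF i])
qed

text \<open>The reference value \<open>X\<close> may depend on the sample as well: it is \<open>grad (obj i)\<close> at the iterate for the
variance and the gradient of the same sample at \<open>xs\<close> for the deviation. It is given only almost surely,
because conditional expectations such as that of \<open>g k i\<close> are.\<close>

lemma cond_exp_frozen_sq:
  assumes i: "i < n"
    and m [measurable]: "(\<lambda>q. m (fst q) (snd q)) \<in> borel_measurable (past k \<Otimes>\<^sub>M \<D> i)"
    and sq: "square_integrable M (\<lambda>\<omega>. g k i \<omega> - X \<omega>)"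
    and X: "AE \<omega> in M. X \<omega> = m \<omega> (\<xi> k i \<omega>)"
  shows "AE \<omega> in M. real_cond_exp M (past k) (\<lambda>\<omega>. (norm (g k i \<omega> - X \<omega>))\<^sup>2) \<omega>
    = (\<integral>z. (norm (grad (F z) (x k \<omega>) - m \<omega> z))\<^sup>2 \<partial>\<D> i)"
proof -
  interpret fresh_sample M "past k" "\<D> i" "\<xi> k i" by (rule fresh_xi[OF i])
  note [measurable] = grad_frozen_measurable[OF i]
  have "AE \<omega> in M. real_cond_exp M (past k) (\<lambda>\<omega>. (norm (g k i \<omega> - X \<omega>))\<^sup>2) \<omega>
    = (\<integral>z. (\<lambda>q. (norm (grad (F (snd q)) (x k (fst q)) - m (fst q) (snd q)))\<^sup>2) (\<omega>, z) \<partial>distr M (\<D> i) (\<xi> k i))"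
  proof (rule freeze_cond_exp)
    show "integrable M (\<lambda>\<omega>. (norm (g k i \<omega> - X \<omega>))\<^sup>2)"
      using sq by (simp add: square_integrable_def)
    show "AE \<omega> in M. (norm (g k i \<omega> - X \<omega>))\<^sup>2
      = (\<lambda>q. (norm (grad (F (snd q)) (x k (fst q)) - m (fst q) (snd q)))\<^sup>2) (\<omega>, \<xi> k i \<omega>)"
      using X AE_space by eventually_elim (simp add: g_eq i)
  qed measurable
  then show ?thesis by (simp add: xi_law[OF i])
qed

lemma vec_cond_exp_measurable: "vec_cond_exp M (past k) X \<in> borel_measurable M"
proof -
  have "real_cond_exp M (past k) h \<in> borel_measurable M" for h
    by (rule borel_measurable_cond_exp2)
  then show ?thesis unfolding vec_cond_exp_def[abs_def] by measurable
qed

lemma square_integrable_noise: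
  assumes i: "i < n"
  shows "square_integrable M (\<lambda>\<omega>. g k i \<omega> - vec_cond_exp M (past k) (g k i) \<omega>)"
proof (rule square_integrable_cong_AE)
  show "AE \<omega> in M. g k i \<omega> - grad (obj i) (x k \<omega>) = g k i \<omega> - vec_cond_exp M (past k) (g k i) \<omega>"
    using cond_exp_g[OF i, of k] by eventually_elim simp
  show "square_integrable M (\<lambda>\<omega>. g k i \<omega> - grad (obj i) (x k \<omega>))"
    by (intro square_integrable_diff square_integrable_g_run square_integrable_grad_x i)
  show "(\<lambda>\<omega>. g k i \<omega> - vec_cond_exp M (past k) (g k i) \<omega>) \<in> borel_measurable M"
    by (intro borel_measurable_diff g_measurable[OF i] vec_cond_exp_measurable)
qed

lemma cond_exp_noise:
  assumes i: "i < n"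
  shows "AE \<omega> in M. real_cond_exp M (past k)
      (\<lambda>\<omega>. (norm (g k i \<omega> - vec_cond_exp M (past k) (g k i) \<omega>))\<^sup>2) \<omega> = grad_var i (x k \<omega>)"
  unfolding grad_var_def
  using i grad_obj_frozen_measurable[OF i] square_integrable_noise[OF i] cond_exp_g[OF i]
  by (rule cond_exp_frozen_sq)

lemma cond_exp_dev:
  assumes i: "i < n"
  shows "AE \<omega> in M. real_cond_exp M (past k)
      (\<lambda>\<omega>. (norm (g k i \<omega> - grad (F (\<xi> k i \<omega>)) xs))\<^sup>2) \<omega> = grad_dev i (x k \<omega>)"
  unfolding grad_dev_def
proof (rule cond_exp_frozen_sq[OF i, where m = "\<lambda>_ z. grad (F z) xs"])
  show "(\<lambda>q. grad (F (snd q)) xs) \<in> borel_measurable (past k \<Otimes>\<^sub>M \<D> i)"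
    using grad_measurable_sample[OF i, of xs] by measurable
  show "square_integrable M (\<lambda>\<omega>. g k i \<omega> - grad (F (\<xi> k i \<omega>)) xs)"
    by (intro square_integrable_diff square_integrable_g_run square_integrable_sample_grad i)
qed simp

lemma past_subalgebra: "finite_measure_subalgebra M (past k)"
  by unfold_locales (rule subalgebra_history)

definition "noise_at_min k i \<omega> = grad (F (\<xi> k i \<omega>)) xs - grad (obj i) xs"

lemma integral_xi:
  fixes h :: "'z \<Rightarrow> 'c::{banach, second_countable_topology}"
  assumes "i < n" "h \<in> borel_measurable (\<D> i)"
  shows "(\<integral>\<omega>. h (\<xi> k i \<omega>) \<partial>M) = (\<integral>z. h z \<partial>\<D> i)"
  using integral_distr[OF xi_measurable[OF assms(1), of k] assms(2)] unfolding xi_law[OF assms(1)] by simp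

lemma square_integrable_noise_at_min: "i < n \<Longrightarrow> square_integrable M (noise_at_min k i)"
  unfolding noise_at_min_def[abs_def]
  by (intro square_integrable_diff square_integrable_sample_grad square_integrable_const)

lemma square_integrable_avg_noise: "square_integrable M (\<lambda>\<omega>. avg n (\<lambda>i. noise_at_min k i \<omega>))"
  by (intro square_integrable_avg square_integrable_noise_at_min)

lemma square_integrable_avg_g: "square_integrable M (\<lambda>\<omega>. avg n (\<lambda>i. g k i \<omega>))"
  by (intro square_integrable_avg square_integrable_g_run)

text \<open>The noise vectors of different workers are independent and centred, hence orthogonal. Averaging
therefore divides the variance by \<open>n\<close>, which is the source of the factor \<open>1 / n\<^sup>2\<close> in \<open>D1p\<close>.\<close>

lemma second_moment_avg_noise:
  "(\<integral>\<omega>. (norm (avg n (\<lambda>i. noise_at_min k i \<omega>)))\<^sup>2 \<partial>M) = 1 / (real n)\<^sup>2 * (\<Sum>i<n. grad_var i xs)"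
proof -
  have "(\<integral>\<omega>. (norm (\<Sum>i<n. noise_at_min k i \<omega>))\<^sup>2 \<partial>M)
      = (\<Sum>i<n. \<integral>\<omega>. (norm (noise_at_min k i \<omega>))\<^sup>2 \<partial>M)"
  proof (rule norm_sum_sq_orthogonal)
    fix i j assume ij: "i \<in> {..<n}" "j \<in> {..<n}" "i \<noteq> j"
    note [measurable] = grad_measurable_sample[of i xs] grad_measurable_sample[of j xs]
    show "(\<integral>\<omega>. noise_at_min k i \<omega> \<bullet> noise_at_min k j \<omega> \<partial>M) = 0"
    proof (rule indep_var_inner_zero)
      show "indep_var borel (noise_at_min k i) borel (noise_at_min k j)"
        unfolding noise_at_min_def[abs_def]
        using ij indep_workers[of i j "\<lambda>z. grad (F z) xs - grad (obj i) xs" "\<lambda>z. grad (F z) xs - grad (obj j) xs" k]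
        by simp
      interpret D: prob_space "\<D> i" using ij prob_D by simp
      have "expectation (noise_at_min k i) = (\<integral>z. grad (F z) xs - grad (obj i) xs \<partial>\<D> i)"
        unfolding noise_at_min_def[abs_def] using ij by (intro integral_xi) auto
      also have "\<dots> = 0"
        using ij by (simp add: expectation_grad integrable_grad D.prob_space)
      finally show "expectation (noise_at_min k i) = 0" .
    qed (use ij square_integrable_noise_at_min in auto)
  qed (use square_integrable_noise_at_min in auto)
  also have "\<dots> = (\<Sum>i<n. grad_var i xs)"
  proof (rule sum.cong)
    fix i assume "i \<in> {..<n}"
    then show "(\<integral>\<omega>. (norm (noise_at_min k i \<omega>))\<^sup>2 \<partial>M) = grad_var i xs"
      unfolding noise_at_min_def grad_var_def
      using grad_measurable_sample[of i xs] by (intro integral_xi) auto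
  qed simp
  finally show ?thesis
    by (simp add: avg_def power_mult_distrib power_divide)
qed

text \<open>This noise is evaluated at the deterministic point \<open>xs\<close>, so it is a function of the fresh block alone
and conditioning on the past has no effect.\<close>

lemma cond_exp_avg_noise:
  "AE \<omega> in M. real_cond_exp M (past k) (\<lambda>\<omega>. (norm (avg n (\<lambda>i. noise_at_min k i \<omega>)))\<^sup>2) \<omega>
    = 1 / (real n)\<^sup>2 * (\<Sum>i<n. grad_var i xs)"
proof -
  let ?W = "\<lambda>\<omega>. (norm (avg n (\<lambda>i. noise_at_min k i \<omega>)))\<^sup>2"
  let ?N = "PiM ({k} \<times> {..<n}) (\<lambda>(k, i). \<D> i \<Otimes>\<^sub>M R)"
  let ?h = "\<lambda>h. (norm (avg n (\<lambda>i. grad (F (fst (h (k, i)))) xs - grad (obj i) xs)))\<^sup>2"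
  let ?Y = "\<lambda>\<omega>. \<lambda>p\<in>{k} \<times> {..<n}. case p of (k, i) \<Rightarrow> (\<xi> k i \<omega>, \<zeta> k i \<omega>)"
  have "(\<lambda>h. grad (F (fst (h (k, i)))) xs) \<in> borel_measurable ?N" if "i < n" for i
  proof -
    have "(\<lambda>h. h (k, i)) \<in> measurable ?N (\<D> i \<Otimes>\<^sub>M R)"
      using measurable_component_singleton[of "(k, i)" "{k} \<times> {..<n}" "\<lambda>(k, i). \<D> i \<Otimes>\<^sub>M R"] that by simp
    from measurable_compose[OF measurable_compose[OF this measurable_fst] grad_measurable_sample[OF that]]
    show ?thesis .
  qed
  then have "?h \<in> borel_measurable ?N"
    unfolding avg_def
    by (intro borel_measurable_power borel_measurable_norm borel_measurable_scaleR borel_measurable_sum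
        borel_measurable_diff borel_measurable_const) auto
  from fresh_sample_compose[OF fresh_block this]
  have "fresh_sample M (past k) borel (\<lambda>\<omega>. ?h (?Y \<omega>))" .
  moreover have "(\<lambda>\<omega>. ?h (?Y \<omega>)) = ?W"
  proof
    fix \<omega>
    have "avg n (\<lambda>i. grad (F (fst (?Y \<omega> (k, i)))) xs - grad (obj i) xs) = avg n (\<lambda>i. noise_at_min k i \<omega>)"
      by (rule avg_cong) (simp add: noise_at_min_def)
    then show "?h (?Y \<omega>) = ?W \<omega>" by (rule arg_cong)
  qed
  ultimately interpret fresh_sample M "past k" borel ?W by (simp only:)
  have "integrable M ?W"
    using square_integrable_avg_noise
    unfolding square_integrable_def by blast
  then have "AE \<omega> in M. real_cond_exp M (past k) ?W \<omega> = (\<integral>y. snd (\<omega>, y) \<partial>distr M borel ?W)"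
    by (intro freeze_cond_exp) auto
  moreover have "(\<integral>y. y \<partial>distr M borel ?W) = expectation ?W"
    by (rule integral_distr) (auto intro: measurable_sample)
  ultimately show ?thesis using second_moment_avg_noise[of k] by simp
qed

text \<open>Since the gradients of the local objectives at \<open>xs\<close> average to zero, the averaged stochastic gradient is
the average of the deviations from \<open>xs\<close> plus the average noise at \<open>xs\<close>. The first summand is bounded by
convexity of the square, the second by independence of the workers.\<close>

lemma cond_second_moment_avg_g:
  assumes stationary: "grad f xs = 0"
  shows "AE \<omega> in M. real_cond_exp M (past k) (\<lambda>\<omega>. (norm (avg n (\<lambda>i. g k i \<omega>)))\<^sup>2) \<omega>
    \<le> 2 * avg n (\<lambda>i. grad_dev i (x k \<omega>)) + 2 / (real n)\<^sup>2 * (\<Sum>i<n. grad_var i xs)"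
proof -
  let ?dev = "\<lambda>i \<omega>. (norm (g k i \<omega> - grad (F (\<xi> k i \<omega>)) xs))\<^sup>2"
  let ?W = "\<lambda>\<omega>. (norm (avg n (\<lambda>i. noise_at_min k i \<omega>)))\<^sup>2"
  have dev_int: "integrable M (?dev i)" if "i < n" for i
    using square_integrable_diff[OF square_integrable_g_run[OF that] square_integrable_sample_grad[OF that]]
    unfolding square_integrable_def by blast
  interpret past_cond: finite_measure_subalgebra M "past k" by (rule past_subalgebra)
  have dev_avg_int: "integrable M (\<lambda>\<omega>. avg n (\<lambda>i. ?dev i \<omega>))"
    by (intro integral_avg dev_int)
  have W_int: "integrable M ?W"
    using square_integrable_avg_noise
    unfolding square_integrable_def by blast
  have le: "(norm (avg n (\<lambda>i. g k i \<omega>)))\<^sup>2 \<le> 2 * avg n (\<lambda>i. ?dev i \<omega>) + 2 * ?W \<omega>" for \<omega>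
  proof -
    have "avg n (\<lambda>i. g k i \<omega>)
        = avg n (\<lambda>i. g k i \<omega> - grad (F (\<xi> k i \<omega>)) xs) + avg n (\<lambda>i. noise_at_min k i \<omega>)"
      using stationary by (simp add: grad_f noise_at_min_def avg_diff)
    then have "(norm (avg n (\<lambda>i. g k i \<omega>)))\<^sup>2
        \<le> 2 * (norm (avg n (\<lambda>i. g k i \<omega> - grad (F (\<xi> k i \<omega>)) xs)))\<^sup>2 + 2 * ?W \<omega>"
      using norm_add_sq_young[of 1] by simp
    also have "\<dots> \<le> 2 * avg n (\<lambda>i. ?dev i \<omega>) + 2 * ?W \<omega>"
      using norm_avg_sq_le[of n "\<lambda>i. g k i \<omega> - grad (F (\<xi> k i \<omega>)) xs"] by simp
    finally show ?thesis .
  qed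
  have "integrable M (\<lambda>\<omega>. (norm (avg n (\<lambda>i. g k i \<omega>)))\<^sup>2)"
    using square_integrable_avg_g
    unfolding square_integrable_def by blast
  then have "AE \<omega> in M. real_cond_exp M (past k) (\<lambda>\<omega>. (norm (avg n (\<lambda>i. g k i \<omega>)))\<^sup>2) \<omega>
      \<le> real_cond_exp M (past k) (\<lambda>\<omega>. 2 * avg n (\<lambda>i. ?dev i \<omega>) + 2 * ?W \<omega>) \<omega>"
    using dev_avg_int W_int by (intro past_cond.real_cond_exp_mono AE_I2 le) auto
  moreover have "AE \<omega> in M. real_cond_exp M (past k) (\<lambda>\<omega>. 2 * avg n (\<lambda>i. ?dev i \<omega>) + 2 * ?W \<omega>) \<omega>
      = real_cond_exp M (past k) (\<lambda>\<omega>. 2 * avg n (\<lambda>i. ?dev i \<omega>)) \<omega>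
        + real_cond_exp M (past k) (\<lambda>\<omega>. 2 * ?W \<omega>) \<omega>"
    using dev_avg_int W_int by (intro past_cond.real_cond_exp_add) auto
  moreover have "AE \<omega> in M. real_cond_exp M (past k) (\<lambda>\<omega>. avg n (\<lambda>i. ?dev i \<omega>)) \<omega>
      = avg n (\<lambda>i. real_cond_exp M (past k) (?dev i) \<omega>)"
    by (intro past_cond.real_cond_exp_avg dev_int)
  moreover note past_cond.real_cond_exp_cmult[OF dev_avg_int, where c = 2]
    past_cond.real_cond_exp_cmult[OF W_int, where c = 2]
    cond_exp_avg_noise[of k]
  moreover have "AE \<omega> in M. \<forall>i\<in>{..<n}. real_cond_exp M (past k) (?dev i) \<omega> = grad_dev i (x k \<omega>)"
    using cond_exp_dev by (intro AE_finite_allI) auto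
  ultimately show ?thesis
  proof eventually_elim
    case (elim \<omega>)
    have "avg n (\<lambda>i. real_cond_exp M (past k) (?dev i) \<omega>) = avg n (\<lambda>i. grad_dev i (x k \<omega>))"
      using elim(7) by (intro avg_cong) auto
    then show ?case using elim(1-6) by simp
  qed
qed

lemma cond_exp_avg_g:
  "AE \<omega> in M. vec_cond_exp M (past k) (\<lambda>\<omega>. avg n (\<lambda>i. g k i \<omega>)) \<omega> = grad f (x k \<omega>)"
proof -
  interpret past_cond: finite_measure_subalgebra M "past k" by (rule past_subalgebra)
  have int: "integrable M (\<lambda>\<omega>. g k i \<omega> \<bullet> b)" if "i < n" for i b
    using square_integrable_inner[OF square_integrable_g_run[OF that] square_integrable_const] .
  have "AE \<omega> in M. \<forall>b\<in>Basis. real_cond_exp M (past k) (\<lambda>\<omega>. avg n (\<lambda>i. g k i \<omega>) \<bullet> b) \<omega>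
      = avg n (\<lambda>i. real_cond_exp M (past k) (\<lambda>\<omega>. g k i \<omega> \<bullet> b) \<omega>)"
    using past_cond.real_cond_exp_avg[of n "\<lambda>i \<omega>. g k i \<omega> \<bullet> b" for b, OF int]
    by (intro AE_finite_allI) (auto simp: inner_avg inner_commute[of "avg n _"] inner_commute[of "g k _ _"])
  moreover have "AE \<omega> in M. \<forall>i\<in>{..<n}. vec_cond_exp M (past k) (g k i) \<omega> = grad (obj i) (x k \<omega>)"
    using cond_exp_g by (intro AE_finite_allI) auto
  ultimately show ?thesis
  proof eventually_elim
    case (elim \<omega>)
    have "vec_cond_exp M (past k) (\<lambda>\<omega>. avg n (\<lambda>i. g k i \<omega>)) \<omega>
        = (\<Sum>b\<in>Basis. avg n (\<lambda>i. real_cond_exp M (past k) (\<lambda>\<omega>. g k i \<omega> \<bullet> b) \<omega>) *\<^sub>R b)"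
      unfolding vec_cond_exp_def using elim(1) by (intro sum.cong) auto
    also have "\<dots> = avg n (\<lambda>i. vec_cond_exp M (past k) (g k i) \<omega>)"
      unfolding vec_cond_exp_def avg_def
      by (subst sum.swap) (simp add: scaleR_sum_left scaleR_sum_right sum_divide_distrib)
    also have "\<dots> = grad f (x k \<omega>)"
      unfolding grad_f using elim(2) by (intro avg_cong) auto
    finally show ?case .
  qed
qed

text \<open>A vector known before iteration \<open>k\<close> sees only the conditional mean of the stochastic gradient.\<close>

lemma expectation_inner_g:
  assumes i: "i < n" and a: "a \<in> borel_measurable (past k)" "square_integrable M a"
  shows "(\<integral>\<omega>. a \<omega> \<bullet> g k i \<omega> \<partial>M) = (\<integral>\<omega>. a \<omega> \<bullet> grad (obj i) (x k \<omega>) \<partial>M)"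
proof -
  interpret fresh_sample M "past k" "\<D> i" "\<xi> k i" by (rule fresh_xi[OF i])
  note [measurable] = grad_frozen_measurable[OF i, of k] a(1)
  have eq: "a \<omega> \<bullet> grad (F (\<xi> k i \<omega>)) (x k \<omega>) = a \<omega> \<bullet> g k i \<omega>" if "\<omega> \<in> space M" for \<omega>
    using that by (simp add: g_eq i)
  have "integrable M (\<lambda>\<omega>. a \<omega> \<bullet> g k i \<omega>)"
    by (rule square_integrable_inner[OF a(2) square_integrable_g_run[OF i]])
  then have "integrable M (\<lambda>\<omega>. a \<omega> \<bullet> grad (F (\<xi> k i \<omega>)) (x k \<omega>))"
    by (subst Bochner_Integration.integrable_cong[OF refl eq]) auto
  then have "(\<integral>\<omega>. a \<omega> \<bullet> grad (F (\<xi> k i \<omega>)) (x k \<omega>) \<partial>M)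
      = (\<integral>\<omega>. \<integral>z. a \<omega> \<bullet> grad (F z) (x k \<omega>) \<partial>\<D> i \<partial>M)"
    using freeze_integral(2)[of "\<lambda>q. a (fst q) \<bullet> grad (F (snd q)) (x k (fst q))"]
    by (simp add: xi_law[OF i])
  also have "\<dots> = (\<integral>\<omega>. a \<omega> \<bullet> grad (obj i) (x k \<omega>) \<partial>M)"
    by (simp add: integrable_grad[OF i] expectation_grad[OF i])
  finally show ?thesis
    using Bochner_Integration.integral_cong[OF refl eq, of M] by simp
qed

lemma expectation_noise:
  assumes i: "i < n"
  shows "integrable M (\<lambda>\<omega>. grad_var i (x k \<omega>))"
    and "(\<integral>\<omega>. (norm (g k i \<omega> - grad (obj i) (x k \<omega>)))\<^sup>2 \<partial>M) = (\<integral>\<omega>. grad_var i (x k \<omega>) \<partial>M)"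
proof -
  interpret fresh_sample M "past k" "\<D> i" "\<xi> k i" by (rule fresh_xi[OF i])
  note [measurable] = grad_frozen_measurable[OF i, of k] grad_obj_frozen_measurable[OF i, of k]
  let ?\<phi> = "\<lambda>q. (norm (grad (F (snd q)) (x k (fst q)) - grad (obj i) (x k (fst q))))\<^sup>2"
  have eq: "?\<phi> (\<omega>, \<xi> k i \<omega>) = (norm (g k i \<omega> - grad (obj i) (x k \<omega>)))\<^sup>2" if "\<omega> \<in> space M" for \<omega>
    using that by (simp add: g_eq i)
  have "integrable M (\<lambda>\<omega>. (norm (g k i \<omega> - grad (obj i) (x k \<omega>)))\<^sup>2)"
    using square_integrable_diff[OF square_integrable_g_run[OF i] square_integrable_grad_x[OF i]]
    unfolding square_integrable_def by blast
  then have int: "integrable M (\<lambda>\<omega>. ?\<phi> (\<omega>, \<xi> k i \<omega>))"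
    by (subst Bochner_Integration.integrable_cong[OF refl eq]) auto
  show "integrable M (\<lambda>\<omega>. grad_var i (x k \<omega>))"
    using freeze_integral(1)[OF _ int] by (simp add: xi_law[OF i] grad_var_def)
  show "(\<integral>\<omega>. (norm (g k i \<omega> - grad (obj i) (x k \<omega>)))\<^sup>2 \<partial>M) = (\<integral>\<omega>. grad_var i (x k \<omega>) \<partial>M)"
    using freeze_integral(2)[OF _ int] Bochner_Integration.integral_cong[OF refl eq, of M]
    by (simp add: xi_law[OF i] grad_var_def)
qed

text \<open>The conditional mean of the gradient is added to the error before Young's inequality is applied, and the
noise around it is orthogonal to both. Hence only the mean pays the factor \<open>2 / \<delta>\<close>, and the variance enters
with factor 1.\<close>

lemma worker_error_step:
  assumes i: "i < n"
  shows "(\<integral>\<omega>. (norm (e (Suc k) i \<omega>))\<^sup>2 \<partial>M) \<le> (1 - \<delta> / 2) * (\<integral>\<omega>. (norm (e k i \<omega>))\<^sup>2 \<partial>M)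
    + \<gamma>\<^sup>2 * (2 / \<delta> * (\<integral>\<omega>. (norm (grad (obj i) (x k \<omega>)))\<^sup>2 \<partial>M) + (\<integral>\<omega>. grad_var i (x k \<omega>) \<partial>M))"
proof -
  let ?d = "\<lambda>\<omega>. grad (obj i) (x k \<omega>)"
  let ?b = "\<lambda>\<omega>. e k i \<omega> + \<gamma> *\<^sub>R ?d \<omega>"
  note sq_e = square_integrable_e[OF i, of k] and sq_g = square_integrable_g_run[OF i, of k]
    and sq_d = square_integrable_grad_x[OF i, of k]
  have sq_b: "square_integrable M ?b"
    by (intro square_integrable_add square_integrable_scaleR sq_e sq_d)
  have b_past: "?b \<in> borel_measurable (past k)"
    by (intro borel_measurable_add borel_measurable_scaleR borel_measurable_const e_past[OF i]
        measurable_compose[OF x_past grad_obj_measurable[OF i]])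
  have sq_n: "square_integrable M (\<lambda>\<omega>. g k i \<omega> - ?d \<omega>)"
    by (intro square_integrable_diff sq_g sq_d)
  have int_b: "integrable M (\<lambda>\<omega>. (norm (?b \<omega>))\<^sup>2)" and int_n: "integrable M (\<lambda>\<omega>. (norm (g k i \<omega> - ?d \<omega>))\<^sup>2)"
    and int_e: "integrable M (\<lambda>\<omega>. (norm (e k i \<omega>))\<^sup>2)" and int_d: "integrable M (\<lambda>\<omega>. (norm (?d \<omega>))\<^sup>2)"
    using sq_b sq_n sq_e sq_d unfolding square_integrable_def by blast+
  have cross: "(\<integral>\<omega>. ?b \<omega> \<bullet> (g k i \<omega> - ?d \<omega>) \<partial>M) = 0"
    using expectation_inner_g[OF i b_past sq_b] square_integrable_inner[OF sq_b sq_g]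
      square_integrable_inner[OF sq_b sq_d]
    by (simp add: inner_diff_right)
  have "(norm (e k i \<omega> + \<gamma> *\<^sub>R g k i \<omega>))\<^sup>2
      = (norm (?b \<omega>))\<^sup>2 + 2 * \<gamma> * (?b \<omega> \<bullet> (g k i \<omega> - ?d \<omega>)) + \<gamma>\<^sup>2 * (norm (g k i \<omega> - ?d \<omega>))\<^sup>2" for \<omega>
  proof -
    have "e k i \<omega> + \<gamma> *\<^sub>R g k i \<omega> = ?b \<omega> + \<gamma> *\<^sub>R (g k i \<omega> - ?d \<omega>)"
      by (simp add: algebra_simps)
    also have "(norm \<dots>)\<^sup>2 = (norm (?b \<omega>))\<^sup>2 + 2 * \<gamma> * (?b \<omega> \<bullet> (g k i \<omega> - ?d \<omega>)) + \<gamma>\<^sup>2 * (norm (g k i \<omega> - ?d \<omega>))\<^sup>2"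
      unfolding power2_norm_eq_inner inner_add_left[of "?b \<omega>"] inner_add_right[of _ "?b \<omega>"]
      by (simp add: inner_commute[of "g k i \<omega> - ?d \<omega>" "?b \<omega>"] power2_eq_square)
    finally show ?thesis .
  qed
  then have "(\<integral>\<omega>. (norm (e k i \<omega> + \<gamma> *\<^sub>R g k i \<omega>))\<^sup>2 \<partial>M)
      = (\<integral>\<omega>. (norm (?b \<omega>))\<^sup>2 \<partial>M) + \<gamma>\<^sup>2 * (\<integral>\<omega>. grad_var i (x k \<omega>) \<partial>M)"
    using int_b int_n square_integrable_inner[OF sq_b sq_n] cross expectation_noise(2)[OF i, of k] by simp
  then have "(\<integral>\<omega>. (norm (e (Suc k) i \<omega>))\<^sup>2 \<partial>M)
      \<le> (1 - \<delta>) * (\<integral>\<omega>. (norm (?b \<omega>))\<^sup>2 \<partial>M) + (1 - \<delta>) * (\<gamma>\<^sup>2 * (\<integral>\<omega>. grad_var i (x k \<omega>) \<partial>M))"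
    using compression_step(2)[OF i square_integrable_add[OF sq_e square_integrable_scaleR[OF sq_g]]]
    by (simp add: distrib_left)
  also have "(1 - \<delta>) * (\<gamma>\<^sup>2 * (\<integral>\<omega>. grad_var i (x k \<omega>) \<partial>M)) \<le> 1 * (\<gamma>\<^sup>2 * (\<integral>\<omega>. grad_var i (x k \<omega>) \<partial>M))"
    using \<delta> by (intro mult_right_mono mult_nonneg_nonneg integral_nonneg_AE) (auto simp: grad_var_nonneg)
  also have "(1 - \<delta>) * (\<integral>\<omega>. (norm (?b \<omega>))\<^sup>2 \<partial>M) = (\<integral>\<omega>. (1 - \<delta>) * (norm (?b \<omega>))\<^sup>2 \<partial>M)"
    by simp
  also have "\<dots> \<le> (\<integral>\<omega>. (1 - \<delta> / 2) * (norm (e k i \<omega>))\<^sup>2 + 2 / \<delta> * (\<gamma>\<^sup>2 * (norm (?d \<omega>))\<^sup>2) \<partial>M)"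
  proof (rule integral_mono)
    fix \<omega>
    show "(1 - \<delta>) * (norm (?b \<omega>))\<^sup>2 \<le> (1 - \<delta> / 2) * (norm (e k i \<omega>))\<^sup>2 + 2 / \<delta> * (\<gamma>\<^sup>2 * (norm (?d \<omega>))\<^sup>2)"
      using compression_young[OF \<delta>, of "e k i \<omega>" "\<gamma> *\<^sub>R ?d \<omega>"] by (simp add: power_mult_distrib)
  qed (use int_b int_e int_d in auto)
  also have "\<dots> = (1 - \<delta> / 2) * (\<integral>\<omega>. (norm (e k i \<omega>))\<^sup>2 \<partial>M)
      + 2 / \<delta> * (\<gamma>\<^sup>2 * (\<integral>\<omega>. (norm (?d \<omega>))\<^sup>2 \<partial>M))"
    using int_e int_d by simp
  finally show ?thesis by (simp add: algebra_simps)
qed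

section \<open>Consequences of convexity and smoothness\<close>

lemma grad_at_minimum:
  assumes "\<And>y. f xs \<le> f y"
  shows "grad f xs = 0"
  using grad_norm_le_gap[OF f_gderiv grad_f_lipschitz L_pos assms, of xs] by simp

text \<open>The gradient is bounded above by \<open>grad_norm_le_gap\<close> and below through the quasi strong convexity
inequality. Comparing the two bounds by \<open>(p + q)\<^sup>2 \<ge> 4 p q\<close> with \<open>q = \<mu> d\<^sup>2 / 2\<close> gives \<open>\<mu> \<le> L\<close>, once there
is a point whose gap \<open>p\<close> is positive.\<close>

lemma growth_le_smoothness:
  assumes minimum: "\<And>y. f xs \<le> f y"
    and quasi: "f y + grad f y \<bullet> (xs - y) + \<mu> / 2 * (norm (y - xs))\<^sup>2 \<le> f xs"
    and strict: "f xs < f y" and \<mu>: "0 \<le> \<mu>"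
  shows "\<mu> \<le> L"
proof -
  define d where "d = norm (y - xs)"
  define p where "p = f y - f xs"
  have p: "0 < p" using strict by (simp add: p_def)
  have "y \<noteq> xs" using strict by auto
  then have d: "0 < d\<^sup>2" by (simp add: d_def)
  have "p + \<mu> / 2 * d\<^sup>2 \<le> (y - xs) \<bullet> grad f y"
    using quasi by (simp add: p_def d_def inner_diff_left inner_diff_right inner_commute)
  also have "\<dots> \<le> d * norm (grad f y)"
    unfolding d_def by (rule norm_cauchy_schwarz)
  finally have "(p + \<mu> / 2 * d\<^sup>2)\<^sup>2 \<le> (d * norm (grad f y))\<^sup>2"
    using p \<mu> by (intro power_mono) auto
  also have "\<dots> \<le> d\<^sup>2 * (2 * L * p)"
    unfolding power_mult_distrib p_def
    by (intro mult_left_mono grad_norm_le_gap[OF f_gderiv grad_f_lipschitz L_pos minimum]) simp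
  finally have "2 * \<mu> * (p * d\<^sup>2) + (p - \<mu> / 2 * d\<^sup>2)\<^sup>2 \<le> 2 * L * (p * d\<^sup>2)"
    by (simp add: power2_eq_square algebra_simps)
  then have "2 * \<mu> * (p * d\<^sup>2) \<le> 2 * L * (p * d\<^sup>2)"
    using zero_le_power2[of "p - \<mu> / 2 * d\<^sup>2"] by linarith
  then show ?thesis using p d by simp
qed

lemma above_tangent_convex:
  assumes conv: "\<And>i z. i < n \<Longrightarrow> z \<in> space (\<D> i) \<Longrightarrow> convex_on UNIV (F z) \<and> L_smooth L (F z)"
  shows "f y + grad f y \<bullet> (y' - y) \<le> f y'"
proof -
  have "0 \<le> avg n (\<lambda>i. \<integral>z. F z y' - F z y - grad (F z) y \<bullet> (y' - y) \<partial>\<D> i)"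
    unfolding avg_def real_scaleR_def
  proof (intro mult_nonneg_nonneg sum_nonneg integral_nonneg_AE AE_I2)
    fix i z assume "i \<in> {..<n}" "z \<in> space (\<D> i)"
    then have cv: "convex_on UNIV (F z)" and sm: "L_smooth L (F z)" using conv by auto
    show "0 \<le> F z y' - F z y - grad (F z) y \<bullet> (y' - y)"
      using convex_above_tangent[OF L_smoothD(1)[OF sm] cv, of y y'] by simp
  qed simp
  then show ?thesis unfolding avg_bregman by simp
qed

text \<open>Each sample is cocoercive relative to \<open>xs\<close>, and in the average the linear terms disappear because the
gradient of \<open>f\<close> vanishes at \<open>xs\<close>.\<close>

lemma grad_dev_le_convex:
  assumes conv: "\<And>i z. i < n \<Longrightarrow> z \<in> space (\<D> i) \<Longrightarrow> convex_on UNIV (F z) \<and> L_smooth L (F z)"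
    and minimum: "\<And>y. f xs \<le> f y"
  shows "avg n (\<lambda>i. grad_dev i y) \<le> 2 * L * (f y - f xs)"
proof -
  have "avg n (\<lambda>i. grad_dev i y)
      \<le> avg n (\<lambda>i. 2 * L * (\<integral>z. F z y - F z xs - grad (F z) xs \<bullet> (y - xs) \<partial>\<D> i))"
  proof (rule avg_mono)
    fix i assume i: "i < n"
    have int: "integrable (\<D> i) (\<lambda>z. F z y - F z xs - grad (F z) xs \<bullet> (y - xs))"
      using integrable_F[OF i] integrable_grad[OF i] by auto
    have "grad_dev i y \<le> (\<integral>z. 2 * L * (F z y - F z xs - grad (F z) xs \<bullet> (y - xs)) \<partial>\<D> i)"
      unfolding grad_dev_def
    proof (rule integral_mono)
      fix z assume "z \<in> space (\<D> i)"
      then have cv: "convex_on UNIV (F z)" and sm: "L_smooth L (F z)" using conv i by auto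
      show "(norm (grad (F z) y - grad (F z) xs))\<^sup>2 \<le> 2 * L * (F z y - F z xs - grad (F z) xs \<bullet> (y - xs))"
        by (rule smooth_convex_bregman[OF L_smoothD(1)[OF sm] L_smoothD(2)[OF sm] L_pos cv])
    qed (use int square_integrable_grad_diff[OF i] in \<open>auto simp: square_integrable_def\<close>)
    then show "grad_dev i y \<le> 2 * L * (\<integral>z. F z y - F z xs - grad (F z) xs \<bullet> (y - xs) \<partial>\<D> i)"
      by simp
  qed
  also have "\<dots> = 2 * L * (f y - f xs)"
    unfolding avg_mult avg_bregman by (simp add: grad_at_minimum[OF minimum])
  finally show ?thesis .
qed

lemma grad_dev_le_lipschitz: "avg n (\<lambda>i. grad_dev i y) \<le> L\<^sup>2 * (norm (y - xs))\<^sup>2"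
proof -
  have "avg n (\<lambda>i. grad_dev i y) \<le> avg n (\<lambda>i. L\<^sup>2 * (norm (y - xs))\<^sup>2)"
  proof (rule avg_mono)
    fix i assume i: "i < n"
    interpret D: prob_space "\<D> i" by (rule prob_D[OF i])
    have "grad_dev i y \<le> (\<integral>z. L\<^sup>2 * (norm (y - xs))\<^sup>2 \<partial>\<D> i)"
      unfolding grad_dev_def
      using square_integrable_grad_diff[OF i] grad_diff_sq_bound[OF i]
      by (intro integral_mono_AE) (auto simp: square_integrable_def)
    then show "grad_dev i y \<le> L\<^sup>2 * (norm (y - xs))\<^sup>2" by (simp add: D.prob_space)
  qed
  also have "\<dots> = L\<^sup>2 * (norm (y - xs))\<^sup>2" using n_pos by (simp add: avg_def)
  finally show ?thesis .
qed

end

section \<open>Error recursion\<close>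

text \<open>The common hypotheses of both parts. The three step size conditions serve, in this order, to absorb the
gap in \<open>E \<bar>g\<^sup>k\<bar>\<^sup>2\<close>, to keep the growth of the weights below the contraction of the errors, and to absorb
the gaps produced by the error recursion.\<close>

locale ec_sgd_convergence = ec_sgd_run M \<D> R F C \<xi> \<zeta> x e g v f x0 xs n L \<gamma> \<delta>
  for M :: "'w measure" and \<D> :: "nat \<Rightarrow> 'z measure" and R :: "'r measure"
    and F :: "'z \<Rightarrow> 'a::euclidean_space \<Rightarrow> real" and C :: "'r \<Rightarrow> 'a \<Rightarrow> 'a"
    and \<xi> :: "nat \<Rightarrow> nat \<Rightarrow> 'w \<Rightarrow> 'z" and \<zeta> :: "nat \<Rightarrow> nat \<Rightarrow> 'w \<Rightarrow> 'r"
    and x :: "nat \<Rightarrow> 'w \<Rightarrow> 'a" and e g v :: "nat \<Rightarrow> nat \<Rightarrow> 'w \<Rightarrow> 'a"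
    and f :: "'a \<Rightarrow> real" and x0 xs :: 'a and n :: nat and L \<gamma> \<delta> :: real +
  fixes \<mu> Lc :: real
  assumes minimum: "f xs \<le> f y"
    and above_tangent: "f y + grad f y \<bullet> (y' - y) \<le> f y'"
    and quasi: "f y + grad f y \<bullet> (xs - y) + \<mu> / 2 * (norm (y - xs))\<^sup>2 \<le> f xs"
    and grad_dev_le: "avg n (\<lambda>i. grad_dev i y) \<le> 2 * Lc * (f y - f xs)"
    and \<mu>: "0 \<le> \<mu>" "\<mu> \<le> L" and \<gamma>: "0 < \<gamma>"
    and step_gradient: "8 * Lc * \<gamma> \<le> 1"
    and step_rate: "4 * \<gamma> * \<mu> \<le> \<delta>"
    and step_error: "192 * L * Lc * (2 + 3 * \<delta>) * \<gamma>\<^sup>2 \<le> \<delta>\<^sup>2"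
begin

definition "D1 = 2 / real n * (\<Sum>i<n. (norm (grad (obj i) xs))\<^sup>2)"
definition "D1t = 2 / real n * (\<Sum>i<n. grad_var i xs)"
definition "D1p = 2 / (real n)\<^sup>2 * (\<Sum>i<n. grad_var i xs)"
definition "D3 = 6 * L * \<gamma> / \<delta> * (2 * D1 / \<delta> + D1t)"

definition "gap y = f y - f xs"
definition "mean_gap k = (\<integral>\<omega>. gap (x k \<omega>) \<partial>M)"

lemma gap_nonneg: "0 \<le> gap y"
  using minimum by (simp add: gap_def)

lemma Lc_gap_nonneg: "0 \<le> Lc * gap y"
proof -
  have "0 \<le> avg n (\<lambda>i. grad_dev i y)"
    by (simp add: avg_def sum_nonneg grad_dev_nonneg)
  then show ?thesis using grad_dev_le[of y] by (simp add: gap_def)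
qed

lemma grad_sq_le_gap: "(norm (grad f y))\<^sup>2 \<le> 2 * L * gap y"
  unfolding gap_def
  by (rule grad_norm_le_gap[OF f_gderiv grad_f_lipschitz L_pos minimum])

lemma grad_f_xs: "grad f xs = 0"
  by (rule grad_at_minimum[OF minimum])

lemma gap_le: "gap y \<le> L / 2 * (norm (y - xs))\<^sup>2"
  using smooth_upper_bound[OF f_gderiv grad_f_lipschitz, of y xs]
  by (simp add: gap_def grad_f_xs)

lemma integrable_gap: "integrable M (\<lambda>\<omega>. gap (x k \<omega>))"
proof (rule Bochner_Integration.integrable_bound)
  show "integrable M (\<lambda>\<omega>. L / 2 * (norm (x k \<omega> - xs))\<^sup>2)"
    using square_integrable_diff[OF square_integrable_x square_integrable_const]
    unfolding square_integrable_def by simp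
  show "(\<lambda>\<omega>. gap (x k \<omega>)) \<in> borel_measurable M" unfolding gap_def by measurable
  show "AE \<omega> in M. norm (gap (x k \<omega>)) \<le> norm (L / 2 * (norm (x k \<omega> - xs))\<^sup>2)"
  proof (rule AE_I2)
    fix \<omega>
    show "norm (gap (x k \<omega>)) \<le> norm (L / 2 * (norm (x k \<omega> - xs))\<^sup>2)"
      using gap_le[of "x k \<omega>"] gap_nonneg[of "x k \<omega>"] by simp
  qed
qed

lemma mean_gap_nonneg: "0 \<le> mean_gap k"
  unfolding mean_gap_def by (simp add: gap_nonneg)

lemma Lc_mean_gap_nonneg: "0 \<le> Lc * mean_gap k"
proof -
  have "0 \<le> (\<integral>\<omega>. Lc * gap (x k \<omega>) \<partial>M)" by (intro integral_nonneg_AE AE_I2 Lc_gap_nonneg)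
  then show ?thesis by (simp add: mean_gap_def)
qed

lemma avg_grad_sq_le:
  assumes c: "0 < c"
  shows "avg n (\<lambda>i. (norm (grad (obj i) y))\<^sup>2) \<le> (1 + c) / 2 * D1 + (1 + 1 / c) * (2 * Lc * gap y)"
proof -
  have "avg n (\<lambda>i. (norm (grad (obj i) y))\<^sup>2)
      \<le> avg n (\<lambda>i. (1 + c) * (norm (grad (obj i) xs))\<^sup>2 + (1 + 1 / c) * grad_dev i y)"
    by (intro avg_mono grad_obj_sq_le c)
  also have "\<dots> = (1 + c) / 2 * D1 + (1 + 1 / c) * avg n (\<lambda>i. grad_dev i y)"
    unfolding avg_add avg_mult by (simp add: D1_def avg_def)
  also have "\<dots> \<le> (1 + c) / 2 * D1 + (1 + 1 / c) * (2 * Lc * gap y)"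
    using c grad_dev_le[of y] by (intro add_left_mono mult_left_mono) (auto simp: gap_def)
  finally show ?thesis .
qed

lemma avg_grad_var_le:
  assumes c: "0 < c"
  shows "avg n (\<lambda>i. grad_var i y) \<le> (1 + c) / 2 * D1t + (1 + 1 / c) * (2 * Lc * gap y)"
proof -
  have "avg n (\<lambda>i. grad_var i y)
      \<le> avg n (\<lambda>i. (1 + c) * grad_var i xs + (1 + 1 / c) * grad_dev i y)"
    by (intro avg_mono grad_var_le c)
  also have "\<dots> = (1 + c) / 2 * D1t + (1 + 1 / c) * avg n (\<lambda>i. grad_dev i y)"
    unfolding avg_add avg_mult by (simp add: D1t_def avg_def)
  also have "\<dots> \<le> (1 + c) / 2 * D1t + (1 + 1 / c) * (2 * Lc * gap y)"
    using c grad_dev_le[of y] by (intro add_left_mono mult_left_mono) (auto simp: gap_def)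
  finally show ?thesis .
qed

lemma constants_nonneg: "0 \<le> D1" "0 \<le> D1t"
  by (simp_all add: D1_def D1t_def sum_nonneg grad_var_nonneg)

lemma cond_second_moment_le:
  "AE \<omega> in M. real_cond_exp M (past k) (\<lambda>\<omega>. (norm (avg n (\<lambda>i. g k i \<omega>)))\<^sup>2) \<omega>
    \<le> 4 * Lc * gap (x k \<omega>) + D1p"
  using cond_second_moment_avg_g[OF grad_f_xs, of k]
proof eventually_elim
  case (elim \<omega>)
  then show ?case using grad_dev_le[of "x k \<omega>"] by (simp add: D1p_def gap_def)
qed

lemma second_moment_le:
  "(\<integral>\<omega>. (norm (avg n (\<lambda>i. g k i \<omega>)))\<^sup>2 \<partial>M) \<le> 4 * Lc * mean_gap k + D1p"
proof -
  interpret past_cond: finite_measure_subalgebra M "past k" by (rule past_subalgebra)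
  let ?G = "\<lambda>\<omega>. (norm (avg n (\<lambda>i. g k i \<omega>)))\<^sup>2"
  have int: "integrable M ?G"
    using square_integrable_avg_g unfolding square_integrable_def by blast
  have "(\<integral>\<omega>. ?G \<omega> \<partial>M) = (\<integral>\<omega>. real_cond_exp M (past k) ?G \<omega> \<partial>M)"
    by (rule past_cond.real_cond_exp_int(2)[OF int, symmetric])
  also have "\<dots> \<le> (\<integral>\<omega>. 4 * Lc * gap (x k \<omega>) + D1p \<partial>M)"
    using past_cond.real_cond_exp_int(1)[OF int] integrable_gap cond_second_moment_le
    by (intro integral_mono_AE) auto
  also have "\<dots> = 4 * Lc * mean_gap k + D1p"
    using integrable_gap by (simp add: mean_gap_def prob_space)
  finally show ?thesis .
qed

text \<open>The rate and the weights of the parametric assumption. The step size is so small that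
\<open>\<gamma> \<mu> / 2\<close> is the smallest of the three candidates for the rate; see \<open>rate_params\<close>.\<close>

definition "\<eta> = \<gamma> * \<mu> / 2"
definition "w k = 1 / (1 - \<eta>) ^ (k + 1)"
definition "W K = (\<Sum>k\<le>K. w k)"

lemma \<eta>: "0 \<le> \<eta>" "\<eta> \<le> \<delta> / 8" "\<eta> < 1"
  using \<gamma> \<mu> step_rate \<delta> by (auto simp: \<eta>_def)

lemma w_pos: "0 < w k" and w_Suc: "(1 - \<eta>) * w (Suc k) = w k" and w_0: "(1 - \<eta>) * w 0 = 1"
  using \<eta>(3) by (auto simp: w_def)

lemma W_pos: "0 < W K"
  unfolding W_def by (intro sum_pos w_pos) auto

definition "mean_error k = avg n (\<lambda>i. \<integral>\<omega>. (norm (e k i \<omega>))\<^sup>2 \<partial>M)"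

text \<open>The moments are estimated with \<open>c = 1/2\<close>, which leaves three quarters of \<open>D1\<close> and \<open>D1t\<close>.\<close>

lemma mean_error_step:
  "mean_error (Suc k) \<le> (1 - \<delta> / 2) * mean_error k + \<gamma>\<^sup>2 *
    (2 / \<delta> * (3 / 4 * D1 + 6 * Lc * mean_gap k) + (3 / 4 * D1t + 6 * Lc * mean_gap k))"
proof -
  let ?d = "\<lambda>i. \<integral>\<omega>. (norm (grad (obj i) (x k \<omega>)))\<^sup>2 \<partial>M"
  let ?s = "\<lambda>i. \<integral>\<omega>. grad_var i (x k \<omega>) \<partial>M"
  have int_d: "integrable M (\<lambda>\<omega>. (norm (grad (obj i) (x k \<omega>)))\<^sup>2)" if "i < n" for i
    using square_integrable_grad_x[OF that] unfolding square_integrable_def by blast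
  have int_s: "integrable M (\<lambda>\<omega>. grad_var i (x k \<omega>))" if "i < n" for i
    by (rule expectation_noise(1)[OF that])
  have "mean_error (Suc k) \<le> avg n (\<lambda>i. (1 - \<delta> / 2) * (\<integral>\<omega>. (norm (e k i \<omega>))\<^sup>2 \<partial>M)
      + \<gamma>\<^sup>2 * (2 / \<delta> * ?d i + ?s i))"
    unfolding mean_error_def by (intro avg_mono worker_error_step)
  also have "\<dots> = (1 - \<delta> / 2) * mean_error k + \<gamma>\<^sup>2 * (2 / \<delta> * avg n ?d + avg n ?s)"
    unfolding avg_add avg_mult mean_error_def ..
  finally have step: "mean_error (Suc k) \<le> (1 - \<delta> / 2) * mean_error k
      + \<gamma>\<^sup>2 * (2 / \<delta> * avg n ?d + avg n ?s)" .
  have "avg n ?d = (\<integral>\<omega>. avg n (\<lambda>i. (norm (grad (obj i) (x k \<omega>)))\<^sup>2) \<partial>M)"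
    by (intro integral_avg(2)[symmetric] int_d)
  also have "\<dots> \<le> (\<integral>\<omega>. 3 / 4 * D1 + 6 * Lc * gap (x k \<omega>) \<partial>M)"
  proof (intro integral_mono integral_avg(1) int_d)
    show "avg n (\<lambda>i. (norm (grad (obj i) (x k \<omega>)))\<^sup>2) \<le> 3 / 4 * D1 + 6 * Lc * gap (x k \<omega>)" for \<omega>
      using avg_grad_sq_le[of "1 / 2" "x k \<omega>"] by simp
  qed (use integrable_gap in auto)
  also have "\<dots> = 3 / 4 * D1 + 6 * Lc * mean_gap k"
    using integrable_gap by (simp add: mean_gap_def prob_space)
  finally have d: "avg n ?d \<le> 3 / 4 * D1 + 6 * Lc * mean_gap k" .
  have "avg n ?s = (\<integral>\<omega>. avg n (\<lambda>i. grad_var i (x k \<omega>)) \<partial>M)"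
    by (intro integral_avg(2)[symmetric] int_s)
  also have "\<dots> \<le> (\<integral>\<omega>. 3 / 4 * D1t + 6 * Lc * gap (x k \<omega>) \<partial>M)"
  proof (intro integral_mono integral_avg(1) int_s)
    show "avg n (\<lambda>i. grad_var i (x k \<omega>)) \<le> 3 / 4 * D1t + 6 * Lc * gap (x k \<omega>)" for \<omega>
      using avg_grad_var_le[of "1 / 2" "x k \<omega>"] by simp
  qed (use integrable_gap in auto)
  also have "\<dots> = 3 / 4 * D1t + 6 * Lc * mean_gap k"
    using integrable_gap by (simp add: mean_gap_def prob_space)
  finally have s: "avg n ?s \<le> 3 / 4 * D1t + 6 * Lc * mean_gap k" .
  have "\<gamma>\<^sup>2 * (2 / \<delta> * avg n ?d + avg n ?s)
      \<le> \<gamma>\<^sup>2 * (2 / \<delta> * (3 / 4 * D1 + 6 * Lc * mean_gap k) + (3 / 4 * D1t + 6 * Lc * mean_gap k))"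
    using d s \<delta> by (intro mult_left_mono add_mono) auto
  then show ?thesis using step by linarith
qed

lemma square_integrable_avg_e: "square_integrable M (\<lambda>\<omega>. avg n (\<lambda>i. e k i \<omega>))"
  by (intro square_integrable_avg square_integrable_e)

lemma mean_sq_avg_error_le: "(\<integral>\<omega>. (norm (avg n (\<lambda>i. e k i \<omega>)))\<^sup>2 \<partial>M) \<le> mean_error k"
proof -
  have int: "integrable M (\<lambda>\<omega>. (norm (e k i \<omega>))\<^sup>2)" if "i < n" for i
    using square_integrable_e[OF that] unfolding square_integrable_def by blast
  have "(\<integral>\<omega>. (norm (avg n (\<lambda>i. e k i \<omega>)))\<^sup>2 \<partial>M) \<le> (\<integral>\<omega>. avg n (\<lambda>i. (norm (e k i \<omega>))\<^sup>2) \<partial>M)"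
  proof (intro integral_mono integral_avg(1) int norm_avg_sq_le)
    show "integrable M (\<lambda>\<omega>. (norm (avg n (\<lambda>i. e k i \<omega>)))\<^sup>2)"
      using square_integrable_avg_e unfolding square_integrable_def by blast
  qed
  also have "\<dots> = mean_error k"
    unfolding mean_error_def by (intro integral_avg(2) int)
  finally show ?thesis .
qed

text \<open>Since \<open>\<eta> \<le> \<delta> / 8\<close>, the recursion for the errors contracts by at least \<open>3 \<delta> / 8\<close> relative to the weights,
and summation multiplies its driving term by at most \<open>8 / (3 \<delta>)\<close>. The factor \<open>3/4\<close> in front of the
constants turns this into \<open>2 / \<delta>\<close>, which is what \<open>D3\<close> provides.\<close>

lemma weighted_error_le:
  "3 * L * (\<Sum>k\<le>K. w k * (\<integral>\<omega>. (norm (avg n (\<lambda>i. e k i \<omega>)))\<^sup>2 \<partial>M))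
    \<le> 1 / 4 * (\<Sum>k\<le>K. w k * mean_gap k) + \<gamma> * D3 * W K"
proof -
  define N where "N k = \<gamma>\<^sup>2 *
    (2 / \<delta> * (3 / 4 * D1 + 6 * Lc * mean_gap k) + (3 / 4 * D1t + 6 * Lc * mean_gap k))" for k
  have N_nonneg: "0 \<le> N k" for k
  proof -
    have "0 \<le> 6 * Lc * mean_gap k" using Lc_mean_gap_nonneg[of k] by (simp add: mult.assoc)
    then have p: "0 \<le> 3 / 4 * D1 + 6 * Lc * mean_gap k" "0 \<le> 3 / 4 * D1t + 6 * Lc * mean_gap k"
      using constants_nonneg by auto
    have "0 \<le> 2 / \<delta> * (3 / 4 * D1 + 6 * Lc * mean_gap k)"
      using \<delta> by (intro mult_nonneg_nonneg[OF _ p(1)]) auto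
    then show ?thesis
      unfolding N_def by (rule mult_nonneg_nonneg[OF zero_le_power2 add_nonneg_nonneg[OF _ p(2)]])
  qed
  let ?S = "\<Sum>k\<le>K. w k * mean_error k"
  have S_nonneg: "0 \<le> ?S"
    by (intro sum_nonneg mult_nonneg_nonneg less_imp_le[OF w_pos])
      (simp add: mean_error_def avg_def sum_nonneg)
  have "(1 - \<eta> - (1 - \<delta> / 2)) * ?S \<le> (\<Sum>k\<le>K. w k * N k)"
  proof (rule weighted_sum_of_contraction)
    show "mean_error (Suc k) \<le> (1 - \<delta> / 2) * mean_error k + N k" for k
      unfolding N_def by (rule mean_error_step)
    have "(\<integral>\<omega>. (norm (e 0 i \<omega>))\<^sup>2 \<partial>M) = (\<integral>\<omega>. 0 \<partial>M)" if "i < n" for i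
      using that by (intro Bochner_Integration.integral_cong) (auto simp: e_0)
    then show "mean_error 0 = 0" by (simp add: mean_error_def avg_def)
    show "0 \<le> mean_error k" for k by (simp add: mean_error_def avg_def sum_nonneg)
  qed (use w_pos w_Suc \<eta> \<delta> N_nonneg in \<open>auto intro: less_imp_le\<close>)
  moreover have "3 * \<delta> / 8 * ?S \<le> (1 - \<eta> - (1 - \<delta> / 2)) * ?S"
    using \<eta>(2) S_nonneg by (intro mult_right_mono) auto
  ultimately have S: "?S \<le> 8 / (3 * \<delta>) * (\<Sum>k\<le>K. w k * N k)"
    using \<delta> by (simp add: field_simps)
  have "3 * L * (\<Sum>k\<le>K. w k * (\<integral>\<omega>. (norm (avg n (\<lambda>i. e k i \<omega>)))\<^sup>2 \<partial>M)) \<le> 3 * L * ?S"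
    using L_pos w_pos by (intro mult_left_mono sum_mono mean_sq_avg_error_le) (auto intro: less_imp_le)
  also have "\<dots> \<le> 3 * L * (8 / (3 * \<delta>) * (\<Sum>k\<le>K. w k * N k))"
    using S L_pos by (intro mult_left_mono) auto
  also have "\<dots> = 8 * L / \<delta> * (\<Sum>k\<le>K. w k * N k)"
    by simp
  also have "\<dots> = (\<Sum>k\<le>K. w k * (8 * L / \<delta> * N k))"
    unfolding sum_distrib_left by (intro sum.cong refl mult.left_commute)
  also have "\<dots> \<le> (\<Sum>k\<le>K. w k * (1 / 4 * mean_gap k + \<gamma> * D3))"
  proof (intro sum_mono mult_left_mono less_imp_le[OF w_pos])
    fix k
    have "8 * L / \<delta> * N k = 48 * L * Lc * \<gamma>\<^sup>2 * (2 + \<delta>) / \<delta>\<^sup>2 * mean_gap k + \<gamma> * D3"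
      using \<delta> by (simp add: N_def D3_def field_simps power2_eq_square)
    also have "48 * L * Lc * \<gamma>\<^sup>2 * (2 + \<delta>) / \<delta>\<^sup>2 * mean_gap k \<le> 1 / 4 * mean_gap k"
    proof -
      have nn: "0 \<le> L * \<gamma>\<^sup>2 * (Lc * mean_gap k)"
        using L_pos Lc_mean_gap_nonneg by simp
      have "192 * (2 + \<delta>) * (L * \<gamma>\<^sup>2 * (Lc * mean_gap k)) \<le> 192 * (2 + 3 * \<delta>) * (L * \<gamma>\<^sup>2 * (Lc * mean_gap k))"
        using \<delta> nn by (intro mult_right_mono) auto
      also have "\<dots> = 192 * L * Lc * (2 + 3 * \<delta>) * \<gamma>\<^sup>2 * mean_gap k"
        by (simp add: algebra_simps)
      also have "\<dots> \<le> \<delta>\<^sup>2 * mean_gap k"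
        by (rule mult_right_mono[OF step_error mean_gap_nonneg])
      finally show ?thesis using \<delta> by (simp add: field_simps)
    qed
    finally show "8 * L / \<delta> * N k \<le> 1 / 4 * mean_gap k + \<gamma> * D3" by simp
  qed
  also have "\<dots> = 1 / 4 * (\<Sum>k\<le>K. w k * mean_gap k) + \<gamma> * D3 * W K"
    by (simp add: W_def sum.distrib sum_distrib_left sum_distrib_right algebra_simps)
  finally show ?thesis .
qed

section \<open>Descent of the virtual iterate\<close>

text \<open>The virtual iterate, which follows uncompressed steps.\<close>

definition "virtual k \<omega> = x k \<omega> - avg n (\<lambda>i. e k i \<omega>)"
definition "mean_dist k = (\<integral>\<omega>. (norm (virtual k \<omega> - xs))\<^sup>2 \<partial>M)"

lemma virtual_Suc:
  assumes "\<omega> \<in> space M"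
  shows "virtual (Suc k) \<omega> = virtual k \<omega> - \<gamma> *\<^sub>R avg n (\<lambda>i. g k i \<omega>)"
proof -
  have "avg n (\<lambda>i. e (Suc k) i \<omega>) = avg n (\<lambda>i. e k i \<omega> + \<gamma> *\<^sub>R g k i \<omega> - v k i \<omega>)"
    using assms by (intro avg_cong) (simp add: e_Suc)
  then show ?thesis
    using assms by (simp add: virtual_def x_Suc avg_diff avg_add avg_scaleR)
qed

text \<open>Here \<open>y\<close> is the iterate and \<open>z\<close> the virtual one. Quasi strong convexity speaks about \<open>y - xs\<close>; replacing
it by \<open>z - xs\<close> in the inner product costs half of the gap and \<open>2 L \<bar>y - z\<bar>\<^sup>2\<close>, and in the quadratic term
\<open>\<mu> \<bar>y - z\<bar>\<^sup>2 \<le> L \<bar>y - z\<bar>\<^sup>2\<close>.\<close>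

lemma descent_inner:
  fixes y z :: 'a
  shows "- (2 * \<gamma>) * ((z - xs) \<bullet> grad f y)
    \<le> - \<eta> * (norm (z - xs))\<^sup>2 - \<gamma> * gap y + 3 * L * \<gamma> * (norm (y - z))\<^sup>2"
proof -
  have q: "gap y + \<mu> / 2 * (norm (y - xs))\<^sup>2 \<le> (y - xs) \<bullet> grad f y"
    using quasi[of y] by (simp add: gap_def inner_diff_left inner_diff_right inner_commute)
  have c: "2 * ((y - z) \<bullet> grad f y) \<le> gap y + 2 * L * (norm (y - z))\<^sup>2"
  proof -
    have "0 \<le> (norm (grad f y - (2 * L) *\<^sub>R (y - z)))\<^sup>2" by simp
    also have "\<dots> = (norm (grad f y))\<^sup>2 - 4 * L * ((y - z) \<bullet> grad f y) + 4 * L\<^sup>2 * (norm (y - z))\<^sup>2"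
      unfolding power2_norm_diff_scaleR by (simp add: inner_commute power2_eq_square)
    finally have "2 * L * (2 * ((y - z) \<bullet> grad f y)) \<le> 2 * L * (gap y + 2 * L * (norm (y - z))\<^sup>2)"
      using grad_sq_le_gap[of y] by (simp add: algebra_simps power2_eq_square)
    then show ?thesis using L_pos by simp
  qed
  have t: "\<mu> / 2 * (norm (z - xs))\<^sup>2 \<le> \<mu> * (norm (y - xs))\<^sup>2 + L * (norm (y - z))\<^sup>2"
  proof -
    have "(norm (z - xs))\<^sup>2 \<le> 2 * (norm (y - xs))\<^sup>2 + 2 * (norm (y - z))\<^sup>2"
      using norm_add_sq_young[of 1 "y - xs" "z - y"] by (simp add: norm_minus_commute)
    then have "\<mu> / 2 * (norm (z - xs))\<^sup>2 \<le> \<mu> / 2 * (2 * (norm (y - xs))\<^sup>2 + 2 * (norm (y - z))\<^sup>2)"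
      using \<mu> by (intro mult_left_mono) auto
    also have "\<dots> = \<mu> * (norm (y - xs))\<^sup>2 + \<mu> * (norm (y - z))\<^sup>2" by (simp add: algebra_simps)
    also have "\<mu> * (norm (y - z))\<^sup>2 \<le> L * (norm (y - z))\<^sup>2"
      using \<mu> by (intro mult_right_mono) auto
    finally show ?thesis by simp
  qed
  have "(z - xs) \<bullet> grad f y = (y - xs) \<bullet> grad f y - (y - z) \<bullet> grad f y"
    by (simp add: inner_diff_left)
  then have "- 2 * ((z - xs) \<bullet> grad f y)
      \<le> - (\<mu> / 2) * (norm (z - xs))\<^sup>2 - gap y + 3 * L * (norm (y - z))\<^sup>2"
    using q c t by (simp add: algebra_simps)
  from mult_left_mono[OF this, of \<gamma>] show ?thesis
    using \<gamma> by (simp add: \<eta>_def algebra_simps)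
qed

lemma mean_dist_step:
  "mean_dist (Suc k) \<le> (1 - \<eta>) * mean_dist k
    - (\<gamma> / 2 * mean_gap k - 3 * L * \<gamma> * (\<integral>\<omega>. (norm (avg n (\<lambda>i. e k i \<omega>)))\<^sup>2 \<partial>M) - \<gamma>\<^sup>2 * D1p)"
proof -
  let ?z = "\<lambda>\<omega>. virtual k \<omega> - xs" and ?g = "\<lambda>\<omega>. avg n (\<lambda>i. g k i \<omega>)"
    and ?e = "\<lambda>\<omega>. avg n (\<lambda>i. e k i \<omega>)"
  note sq_e = square_integrable_avg_e[of k]
  have sq_z: "square_integrable M ?z"
    unfolding virtual_def
    by (intro square_integrable_diff square_integrable_x sq_e square_integrable_const)
  have z_past: "?z \<in> borel_measurable (past k)"
    unfolding virtual_def avg_def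
    by (intro borel_measurable_diff borel_measurable_scaleR borel_measurable_sum borel_measurable_const
        x_past e_past) auto
  have int_z: "integrable M (\<lambda>\<omega>. (norm (?z \<omega>))\<^sup>2)" and int_g: "integrable M (\<lambda>\<omega>. (norm (?g \<omega>))\<^sup>2)"
    and int_e: "integrable M (\<lambda>\<omega>. (norm (?e \<omega>))\<^sup>2)"
    using sq_z square_integrable_avg_g sq_e unfolding square_integrable_def by blast+
  have int_zg: "integrable M (\<lambda>\<omega>. ?z \<omega> \<bullet> ?g \<omega>)"
    by (rule square_integrable_inner[OF sq_z square_integrable_avg_g])
  have int_zd: "integrable M (\<lambda>\<omega>. ?z \<omega> \<bullet> grad (obj i) (x k \<omega>))" if "i < n" for i
    by (rule square_integrable_inner[OF sq_z square_integrable_grad_x[OF that]])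
  have "(\<integral>\<omega>. ?z \<omega> \<bullet> ?g \<omega> \<partial>M) = avg n (\<lambda>i. \<integral>\<omega>. ?z \<omega> \<bullet> g k i \<omega> \<partial>M)"
    unfolding inner_avg by (intro integral_avg(2) square_integrable_inner sq_z square_integrable_g_run)
  also have "\<dots> = avg n (\<lambda>i. \<integral>\<omega>. ?z \<omega> \<bullet> grad (obj i) (x k \<omega>) \<partial>M)"
    by (intro avg_cong expectation_inner_g z_past sq_z)
  also have "\<dots> = (\<integral>\<omega>. ?z \<omega> \<bullet> grad f (x k \<omega>) \<partial>M)"
    unfolding grad_f inner_avg by (intro integral_avg(2)[symmetric] int_zd)
  finally have zg: "(\<integral>\<omega>. ?z \<omega> \<bullet> ?g \<omega> \<partial>M) = (\<integral>\<omega>. ?z \<omega> \<bullet> grad f (x k \<omega>) \<partial>M)" .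
  have int_zf: "integrable M (\<lambda>\<omega>. ?z \<omega> \<bullet> grad f (x k \<omega>))"
    unfolding grad_f inner_avg by (intro integral_avg(1) int_zd)
  have "mean_dist (Suc k) = (\<integral>\<omega>. (norm (?z \<omega>))\<^sup>2 - 2 * \<gamma> * (?z \<omega> \<bullet> ?g \<omega>) + \<gamma>\<^sup>2 * (norm (?g \<omega>))\<^sup>2 \<partial>M)"
    unfolding mean_dist_def
  proof (rule Bochner_Integration.integral_cong[OF refl])
    fix \<omega> assume "\<omega> \<in> space M"
    then have "virtual (Suc k) \<omega> - xs = ?z \<omega> - \<gamma> *\<^sub>R ?g \<omega>" by (simp add: virtual_Suc)
    also have "(norm \<dots>)\<^sup>2 = (norm (?z \<omega>))\<^sup>2 - 2 * \<gamma> * (?z \<omega> \<bullet> ?g \<omega>) + \<gamma>\<^sup>2 * (norm (?g \<omega>))\<^sup>2"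
      by (rule power2_norm_diff_scaleR)
    finally show "(norm (virtual (Suc k) \<omega> - xs))\<^sup>2
      = (norm (?z \<omega>))\<^sup>2 - 2 * \<gamma> * (?z \<omega> \<bullet> ?g \<omega>) + \<gamma>\<^sup>2 * (norm (?g \<omega>))\<^sup>2" .
  qed
  also have "\<dots> = mean_dist k - 2 * \<gamma> * (\<integral>\<omega>. ?z \<omega> \<bullet> grad f (x k \<omega>) \<partial>M) + \<gamma>\<^sup>2 * (\<integral>\<omega>. (norm (?g \<omega>))\<^sup>2 \<partial>M)"
    using int_z int_g int_zg zg by (simp add: mean_dist_def)
  finally have expand: "mean_dist (Suc k) = mean_dist k
      - 2 * \<gamma> * (\<integral>\<omega>. ?z \<omega> \<bullet> grad f (x k \<omega>) \<partial>M) + \<gamma>\<^sup>2 * (\<integral>\<omega>. (norm (?g \<omega>))\<^sup>2 \<partial>M)" .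
  have inner: "- 2 * \<gamma> * (\<integral>\<omega>. ?z \<omega> \<bullet> grad f (x k \<omega>) \<partial>M)
      \<le> - \<eta> * mean_dist k - \<gamma> * mean_gap k + 3 * L * \<gamma> * (\<integral>\<omega>. (norm (?e \<omega>))\<^sup>2 \<partial>M)"
  proof -
    have "- 2 * \<gamma> * (\<integral>\<omega>. ?z \<omega> \<bullet> grad f (x k \<omega>) \<partial>M) = (\<integral>\<omega>. - (2 * \<gamma>) * (?z \<omega> \<bullet> grad f (x k \<omega>)) \<partial>M)"
      by simp
    also have "\<dots> \<le> (\<integral>\<omega>. - \<eta> * (norm (?z \<omega>))\<^sup>2 - \<gamma> * gap (x k \<omega>) + 3 * L * \<gamma> * (norm (?e \<omega>))\<^sup>2 \<partial>M)"
    proof (rule integral_mono)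
      show "- (2 * \<gamma>) * (?z \<omega> \<bullet> grad f (x k \<omega>))
          \<le> - \<eta> * (norm (?z \<omega>))\<^sup>2 - \<gamma> * gap (x k \<omega>) + 3 * L * \<gamma> * (norm (?e \<omega>))\<^sup>2" for \<omega>
        using descent_inner[of "virtual k \<omega>" "x k \<omega>"] by (simp add: virtual_def)
    qed (use int_z int_e int_zf integrable_gap in auto)
    also have "\<dots> = - \<eta> * mean_dist k - \<gamma> * mean_gap k + 3 * L * \<gamma> * (\<integral>\<omega>. (norm (?e \<omega>))\<^sup>2 \<partial>M)"
      using int_z int_e integrable_gap by (simp add: mean_dist_def mean_gap_def)
    finally show ?thesis .
  qed
  have second: "\<gamma>\<^sup>2 * (\<integral>\<omega>. (norm (?g \<omega>))\<^sup>2 \<partial>M) \<le> \<gamma> / 2 * mean_gap k + \<gamma>\<^sup>2 * D1p"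
  proof -
    have "\<gamma>\<^sup>2 * (\<integral>\<omega>. (norm (?g \<omega>))\<^sup>2 \<partial>M) \<le> \<gamma>\<^sup>2 * (4 * Lc * mean_gap k + D1p)"
      by (intro mult_left_mono second_moment_le) simp
    also have "\<dots> = (8 * Lc * \<gamma>) * (\<gamma> / 2 * mean_gap k) + \<gamma>\<^sup>2 * D1p"
      by (simp add: algebra_simps power2_eq_square)
    also have "(8 * Lc * \<gamma>) * (\<gamma> / 2 * mean_gap k) \<le> 1 * (\<gamma> / 2 * mean_gap k)"
      using step_gradient \<gamma> mean_gap_nonneg by (intro mult_right_mono) auto
    finally show ?thesis by simp
  qed
  have "(1 - \<eta>) * mean_dist k = mean_dist k - \<eta> * mean_dist k"
    by (simp add: algebra_simps)
  then show ?thesis using expand inner second by linarith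
qed

lemma weighted_gap_le:
  "(\<Sum>k\<le>K. w k * mean_gap k) \<le> 4 / \<gamma> * (norm (x0 - xs))\<^sup>2 + 4 * \<gamma> * (D1p + D3) * W K"
proof -
  let ?E = "\<lambda>k. \<integral>\<omega>. (norm (avg n (\<lambda>i. e k i \<omega>)))\<^sup>2 \<partial>M"
  have "mean_dist 0 = (\<integral>\<omega>. (norm (x0 - xs))\<^sup>2 \<partial>M)"
    unfolding mean_dist_def
    by (intro Bochner_Integration.integral_cong refl) (simp add: virtual_def x_0 e_0 avg_def)
  then have d0: "mean_dist 0 = (norm (x0 - xs))\<^sup>2" by (simp add: prob_space)
  have "(\<Sum>k\<le>K. w k * (\<gamma> / 2 * mean_gap k - 3 * L * \<gamma> * ?E k - \<gamma>\<^sup>2 * D1p)) \<le> mean_dist 0"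
    using mean_dist_step less_imp_le[OF w_pos] w_Suc w_0
    by (rule weighted_sum_of_descent) (simp add: mean_dist_def)
  moreover have "(\<Sum>k\<le>K. w k * (\<gamma> / 2 * mean_gap k - 3 * L * \<gamma> * ?E k - \<gamma>\<^sup>2 * D1p))
      = \<gamma> / 2 * (\<Sum>k\<le>K. w k * mean_gap k) - \<gamma> * (3 * L * (\<Sum>k\<le>K. w k * ?E k)) - \<gamma>\<^sup>2 * D1p * W K"
    by (simp add: W_def sum_subtractf sum.distrib sum_distrib_left sum_distrib_right algebra_simps)
  moreover have "\<gamma> * (3 * L * (\<Sum>k\<le>K. w k * ?E k))
      \<le> \<gamma> * (1 / 4 * (\<Sum>k\<le>K. w k * mean_gap k) + \<gamma> * D3 * W K)"
    using \<gamma> by (intro mult_left_mono weighted_error_le) auto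
  ultimately have "\<gamma> / 4 * (\<Sum>k\<le>K. w k * mean_gap k) \<le> (norm (x0 - xs))\<^sup>2 + \<gamma>\<^sup>2 * (D1p + D3) * W K"
    unfolding d0 by (simp add: algebra_simps power2_eq_square)
  then have "4 / \<gamma> * (\<gamma> / 4 * (\<Sum>k\<le>K. w k * mean_gap k))
      \<le> 4 / \<gamma> * ((norm (x0 - xs))\<^sup>2 + \<gamma>\<^sup>2 * (D1p + D3) * W K)"
    using \<gamma> by (intro mult_left_mono) auto
  moreover have "4 / \<gamma> * (\<gamma>\<^sup>2 * (D1p + D3) * W K) = 4 * \<gamma> * (D1p + D3) * W K"
    using \<gamma> by (simp add: power2_eq_square)
  ultimately show ?thesis
    using \<gamma> by (simp add: distrib_left)
qed

definition "average_iterate K \<omega> = (1 / W K) *\<^sub>R (\<Sum>k\<le>K. w k *\<^sub>R x k \<omega>)"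

text \<open>Jensen's inequality, obtained from the tangent of \<open>f\<close> at the average: the linear terms cancel.\<close>

lemma gap_average_iterate_le:
  "gap (average_iterate K \<omega>) \<le> 1 / W K * (\<Sum>k\<le>K. w k * gap (x k \<omega>))"
proof -
  let ?y = "average_iterate K \<omega>"
  have "W K *\<^sub>R ?y = (\<Sum>k\<le>K. w k *\<^sub>R x k \<omega>)"
    using W_pos[of K] by (simp add: average_iterate_def)
  then have zero: "(\<Sum>k\<le>K. w k *\<^sub>R (x k \<omega> - ?y)) = 0"
    by (simp add: scaleR_diff_right sum_subtractf W_def scaleR_sum_left)
  have "W K * gap ?y = (\<Sum>k\<le>K. w k * gap ?y) + grad f ?y \<bullet> (\<Sum>k\<le>K. w k *\<^sub>R (x k \<omega> - ?y))"
    unfolding zero by (simp add: W_def sum_distrib_right)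
  also have "\<dots> = (\<Sum>k\<le>K. w k * (gap ?y + grad f ?y \<bullet> (x k \<omega> - ?y)))"
    by (simp add: inner_sum_right sum.distrib distrib_left)
  also have "\<dots> \<le> (\<Sum>k\<le>K. w k * gap (x k \<omega>))"
  proof (intro sum_mono mult_left_mono less_imp_le[OF w_pos])
    show "gap ?y + grad f ?y \<bullet> (x k \<omega> - ?y) \<le> gap (x k \<omega>)" for k
      using above_tangent[of ?y "x k \<omega>"] by (simp add: gap_def)
  qed
  finally show ?thesis using W_pos[of K] by (simp add: field_simps)
qed

lemma average_iterate_gap:
  shows integrable_average_gap: "integrable M (\<lambda>\<omega>. gap (average_iterate K \<omega>))"
    and mean_average_gap_le: "(\<integral>\<omega>. gap (average_iterate K \<omega>) \<partial>M)
      \<le> 1 / W K * (4 / \<gamma> * (norm (x0 - xs))\<^sup>2) + 4 * \<gamma> * (D1p + D3)"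
proof -
  let ?B = "\<lambda>\<omega>. 1 / W K * (\<Sum>k\<le>K. w k * gap (x k \<omega>))"
  have int_B: "integrable M ?B" using integrable_gap by auto
  show int: "integrable M (\<lambda>\<omega>. gap (average_iterate K \<omega>))"
  proof (rule Bochner_Integration.integrable_bound[OF int_B])
    show "(\<lambda>\<omega>. gap (average_iterate K \<omega>)) \<in> borel_measurable M"
      unfolding gap_def average_iterate_def by measurable
    show "AE \<omega> in M. norm (gap (average_iterate K \<omega>)) \<le> norm (?B \<omega>)"
    proof (rule AE_I2)
      fix \<omega>
      show "norm (gap (average_iterate K \<omega>)) \<le> norm (?B \<omega>)"
        using gap_average_iterate_le[of K \<omega>] gap_nonneg[of "average_iterate K \<omega>"]
        unfolding real_norm_def by linarith
    qed
  qed
  have "(\<integral>\<omega>. gap (average_iterate K \<omega>) \<partial>M) \<le> (\<integral>\<omega>. ?B \<omega> \<partial>M)"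
    by (intro integral_mono int int_B gap_average_iterate_le)
  also have "\<dots> = 1 / W K * (\<Sum>k\<le>K. w k * mean_gap k)"
    using integrable_gap by (simp add: mean_gap_def Bochner_Integration.integral_sum)
  also have "\<dots> \<le> 1 / W K * (4 / \<gamma> * (norm (x0 - xs))\<^sup>2 + 4 * \<gamma> * (D1p + D3) * W K)"
    using W_pos[of K] by (intro mult_left_mono weighted_gap_le) auto
  also have "\<dots> = 1 / W K * (4 / \<gamma> * (norm (x0 - xs))\<^sup>2) + 4 * \<gamma> * (D1p + D3)"
    using W_pos[of K] by (simp add: field_simps)
  finally show "(\<integral>\<omega>. gap (average_iterate K \<omega>) \<partial>M)
      \<le> 1 / W K * (4 / \<gamma> * (norm (x0 - xs))\<^sup>2) + 4 * \<gamma> * (D1p + D3)" .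
qed

lemma inverse_W_le: "1 / W K \<le> (1 - \<eta>) ^ K"
proof -
  have "w K \<le> W K" unfolding W_def
    by (intro member_le_sum) (auto intro: less_imp_le[OF w_pos])
  then have "1 / W K \<le> 1 / w K"
    using w_pos[of K] by (intro divide_left_mono) auto
  also have "\<dots> = (1 - \<eta>) * (1 - \<eta>) ^ K" by (simp add: w_def)
  also have "\<dots> \<le> 1 * (1 - \<eta>) ^ K"
    using \<eta> by (intro mult_right_mono) auto
  finally show ?thesis by simp
qed

section \<open>Parametric assumption and rate\<close>

definition params :: "'w ec_params" where
  "params = \<lparr> cA = 2 * Lc, cAt = 6 * Lc, cAp = 2 * Lc,
     cB1 = 0, cB1t = 0, cB1p = 0, cB2 = 0, cB2t = 0, cB2p = 0,
     cC1 = 0, cC2 = 0,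
     cD1 = D1, cD1t = D1t, cD1p = D1p, cD2 = 0, cD3 = D3,
     cF1 = 0, cF2 = 0, cG = 0, rho1 = 1, rho2 = 1,
     sig1 = (\<lambda>k \<omega>. 0), sig2 = (\<lambda>k \<omega>. 0) \<rparr>"

lemma params_simps [simp]:
  "cA params = 2 * Lc" "cAt params = 6 * Lc" "cAp params = 2 * Lc"
  "cB1 params = 0" "cB1t params = 0" "cB1p params = 0" "cB2 params = 0" "cB2t params = 0" "cB2p params = 0"
  "cC1 params = 0" "cC2 params = 0" "cD1 params = D1" "cD1t params = D1t" "cD1p params = D1p"
  "cD2 params = 0" "cD3 params = D3" "cF1 params = 0" "cF2 params = 0" "cG params = 0"
  "rho1 params = 1" "rho2 params = 1" "sig1 params k \<omega> = 0" "sig2 params k \<omega> = 0"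
  by (simp_all add: params_def)

lemma rate_params: "rate \<gamma> \<mu> params = \<eta>"
  using step_rate \<delta> by (simp add: rate_def \<eta>_def)

lemma weight_params: "weight \<gamma> \<mu> params k = w k"
  by (simp add: weight_def w_def rate_params)

lemma weight_sum_params: "weight_sum \<gamma> \<mu> params K = W K"
  by (simp add: weight_sum_def W_def weight_params)

lemma weighted_iterate_params: "weighted_iterate \<gamma> \<mu> params x K = average_iterate K"
  by (simp add: fun_eq_iff weighted_iterate_def average_iterate_def weight_params weight_sum_params)

lemma parametric_assumption_params:
  "parametric_assumption M past n f xs L \<gamma> \<mu> x e g params"
proof -
  interpret past_cond: finite_measure_subalgebra M "past k" for k by (rule past_subalgebra)
  have noise: "AE \<omega> in M. avg n (\<lambda>i. real_cond_exp M (past k)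
      (\<lambda>\<omega>'. (norm (g k i \<omega>' - vec_cond_exp M (past k) (g k i) \<omega>'))\<^sup>2) \<omega>)
    \<le> 2 * (6 * Lc) * (f (x k \<omega>) - f xs) + D1t" for k
  proof -
    have "AE \<omega> in M. \<forall>i\<in>{..<n}. real_cond_exp M (past k)
        (\<lambda>\<omega>'. (norm (g k i \<omega>' - vec_cond_exp M (past k) (g k i) \<omega>'))\<^sup>2) \<omega> = grad_var i (x k \<omega>)"
      using cond_exp_noise by (intro AE_finite_allI) auto
    then show ?thesis
    proof eventually_elim
      case (elim \<omega>)
      then have "avg n (\<lambda>i. real_cond_exp M (past k)
          (\<lambda>\<omega>'. (norm (g k i \<omega>' - vec_cond_exp M (past k) (g k i) \<omega>'))\<^sup>2) \<omega>)
          = avg n (\<lambda>i. grad_var i (x k \<omega>))"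
        by (intro avg_cong) auto
      also have "\<dots> \<le> D1t + 4 * (Lc * gap (x k \<omega>))"
        using avg_grad_var_le[of 1 "x k \<omega>"] by simp
      also have "\<dots> \<le> D1t + 12 * (Lc * gap (x k \<omega>))"
        using Lc_gap_nonneg[of "x k \<omega>"] by simp
      finally show ?case by (simp add: gap_def)
    qed
  qed
  have bias: "AE \<omega> in M. avg n (\<lambda>i. (norm (vec_cond_exp M (past k) (g k i) \<omega>))\<^sup>2)
    \<le> 2 * (2 * Lc) * (f (x k \<omega>) - f xs) + D1" for k
  proof -
    have "AE \<omega> in M. \<forall>i\<in>{..<n}. vec_cond_exp M (past k) (g k i) \<omega> = grad (obj i) (x k \<omega>)"
      using cond_exp_g by (intro AE_finite_allI) auto
    then show ?thesis
    proof eventually_elim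
      case (elim \<omega>)
      then have "avg n (\<lambda>i. (norm (vec_cond_exp M (past k) (g k i) \<omega>))\<^sup>2)
          = avg n (\<lambda>i. (norm (grad (obj i) (x k \<omega>)))\<^sup>2)"
        by (intro avg_cong) auto
      also have "\<dots> \<le> D1 + 4 * (Lc * gap (x k \<omega>))"
        using avg_grad_sq_le[of 1 "x k \<omega>"] by simp
      finally show ?case by (simp add: gap_def)
    qed
  qed
  have zero: "AE \<omega> in M. real_cond_exp M (past k) (\<lambda>_. 0) \<omega> \<le> 0" for k
  proof -
    have "AE \<omega> in M. real_cond_exp M (past k) (\<lambda>_. 0) \<omega> = 0"
      by (rule past_cond.real_cond_exp_F_meas) auto
    then show ?thesis by eventually_elim simp
  qed
  have "integrable M (g k i)" "integrable M (\<lambda>\<omega>. (norm (g k i \<omega> - vec_cond_exp M (past k) (g k i) \<omega>))\<^sup>2)"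
    if "i < n" for k i
    using square_integrable_integrable[OF square_integrable_g_run[OF that]] square_integrable_noise[OF that]
    unfolding square_integrable_def by blast+
  moreover have "integrable M (\<lambda>\<omega>. (norm (avg n (\<lambda>i. g k i \<omega>)))\<^sup>2)" for k
    using square_integrable_avg_g unfolding square_integrable_def by blast
  moreover have "integrable M (\<lambda>\<omega>. (norm (avg n (\<lambda>i. e k i \<omega>)))\<^sup>2)" for k
    using square_integrable_avg_e unfolding square_integrable_def by blast
  moreover have "integrable M (\<lambda>\<omega>. f (x k \<omega>) - f xs)" for k
    using integrable_gap by (simp add: gap_def)
  ultimately show ?thesis
    unfolding parametric_assumption_def Let_def
    using cond_exp_avg_g noise bias zero cond_second_moment_le weighted_error_le
    by (simp add: gap_def mean_gap_def weight_params weight_sum_params)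
qed

lemma noise_eq: "4 * \<gamma> * (D1p + D3) = 4 * \<gamma> * (D1p + 12 * L * \<gamma> / \<delta>\<^sup>2 * D1 + 6 * L * \<gamma> / \<delta> * D1t)"
  using \<delta> by (simp add: D3_def field_simps power2_eq_square)

theorem ec_sgd_rate:
  "integrable M (\<lambda>\<omega>. f (weighted_iterate \<gamma> \<mu> params x K \<omega>) - f xs)"
  "(\<integral>\<omega>. f (weighted_iterate \<gamma> \<mu> params x K \<omega>) - f xs \<partial>M)
    \<le> (1 - \<gamma> * \<mu> / 2) ^ K * (4 * (norm (x0 - xs))\<^sup>2 / \<gamma>) + 4 * \<gamma> * (D1p + D3)"
  "\<mu> = 0 \<Longrightarrow> 0 < K \<Longrightarrow> (\<integral>\<omega>. f (weighted_iterate \<gamma> \<mu> params x K \<omega>) - f xs \<partial>M)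
    \<le> 4 * (norm (x0 - xs))\<^sup>2 / (real K * \<gamma>) + 4 * \<gamma> * (D1p + D3)"
proof -
  show "integrable M (\<lambda>\<omega>. f (weighted_iterate \<gamma> \<mu> params x K \<omega>) - f xs)"
    using integrable_average_gap[of K] by (simp add: weighted_iterate_params gap_def)
  have main: "(\<integral>\<omega>. f (weighted_iterate \<gamma> \<mu> params x K \<omega>) - f xs \<partial>M)
    \<le> 1 / W K * (4 / \<gamma> * (norm (x0 - xs))\<^sup>2) + 4 * \<gamma> * (D1p + D3)"
    using mean_average_gap_le[of K] by (simp add: weighted_iterate_params gap_def)
  also have "1 / W K * (4 / \<gamma> * (norm (x0 - xs))\<^sup>2) \<le> (1 - \<eta>) ^ K * (4 / \<gamma> * (norm (x0 - xs))\<^sup>2)"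
    using \<gamma> by (intro mult_right_mono inverse_W_le) auto
  finally show "(\<integral>\<omega>. f (weighted_iterate \<gamma> \<mu> params x K \<omega>) - f xs \<partial>M)
    \<le> (1 - \<gamma> * \<mu> / 2) ^ K * (4 * (norm (x0 - xs))\<^sup>2 / \<gamma>) + 4 * \<gamma> * (D1p + D3)"
    by (simp add: \<eta>_def)
  assume "\<mu> = 0" and K: "0 < K"
  then have "\<eta> = 0" unfolding \<eta>_def by simp
  then have "W K = real K + 1" by (simp add: W_def w_def)
  then have "1 / W K * (4 / \<gamma> * (norm (x0 - xs))\<^sup>2) \<le> 1 / real K * (4 / \<gamma> * (norm (x0 - xs))\<^sup>2)"
    using \<gamma> K by (intro mult_right_mono divide_left_mono) auto
  then show "(\<integral>\<omega>. f (weighted_iterate \<gamma> \<mu> params x K \<omega>) - f xs \<partial>M)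
    \<le> 4 * (norm (x0 - xs))\<^sup>2 / (real K * \<gamma>) + 4 * \<gamma> * (D1p + D3)"
    using main by simp
qed

end

lemma step_size_bounds:
  fixes \<gamma> \<delta> L s :: real
  assumes "0 < \<gamma>" "0 < L" "1 \<le> s" "\<gamma> \<le> \<delta> / (8 * L * sqrt s)"
  shows "8 * L * \<gamma> \<le> \<delta>" "64 * L\<^sup>2 * s * \<gamma>\<^sup>2 \<le> \<delta>\<^sup>2"
proof -
  have s: "1 \<le> sqrt s" using assms(3) by simp
  have le: "8 * L * \<gamma> * sqrt s \<le> \<delta>"
    using assms s by (simp add: pos_le_divide_eq mult.commute mult.left_commute)
  have "8 * L * \<gamma> * 1 \<le> 8 * L * \<gamma> * sqrt s"
    using s assms by (intro mult_left_mono) auto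
  then show "8 * L * \<gamma> \<le> \<delta>" using le by simp
  have "(8 * L * \<gamma> * sqrt s)\<^sup>2 \<le> \<delta>\<^sup>2"
    using le assms by (intro power_mono) auto
  then show "64 * L\<^sup>2 * s * \<gamma>\<^sup>2 \<le> \<delta>\<^sup>2"
    using assms(3) by (simp add: power_mult_distrib mult.commute mult.left_commute)
qed

theorem theoremJ2:
  fixes M :: "'w measure" and \<D> :: "nat \<Rightarrow> 'z measure" and R :: "'r measure"
    and F :: "'z \<Rightarrow> 'a::euclidean_space \<Rightarrow> real" and C :: "'r \<Rightarrow> 'a \<Rightarrow> 'a"
    and \<xi> :: "nat \<Rightarrow> nat \<Rightarrow> 'w \<Rightarrow> 'z" and \<zeta> :: "nat \<Rightarrow> nat \<Rightarrow> 'w \<Rightarrow> 'r"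
    and x :: "nat \<Rightarrow> 'w \<Rightarrow> 'a" and e g v :: "nat \<Rightarrow> nat \<Rightarrow> 'w \<Rightarrow> 'a"
    and f :: "'a \<Rightarrow> real" and x0 xs :: 'a and n :: nat
    and L \<mu> \<gamma> \<delta> \<kappa> D1 D1t D1p D3 noise :: real
    and P :: "real \<Rightarrow> real \<Rightarrow> 'w ec_params"
  assumes problem: "stochastic_problem n \<D> F L"
    and f_def: "f = global_obj n \<D> F"
    and compressor: "compression_operator R C \<delta>"
    and fresh: "fresh_randomness M n \<D> R \<xi> \<zeta>"
    and run: "ec_sgd M n F C \<gamma> x0 \<xi> \<zeta> x e g v"
    and variance_finite: "\<forall>i<n. integrable (\<D> i)
          (\<lambda>z. (norm (grad (F z) xs - grad (local_obj \<D> F i) xs))\<^sup>2)"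
    and D1_def: "D1 = 2 / real n * (\<Sum>i<n. (norm (grad (local_obj \<D> F i) xs))\<^sup>2)"
    and D1t_def: "D1t = 2 / real n *
          (\<Sum>i<n. \<integral>z. (norm (grad (F z) xs - grad (local_obj \<D> F i) xs))\<^sup>2 \<partial>\<D> i)"
    and D1p_def: "D1p = 2 / (real n)\<^sup>2 *
          (\<Sum>i<n. \<integral>z. (norm (grad (F z) xs - grad (local_obj \<D> F i) xs))\<^sup>2 \<partial>\<D> i)"
    and D3_def: "D3 = 6 * L * \<gamma> / \<delta> * (2 * D1 / \<delta> + D1t)"
    and noise_def: "noise = 4 * \<gamma> * (D1p + 12 * L * \<gamma> / \<delta>\<^sup>2 * D1 + 6 * L * \<gamma> / \<delta> * D1t)"
    and \<kappa>_def: "\<kappa> = L / \<mu>"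
    and P_def: "P = (\<lambda>a b.
          \<lparr> cA = a, cAt = b, cAp = a,
            cB1 = 0, cB1t = 0, cB1p = 0, cB2 = 0, cB2t = 0, cB2p = 0,
            cC1 = 0, cC2 = 0,
            cD1 = D1, cD1t = D1t, cD1p = D1p, cD2 = 0, cD3 = D3,
            cF1 = 0, cF2 = 0, cG = 0, rho1 = 1, rho2 = 1,
            sig1 = (\<lambda>k \<omega>. 0), sig2 = (\<lambda>k \<omega>. 0) \<rparr>)"
  shows
    "((\<forall>i<n. \<forall>z\<in>space (\<D> i). convex_on UNIV (F z) \<and> L_smooth L (F z)) \<and>
       0 \<le> \<mu> \<and> quasi_strongly_convex \<mu> f xs \<and>
       0 < \<gamma> \<and> \<gamma> \<le> \<delta> / (8 * L * sqrt (6 + 9 * \<delta>)) \<longrightarrow>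
        parametric_assumption M (history M n \<D> R \<xi> \<zeta>) n f xs L \<gamma> \<mu> x e g (P (2 * L) (6 * L)) \<and>
        (\<forall>K. integrable M (\<lambda>\<omega>. f (weighted_iterate \<gamma> \<mu> (P (2 * L) (6 * L)) x K \<omega>) - f xs) \<and>
          (0 < \<mu> \<longrightarrow>
            (\<integral>\<omega>. f (weighted_iterate \<gamma> \<mu> (P (2 * L) (6 * L)) x K \<omega>) - f xs \<partial>M)
              \<le> (1 - \<gamma> * \<mu> / 2) ^ K * (4 * (norm (x0 - xs))\<^sup>2 / \<gamma>) + noise) \<and>
          (\<mu> = 0 \<and> 0 < K \<longrightarrow>
            (\<integral>\<omega>. f (weighted_iterate \<gamma> \<mu> (P (2 * L) (6 * L)) x K \<omega>) - f xs \<partial>M)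
              \<le> 4 * (norm (x0 - xs))\<^sup>2 / (real K * \<gamma>) + noise)))
     \<and>
     (0 < \<mu> \<and> strongly_convex \<mu> f \<and> (\<forall>y. f xs \<le> f y) \<and>
       0 < \<gamma> \<and> \<gamma> \<le> min (1 / (8 * \<kappa> * L)) (\<delta> / (8 * L * sqrt (3 * \<kappa> * (2 + 3 * \<delta>)))) \<longrightarrow>
        parametric_assumption M (history M n \<D> R \<xi> \<zeta>) n f xs L \<gamma> \<mu> x e g
          (P (2 * L * \<kappa>) (6 * L * \<kappa>)) \<and>
        (\<forall>K. integrable M (\<lambda>\<omega>. f (weighted_iterate \<gamma> \<mu> (P (2 * L * \<kappa>) (6 * L * \<kappa>)) x K \<omega>) - f xs) \<and>
          (\<integral>\<omega>. f (weighted_iterate \<gamma> \<mu> (P (2 * L * \<kappa>) (6 * L * \<kappa>)) x K \<omega>) - f xs \<partial>M)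
            \<le> (1 - \<gamma> * \<mu> / 2) ^ K * (4 * (norm (x0 - xs))\<^sup>2 / \<gamma>) + noise))"
proof -
  interpret ec_sgd_run M \<D> R F C \<xi> \<zeta> x e g v f x0 xs n L \<gamma> \<delta>
    using problem f_def compressor fresh run variance_finite by unfold_locales auto
  obtain b :: 'a where "b \<in> Basis" using nonempty_Basis by blast
  then have b: "xs + b \<noteq> xs" using nonzero_Basis by auto
  (* the convergence estimates as a function of Lc, to be instantiated with L and with L * \<kappa> *)
  define Q where "Q Lc K \<longleftrightarrow>
      integrable M (\<lambda>\<omega>. f (weighted_iterate \<gamma> \<mu> (P (2 * Lc) (6 * Lc)) x K \<omega>) - f xs) \<and>
      (\<integral>\<omega>. f (weighted_iterate \<gamma> \<mu> (P (2 * Lc) (6 * Lc)) x K \<omega>) - f xs \<partial>M)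
        \<le> (1 - \<gamma> * \<mu> / 2) ^ K * (4 * (norm (x0 - xs))\<^sup>2 / \<gamma>) + noise \<and>
      (\<mu> = 0 \<and> 0 < K \<longrightarrow>
        (\<integral>\<omega>. f (weighted_iterate \<gamma> \<mu> (P (2 * Lc) (6 * Lc)) x K \<omega>) - f xs \<partial>M)
          \<le> 4 * (norm (x0 - xs))\<^sup>2 / (real K * \<gamma>) + noise)" for Lc K
  have conclude: "parametric_assumption M (history M n \<D> R \<xi> \<zeta>) n f xs L \<gamma> \<mu> x e g (P (2 * Lc) (6 * Lc)) \<and> (\<forall>K. Q Lc K)"
    if conv: "ec_sgd_convergence M \<D> R F C \<xi> \<zeta> x e g v f x0 xs n L \<gamma> \<delta> \<mu> Lc" for Lc
  proof -
    interpret run: ec_sgd_convergence M \<D> R F C \<xi> \<zeta> x e g v f x0 xs n L \<gamma> \<delta> \<mu> Lc by (rule conv)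
    have D: "run.D1 = D1" "run.D1t = D1t" "run.D1p = D1p"
      unfolding run.D1_def run.D1t_def run.D1p_def D1_def D1t_def D1p_def grad_var_def by simp_all
    then have D3: "run.D3 = D3" unfolding run.D3_def D3_def by simp
    have P: "P (2 * Lc) (6 * Lc) = run.params"
      unfolding P_def run.params_def D D3 ..
    have noise: "noise = 4 * \<gamma> * (run.D1p + run.D3)"
      using run.noise_eq unfolding noise_def D by (rule sym)
    show ?thesis
      unfolding Q_def P noise using run.parametric_assumption_params run.ec_sgd_rate by blast
  qed
  show ?thesis
  proof (intro conjI impI; elim conjE)
    assume conv: "\<forall>i<n. \<forall>z\<in>space (\<D> i). convex_on UNIV (F z) \<and> L_smooth L (F z)"
      and \<mu>: "0 \<le> \<mu>" and qsc: "quasi_strongly_convex \<mu> f xs"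
      and \<gamma>: "0 < \<gamma>" "\<gamma> \<le> \<delta> / (8 * L * sqrt (6 + 9 * \<delta>))"
    have argmin: "{y. \<forall>x. f y \<le> f x} = {xs}"
      and quasi: "f y + grad f y \<bullet> (xs - y) + \<mu> / 2 * (norm (y - xs))\<^sup>2 \<le> f xs" for y
      using qsc unfolding quasi_strongly_convex_def by auto
    have minimum: "f xs \<le> f y" for y using argmin by blast
    (* uniqueness of the minimizer provides a point with positive gap *)
    have "xs + b \<notin> {y. \<forall>x. f y \<le> f x}" unfolding argmin using b by simp
    then obtain y where "f y < f (xs + b)" by (auto simp: not_le)
    then have "f xs < f (xs + b)" using minimum[of y] by simp
    then have \<mu>_le: "\<mu> \<le> L" by (rule growth_le_smoothness[OF minimum quasi _ \<mu>])
    have step: "8 * L * \<gamma> \<le> \<delta>" "64 * L\<^sup>2 * (6 + 9 * \<delta>) * \<gamma>\<^sup>2 \<le> \<delta>\<^sup>2"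
      using step_size_bounds[OF \<gamma>(1) L_pos _ \<gamma>(2)] \<delta> by auto
    have "ec_sgd_convergence M \<D> R F C \<xi> \<zeta> x e g v f x0 xs n L \<gamma> \<delta> \<mu> L"
    proof
      show "f y + grad f y \<bullet> (y' - y) \<le> f y'" for y y'
        using conv by (intro above_tangent_convex) auto
      show "avg n (\<lambda>i. grad_dev i y) \<le> 2 * L * (f y - f xs)" for y
        using conv by (intro grad_dev_le_convex minimum) auto
      show "8 * L * \<gamma> \<le> 1" using step(1) \<delta> by simp
      have "4 * (\<gamma> * \<mu>) \<le> 4 * (\<gamma> * L)" using \<gamma> \<mu>_le by simp
      also have "\<dots> \<le> 8 * L * \<gamma>" using \<gamma> L_pos by simp
      finally show "4 * \<gamma> * \<mu> \<le> \<delta>" using step(1) by simp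
      show "192 * L * L * (2 + 3 * \<delta>) * \<gamma>\<^sup>2 \<le> \<delta>\<^sup>2"
        using step(2) by (simp add: power2_eq_square algebra_simps)
    qed (fact minimum quasi \<mu> \<mu>_le \<gamma>(1))+
    from conclude[OF this]
    show "parametric_assumption M (history M n \<D> R \<xi> \<zeta>) n f xs L \<gamma> \<mu> x e g (P (2 * L) (6 * L))"
      and "\<forall>K. integrable M (\<lambda>\<omega>. f (weighted_iterate \<gamma> \<mu> (P (2 * L) (6 * L)) x K \<omega>) - f xs) \<and>
          (0 < \<mu> \<longrightarrow>
            (\<integral>\<omega>. f (weighted_iterate \<gamma> \<mu> (P (2 * L) (6 * L)) x K \<omega>) - f xs \<partial>M)
              \<le> (1 - \<gamma> * \<mu> / 2) ^ K * (4 * (norm (x0 - xs))\<^sup>2 / \<gamma>) + noise) \<and>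
          (\<mu> = 0 \<and> 0 < K \<longrightarrow>
            (\<integral>\<omega>. f (weighted_iterate \<gamma> \<mu> (P (2 * L) (6 * L)) x K \<omega>) - f xs \<partial>M)
              \<le> 4 * (norm (x0 - xs))\<^sup>2 / (real K * \<gamma>) + noise)"
      unfolding Q_def by blast+
  next
    assume \<mu>: "0 < \<mu>" and sc: "strongly_convex \<mu> f" and min: "\<forall>y. f xs \<le> f y"
      and \<gamma>: "0 < \<gamma>" "\<gamma> \<le> min (1 / (8 * \<kappa> * L)) (\<delta> / (8 * L * sqrt (3 * \<kappa> * (2 + 3 * \<delta>))))"
    have minimum: "f xs \<le> f y" for y using min by blast
    have lower: "f y + grad f y \<bullet> (y' - y) + \<mu> / 2 * (norm (y' - y))\<^sup>2 \<le> f y'" for y y'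
      using sc unfolding strongly_convex_def by blast
    have quasi: "f y + grad f y \<bullet> (xs - y) + \<mu> / 2 * (norm (y - xs))\<^sup>2 \<le> f xs" for y
      using lower[of y xs] by (simp add: norm_minus_commute)
    have growth: "\<mu> / 2 * (norm (y - xs))\<^sup>2 \<le> f y - f xs" for y
      using lower[of xs y] by (simp add: grad_at_minimum[OF minimum])
    have "0 < \<mu> / 2 * (norm (xs + b - xs))\<^sup>2" using \<mu> b by simp
    then have "f xs < f (xs + b)" using growth[of "xs + b"] by linarith
    then have \<mu>_le: "\<mu> \<le> L" using \<mu> by (intro growth_le_smoothness[OF minimum quasi]) auto
    then have \<kappa>: "1 \<le> \<kappa>" using \<mu> by (simp add: \<kappa>_def)
    have "1 * 1 \<le> (3 * \<kappa>) * (2 + 3 * \<delta>)" using \<kappa> \<delta> by (intro mult_mono) auto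
    then have step: "8 * L * \<gamma> \<le> \<delta>" "64 * L\<^sup>2 * (3 * \<kappa> * (2 + 3 * \<delta>)) * \<gamma>\<^sup>2 \<le> \<delta>\<^sup>2"
      using step_size_bounds[OF \<gamma>(1) L_pos, of "3 * \<kappa> * (2 + 3 * \<delta>)" \<delta>] \<gamma>(2) by auto
    have "ec_sgd_convergence M \<D> R F C \<xi> \<zeta> x e g v f x0 xs n L \<gamma> \<delta> \<mu> (L * \<kappa>)"
    proof
      show "f y + grad f y \<bullet> (y' - y) \<le> f y'" for y y'
      proof -
        have "0 \<le> \<mu> / 2 * (norm (y' - y))\<^sup>2" using \<mu> by simp
        then show ?thesis using lower[of y y'] by linarith
      qed
      show "avg n (\<lambda>i. grad_dev i y) \<le> 2 * (L * \<kappa>) * (f y - f xs)" for y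
      proof -
        have "L\<^sup>2 * (norm (y - xs))\<^sup>2 = 2 * (L * \<kappa>) * (\<mu> / 2 * (norm (y - xs))\<^sup>2)"
          using \<mu> by (simp add: \<kappa>_def power2_eq_square)
        also have "\<dots> \<le> 2 * (L * \<kappa>) * (f y - f xs)"
          using \<kappa> L_pos by (intro mult_left_mono growth) auto
        finally show ?thesis using grad_dev_le_lipschitz[of y] by linarith
      qed
      have "\<gamma> \<le> 1 / (8 * \<kappa> * L)" using \<gamma>(2) by simp
      then show "8 * (L * \<kappa>) * \<gamma> \<le> 1"
        using \<kappa> L_pos by (simp add: pos_le_divide_eq mult_ac)
      have "4 * (\<gamma> * \<mu>) \<le> 4 * (\<gamma> * L)" using \<gamma> \<mu>_le by simp
      also have "\<dots> \<le> 8 * L * \<gamma>" using \<gamma> L_pos by simp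
      finally show "4 * \<gamma> * \<mu> \<le> \<delta>" using step(1) by simp
      show "192 * L * (L * \<kappa>) * (2 + 3 * \<delta>) * \<gamma>\<^sup>2 \<le> \<delta>\<^sup>2"
        using step(2) by (simp add: power2_eq_square algebra_simps)
      show "0 \<le> \<mu>" using \<mu> by simp
    qed (fact minimum quasi \<mu>_le \<gamma>(1))+
    from conclude[OF this]
    show "parametric_assumption M (history M n \<D> R \<xi> \<zeta>) n f xs L \<gamma> \<mu> x e g
          (P (2 * L * \<kappa>) (6 * L * \<kappa>))"
      and "\<forall>K. integrable M (\<lambda>\<omega>. f (weighted_iterate \<gamma> \<mu> (P (2 * L * \<kappa>) (6 * L * \<kappa>)) x K \<omega>) - f xs) \<and>
          (\<integral>\<omega>. f (weighted_iterate \<gamma> \<mu> (P (2 * L * \<kappa>) (6 * L * \<kappa>)) x K \<omega>) - f xs \<partial>M)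
            \<le> (1 - \<gamma> * \<mu> / 2) ^ K * (4 * (norm (x0 - xs))\<^sup>2 / \<gamma>) + noise"
      unfolding Q_def mult.assoc[of 2 L \<kappa>] mult.assoc[of 6 L \<kappa>] by blast+
  qed
qed

end
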